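(* There exist a sequence of flat rectangular tori $T_{1,R_k}:=\mathbb R^2/2\pi(\mathbb Z\oplus R_k\mathbb Z)$ with $R_k\to\infty$, and a sequence of conformal Hamiltonian stationary Legendrian embeddings $u_k:T_{1,R_k}\to S^5\subset\mathbb C^3$ ($S^5$ being equipped with the round metric and the canonical contact form), such that the varifolds $\mathbf v_k$ induced by the parametrized Hamiltonian stationary Legendrian varifolds $(T_{1,R_k},u_k,1)$ converge to a non-rectifiable Hamiltonian stationary Legendrian varifold. More precisely, letting $\mathfrak H:S^5\to\mathbb{CP}^2$ be the Hopf fibration and $\mathcal C:=\mathfrak H^{-1}([0,0,1])=\{(0,0,e^{i\beta}):\beta\in\mathbb R/2\pi\mathbb Z\}$ one of its fibers, $$\mathbf v_k\rightharpoonup 2\pi\cdot\mu(e^{i\beta})\otimes(\mathcal H^1\llcorner\mathcal C)(0,0,e^{i\beta}),$$ where $\mu(e^{i\beta})$ is the uniform (probability) measure on the set of Legendrian planes in $T_{(0,0,e^{i\beta})}S^5$ $$\mathfrak P(e^{i\beta}):=\{(e^{i\beta})_*\mathcal P_{\tau,\eta}:(\tau,\eta)\in(\mathbb R/2\pi\mathbb Z)^2\},$$ with $\mathcal P_{\tau,\eta}:=\mathrm{span}\{(\cos\tau)e_1+(\sin\tau)e_2,\ (\cos\eta)e_3+(\sin\eta)e_4\}\subset T_{(0,0,1)}S^5$ and $(e^{i\beta})_*\mathcal P_{\tau,\eta}\subset T_{(0,0,e^{i\beta})}S^5$ its image under the differential of $x\mapsto e^{i\beta}x$.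
   Context: $\mathbb C^3\cong\mathbb R^6$ has real coordinates $(x_1,\dots,x_6)$ and standard basis $e_1,\dots,e_6$ (complex coordinates $w_\ell=x_{2\ell-1}+ix_{2\ell}$). The canonical contact form on $S^5$ is the restriction of $\alpha=\sum_{\ell=1}^3(x_{2\ell-1}dx_{2\ell}-x_{2\ell}dx_{2\ell-1})$; $H=\ker\alpha$. A map $u$ into $S^5$ is Legendrian if $u^*\alpha=0$. A Legendrian plane at $p\in S^5$ is a $2$-plane $\mathcal P\subset H_p$ with $d\alpha|_{\mathcal P}=0$; $\Pi:G\to S^5$ is the bundle of such planes. A Legendrian varifold is a Radon measure on $G$, with weight $|\mathbf v|=\Pi_*\mathbf v$; convergence is weak-$*$ convergence of measures on $G$. For $F\in C^\infty(S^5)$, the Hamiltonian vector field $W_F$ is the unique vector field with $\alpha(W_F)=F$ whose flow preserves $H$. A varifold $\mathbf v$ is Hamiltonian stationary Legendrian if $\int_G\mathrm{div}_{\mathcal P}W_F\,d\mathbf v(\mathcal P,p)=0$ for all $F\in C^\infty(S^5)$, where $\mathrm{div}_{\mathcal P}W=\sum_j\langle\nabla_{Z_j}W,Z_j\rangle$ for an orthonormal basis $(Z_1,Z_2)$ of $\mathcal P$. A Legendrian immersion is Hamiltonian stationary if it is critical for the area with respect to (locally supported) variations by Hamiltonian vector fields. A triple $(\Sigma,u,N)$, with $\Sigma$ a Riemann surface, $u\in W^{1,2}_{loc}(\Sigma,S^5)$ Legendrian and weakly conformal, $N\in L^\infty_{loc}(\Sigma,\mathbb N^* )$, is a parametrized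 Hamiltonian stationary Legendrian varifold (PHSLV) if for every $f\in C^\infty_c(\Sigma,[0,\infty))$, for a.e. $t>0$ and for every smooth $F$ with $\mathrm{spt}(F)\subset S^5\setminus u(f^{-1}(t))$ one has $\int_{\{f>t\}}N\,\nabla(W_F\circ u)\cdot\nabla u\,dx^2=0$ (local conformal coordinates). For closed $\Sigma$ the induced varifold is $\mathbf v(B)=\int_{\{x:(\mathrm{img}\nabla u(x),u(x))\in B\}}N\frac{|\nabla u|^2}{2}dx^2$. A varifold is rectifiable if its weight is $\vartheta\mathcal H^2\llcorner M$ with $M$ countably $2$-rectifiable, $\vartheta>0$, and its planes are a.e. the approximate tangent planes of $M$. Concretely, the displayed limit $\mathbf v_\infty$ acts on $\Phi\in C(G)$ by $\langle\mathbf v_\infty,\Phi\rangle=2\pi\int_0^{2\pi}\frac1{4\pi^2}\int_{[0,2\pi]^2}\Phi\big((e^{i\beta})_*\mathcal P_{\tau,\eta},(0,0,e^{i\beta})\big)\,d\tau\,d\eta\,d\beta$. *)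

theory Defs
  imports "HOL-Analysis.Analysis"
begin

primrec Ck_on :: "nat \<Rightarrow> 'a::euclidean_space set \<Rightarrow> ('a \<Rightarrow> 'b::real_normed_vector) \<Rightarrow> bool" where
  "Ck_on 0 U f \<longleftrightarrow> continuous_on U f"
| "Ck_on (Suc k) U f \<longleftrightarrow> (\<forall>x\<in>U. f differentiable (at x)) \<and>
     (\<forall>v. Ck_on k U (\<lambda>x. frechet_derivative f (at x) v))"

text \<open>Smoothness on an arbitrary set, in particular on a closed submanifold of a Euclidean space:
  existence of a smooth extension to an open neighbourhood.\<close>

definition smooth_on :: "'a::euclidean_space set \<Rightarrow> ('a \<Rightarrow> 'b::real_normed_vector) \<Rightarrow> bool" where
  "smooth_on S f \<longleftrightarrow> (\<exists>U g. open U \<and> S \<subseteq> U \<and> (\<forall>k. Ck_on k U g) \<and> (\<forall>x\<in>S. g x = f x))"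

text \<open>The type \<open>complex ^ 3\<close> carries the real inner product of \<open>\<real>\<^sup>6\<close>; all notions
  such as \<open>span\<close>, \<open>subspace\<close>, \<open>dim\<close> are taken over the reals.\<close>

type_synonym C3 = "complex ^ 3"

abbreviation S5 :: "C3 set" where "S5 \<equiv> sphere 0 1"

text \<open>\<open>alpha p v\<close> is the one-form \<open>\<alpha>\<close> at the base point \<open>p\<close> applied to \<open>v\<close>.\<close>

definition alpha :: "C3 \<Rightarrow> C3 \<Rightarrow> real" where
  "alpha p v = (\<Sum>l\<in>UNIV. Re (p $ l) * Im (v $ l) - Im (p $ l) * Re (v $ l))"

text \<open>The coefficients of \<open>\<alpha>\<close> are linear in the base point, so
  \<open>d\<alpha>(v,w) = D\<^sub>v\<alpha>(w) - D\<^sub>w\<alpha>(v)\<close> reads as follows, at every base point.\<close>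

definition dalpha :: "C3 \<Rightarrow> C3 \<Rightarrow> real" where
  "dalpha v w = alpha v w - alpha w v"

definition horizontal :: "C3 \<Rightarrow> C3 set" where
  "horizontal p = {v. p \<bullet> v = 0 \<and> alpha p v = 0}"

text \<open>Derivative of a map defined on \<open>S5\<close> along a vector tangent to \<open>S5\<close>. The derivative within
  the sphere is unique on tangent vectors only, and is used only there.\<close>

definition dS5 :: "(C3 \<Rightarrow> 'b::real_normed_vector) \<Rightarrow> C3 \<Rightarrow> C3 \<Rightarrow> 'b" where
  "dS5 f p v = frechet_derivative f (at p within S5) v"

text \<open>Levi-Civita connection of the round metric: tangential part of the derivative in the
  ambient space.\<close>

definition nablaS5 :: "(C3 \<Rightarrow> C3) \<Rightarrow> C3 \<Rightarrow> C3 \<Rightarrow> C3" where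
  "nablaS5 W p Z = dS5 W p Z - (dS5 W p Z \<bullet> p) *\<^sub>R p"

definition flow_on_S5 :: "(C3 \<Rightarrow> C3) \<Rightarrow> (real \<Rightarrow> C3 \<Rightarrow> C3) \<Rightarrow> bool" where
  "flow_on_S5 W \<phi> \<longleftrightarrow>
     smooth_on (UNIV \<times> S5) (\<lambda>(t, p). \<phi> t p) \<and>
     (\<forall>p\<in>S5. \<phi> 0 p = p) \<and>
     (\<forall>t. \<forall>p\<in>S5. \<phi> t p \<in> S5 \<and> ((\<lambda>s. \<phi> s p) has_vector_derivative W (\<phi> t p)) (at t))"

text \<open>\<open>\<phi>\<close> is the flow of the Hamiltonian vector field \<open>W = W\<^sub>F\<close>. The field \<open>W\<^sub>F\<close> exists and is unique
  on \<open>S5\<close> for each smooth \<open>F\<close>, and it is complete. It is treated relationally, so its values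
  off \<open>S5\<close> are irrelevant.\<close>

definition hamiltonian_flow :: "(C3 \<Rightarrow> real) \<Rightarrow> (C3 \<Rightarrow> C3) \<Rightarrow> (real \<Rightarrow> C3 \<Rightarrow> C3) \<Rightarrow> bool" where
  "hamiltonian_flow F W \<phi> \<longleftrightarrow>
     smooth_on S5 F \<and> smooth_on S5 W \<and>
     (\<forall>p\<in>S5. p \<bullet> W p = 0 \<and> alpha p (W p) = F p) \<and>
     flow_on_S5 W \<phi> \<and>
     (\<forall>t. \<forall>p\<in>S5. dS5 (\<phi> t) p ` horizontal p = horizontal (\<phi> t p))"

definition hamiltonian_field :: "(C3 \<Rightarrow> real) \<Rightarrow> (C3 \<Rightarrow> C3) \<Rightarrow> bool" where
  "hamiltonian_field F W \<longleftrightarrow> (\<exists>\<phi>. hamiltonian_flow F W \<phi>)"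

definition support_S5 :: "(C3 \<Rightarrow> real) \<Rightarrow> C3 set" where
  "support_S5 F = closure {p \<in> S5. F p \<noteq> 0}"

definition legendrian_plane :: "C3 \<Rightarrow> C3 set \<Rightarrow> bool" where
  "legendrian_plane p P \<longleftrightarrow>
     subspace P \<and> dim P = 2 \<and> P \<subseteq> horizontal p \<and> (\<forall>v\<in>P. \<forall>w\<in>P. dalpha v w = 0)"

definition LegG :: "(C3 set \<times> C3) set" where
  "LegG = {(P, p). p \<in> S5 \<and> legendrian_plane p P}"

text \<open>The topology of the bundle is that of the Grassmannian, given by identifying a plane with
  the orthogonal projection onto it.\<close>

definition plane_projection :: "C3 set \<Rightarrow> C3 \<Rightarrow>\<^sub>L C3" where
  "plane_projection P = Blinfun (closest_point P)"

definition LegG_topology :: "(C3 set \<times> C3) topology" where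
  "LegG_topology = pullback_topology LegG (\<lambda>(P, p). (plane_projection P, p)) euclidean"

definition LegG_borel :: "(C3 set \<times> C3) measure" where
  "LegG_borel = sigma LegG {U. openin LegG_topology U}"

text \<open>\<open>LegG\<close> is compact and metrizable, so its Radon measures are its finite Borel measures.\<close>

definition legendrian_varifold :: "(C3 set \<times> C3) measure \<Rightarrow> bool" where
  "legendrian_varifold V \<longleftrightarrow>
     space V = LegG \<and> sets V = sets LegG_borel \<and> finite_measure V"

definition weight :: "(C3 set \<times> C3) measure \<Rightarrow> C3 measure" where
  "weight V = distr V borel snd"

definition varifold_converges ::
    "(nat \<Rightarrow> (C3 set \<times> C3) measure) \<Rightarrow> (C3 set \<times> C3) measure \<Rightarrow> bool" where
  "varifold_converges V Vlim \<longleftrightarrow>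
     (\<forall>k. legendrian_varifold (V k)) \<and> legendrian_varifold Vlim \<and>
     (\<forall>\<Phi>. continuous_map LegG_topology euclideanreal \<Phi> \<longrightarrow>
        (\<lambda>k. \<integral>x. \<Phi> x \<partial>(V k)) \<longlonglongrightarrow> (\<integral>x. \<Phi> x \<partial>Vlim))"

text \<open>The value does not depend on the orthonormal basis.\<close>

definition plane_div :: "(C3 \<Rightarrow> C3) \<Rightarrow> C3 set \<Rightarrow> C3 \<Rightarrow> real" where
  "plane_div W P p = (SOME s. \<exists>Z1 Z2.
     norm Z1 = 1 \<and> norm Z2 = 1 \<and> Z1 \<bullet> Z2 = 0 \<and> span {Z1, Z2} = P \<and>
     s = nablaS5 W p Z1 \<bullet> Z1 + nablaS5 W p Z2 \<bullet> Z2)"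

definition hamiltonian_stationary_varifold :: "(C3 set \<times> C3) measure \<Rightarrow> bool" where
  "hamiltonian_stationary_varifold V \<longleftrightarrow> legendrian_varifold V \<and>
     (\<forall>F W. smooth_on S5 F \<and> hamiltonian_field F W \<longrightarrow>
        (\<integral>(P, p). plane_div W P p \<partial>V) = 0)"

text \<open>The two-dimensional Hausdorff measure, normalised to agree with area on planes, on the
  Caratheodory-measurable sets.\<close>

definition hausdorff2_pre :: "real \<Rightarrow> C3 set \<Rightarrow> ennreal" where
  "hausdorff2_pre \<delta> A =
     (INF C\<in>{C :: nat \<Rightarrow> C3 set.
         A \<subseteq> (\<Union>i. C i) \<and> (\<forall>i. bounded (C i) \<and> diameter (C i) \<le> \<delta>)}.
       \<Sum>i. ennreal (pi * (diameter (C i) / 2)\<^sup>2))"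

definition hausdorff2_outer :: "C3 set \<Rightarrow> ennreal" where
  "hausdorff2_outer A = (SUP \<delta>\<in>{0<..}. hausdorff2_pre \<delta> A)"

definition hausdorff2 :: "C3 measure" where
  "hausdorff2 =
     measure_of UNIV (lambda_system UNIV (Pow UNIV) hausdorff2_outer) hausdorff2_outer"

definition countably_2_rectifiable :: "C3 set \<Rightarrow> bool" where
  "countably_2_rectifiable M \<longleftrightarrow> M \<in> sets hausdorff2 \<and>
     (\<exists>f :: nat \<Rightarrow> real \<times> real \<Rightarrow> C3. (\<forall>i. \<exists>L. L-lipschitz_on UNIV (f i)) \<and>
        hausdorff2_outer (M - (\<Union>i. range (f i))) = 0)"

text \<open>Blow-up definition: the rescalings at \<open>p\<close> of the measure \<open>\<theta> \<H>\<^sup>2\<close> on \<open>M\<close> converge, tested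
  against compactly supported continuous functions, to \<open>\<theta>(p) \<H>\<^sup>2\<close> on \<open>P\<close>.\<close>

definition approx_tangent_plane :: "C3 set \<Rightarrow> (C3 \<Rightarrow> real) \<Rightarrow> C3 \<Rightarrow> C3 set \<Rightarrow> bool" where
  "approx_tangent_plane M \<theta> p P \<longleftrightarrow> subspace P \<and> dim P = 2 \<and>
     (\<forall>\<psi> :: C3 \<Rightarrow> real. continuous_on UNIV \<psi> \<and> compact (closure {y. \<psi> y \<noteq> 0}) \<longrightarrow>
        ((\<lambda>r. (LINT y:M|hausdorff2. \<theta> y * \<psi> ((1 / r) *\<^sub>R (y - p))) / r\<^sup>2)
           \<longlongrightarrow> \<theta> p * (LINT y:P|hausdorff2. \<psi> y)) (at_right 0))"

definition rectifiable_varifold :: "(C3 set \<times> C3) measure \<Rightarrow> bool" where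
  "rectifiable_varifold V \<longleftrightarrow>
     (\<exists>M \<theta>. countably_2_rectifiable M \<and> \<theta> \<in> borel_measurable hausdorff2 \<and>
        (\<forall>y\<in>M. \<theta> y > 0) \<and>
        (\<forall>B\<in>sets borel. emeasure (weight V) B = (\<integral>\<^sup>+y\<in>M \<inter> B. ennreal (\<theta> y) \<partial>hausdorff2)) \<and>
        (AE (P, p) in V. approx_tangent_plane M \<theta> p P))"

text \<open>Objects on the torus \<open>\<real>\<^sup>2 / 2\<pi>(\<int> \<oplus> R\<int>)\<close> are represented by their lifts to the plane; the
  coordinates of the plane are conformal coordinates.\<close>

definition torus_lattice :: "real \<Rightarrow> (real \<times> real) set" where
  "torus_lattice R = {(2 * pi * of_int m, 2 * pi * R * of_int n) | m n. True}"

definition torus_domain :: "real \<Rightarrow> (real \<times> real) set" where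
  "torus_domain R = {0..<2 * pi} \<times> {0..<2 * pi * R}"

definition torus_periodic :: "real \<Rightarrow> (real \<times> real \<Rightarrow> 'b) \<Rightarrow> bool" where
  "torus_periodic R f \<longleftrightarrow> (\<forall>x. \<forall>l\<in>torus_lattice R. f (x + l) = f x)"

definition pd1 :: "(real \<times> real \<Rightarrow> 'b::real_normed_vector) \<Rightarrow> real \<times> real \<Rightarrow> 'b" where
  "pd1 f x = frechet_derivative f (at x) (1, 0)"

definition pd2 :: "(real \<times> real \<Rightarrow> 'b::real_normed_vector) \<Rightarrow> real \<times> real \<Rightarrow> 'b" where
  "pd2 f x = frechet_derivative f (at x) (0, 1)"

definition legendrian_immersion :: "real \<Rightarrow> (real \<times> real \<Rightarrow> C3) \<Rightarrow> bool" where
  "legendrian_immersion R u \<longleftrightarrow>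
     smooth_on UNIV u \<and> torus_periodic R u \<and> (\<forall>x. u x \<in> S5) \<and>
     (\<forall>x. inj (frechet_derivative u (at x))) \<and>
     (\<forall>x v. alpha (u x) (frechet_derivative u (at x) v) = 0)"

definition conformal :: "(real \<times> real \<Rightarrow> C3) \<Rightarrow> bool" where
  "conformal u \<longleftrightarrow> (\<forall>x. pd1 u x \<noteq> 0 \<and> norm (pd1 u x) = norm (pd2 u x) \<and> pd1 u x \<bullet> pd2 u x = 0)"

text \<open>On a compact domain an injective immersion is an embedding.\<close>

definition legendrian_embedding :: "real \<Rightarrow> (real \<times> real \<Rightarrow> C3) \<Rightarrow> bool" where
  "legendrian_embedding R u \<longleftrightarrow>
     legendrian_immersion R u \<and> (\<forall>x y. u x = u y \<longrightarrow> x - y \<in> torus_lattice R)"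

definition area_on :: "(real \<times> real) set \<Rightarrow> (real \<times> real \<Rightarrow> C3) \<Rightarrow> real" where
  "area_on A v =
     (LINT x:A|lborel. sqrt ((norm (pd1 v x))\<^sup>2 * (norm (pd2 v x))\<^sup>2 - (pd1 v x \<bullet> pd2 v x)\<^sup>2))"

text \<open>Locally supported variations: on an open subset \<open>U\<close> of the torus such that \<open>u(\<partial>U)\<close> avoids
  the support of \<open>F\<close>, the map is moved by the flow of \<open>W\<^sub>F\<close>; it is left unchanged outside \<open>U\<close>,
  so only the area of the part over \<open>U\<close> varies.\<close>

definition hamiltonian_stationary_immersion :: "real \<Rightarrow> (real \<times> real \<Rightarrow> C3) \<Rightarrow> bool" where
  "hamiltonian_stationary_immersion R u \<longleftrightarrow> legendrian_immersion R u \<and>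
     (\<forall>U F W \<phi>. open U \<and> torus_periodic R (\<lambda>x. x \<in> U) \<and> smooth_on S5 F \<and>
        hamiltonian_flow F W \<phi> \<and> support_S5 F \<inter> u ` frontier U = {} \<longrightarrow>
        ((\<lambda>t. area_on (torus_domain R \<inter> U) (\<lambda>x. \<phi> t (u x))) has_real_derivative 0) (at 0))"

definition L2_loc :: "(real \<times> real \<Rightarrow> C3) \<Rightarrow> bool" where
  "L2_loc f \<longleftrightarrow> f \<in> borel_measurable lebesgue \<and>
     (\<forall>K. compact K \<longrightarrow> set_integrable lebesgue K (\<lambda>x. (norm (f x))\<^sup>2))"

text \<open>\<open>u\<close> is of class \<open>W\<^sup>1\<^sup>,\<^sup>2\<close> locally, with weak partial derivatives \<open>D1\<close>, \<open>D2\<close> (which are unique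
  almost everywhere).\<close>

definition W12_loc ::
    "(real \<times> real \<Rightarrow> C3) \<Rightarrow> (real \<times> real \<Rightarrow> C3) \<Rightarrow> (real \<times> real \<Rightarrow> C3) \<Rightarrow> bool" where
  "W12_loc u D1 D2 \<longleftrightarrow> L2_loc u \<and> L2_loc D1 \<and> L2_loc D2 \<and>
     (\<forall>\<psi> :: real \<times> real \<Rightarrow> real. smooth_on UNIV \<psi> \<and> compact (closure {x. \<psi> x \<noteq> 0}) \<longrightarrow>
        (\<integral>x. pd1 \<psi> x *\<^sub>R u x \<partial>lebesgue) = - (\<integral>x. \<psi> x *\<^sub>R D1 x \<partial>lebesgue) \<and>
        (\<integral>x. pd2 \<psi> x *\<^sub>R u x \<partial>lebesgue) = - (\<integral>x. \<psi> x *\<^sub>R D2 x \<partial>lebesgue))"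

text \<open>The triple (torus, \<open>u\<close>, \<open>N\<close>) is a parametrized Hamiltonian stationary Legendrian varifold;
  \<open>D1\<close>, \<open>D2\<close> represent the weak gradient of \<open>u\<close>, and \<open>E1\<close>, \<open>E2\<close> that of \<open>W\<^sub>F \<circ> u\<close>.\<close>

definition PHSLV :: "real \<Rightarrow> (real \<times> real \<Rightarrow> C3) \<Rightarrow> (real \<times> real \<Rightarrow> C3) \<Rightarrow>
    (real \<times> real \<Rightarrow> C3) \<Rightarrow> (real \<times> real \<Rightarrow> nat) \<Rightarrow> bool" where
  "PHSLV R u D1 D2 N \<longleftrightarrow>
     torus_periodic R u \<and> torus_periodic R N \<and> (\<forall>x. u x \<in> S5) \<and>
     W12_loc u D1 D2 \<and>
     (AE x in lebesgue. alpha (u x) (D1 x) = 0 \<and> alpha (u x) (D2 x) = 0) \<and>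
     (AE x in lebesgue. norm (D1 x) = norm (D2 x) \<and> D1 x \<bullet> D2 x = 0) \<and>
     N \<in> lebesgue \<rightarrow>\<^sub>M count_space UNIV \<and> (\<forall>x. N x \<ge> 1) \<and>
     (\<exists>c. AE x in lebesgue. N x \<le> c) \<and>
     (\<forall>f :: real \<times> real \<Rightarrow> real.
        smooth_on UNIV f \<and> torus_periodic R f \<and> (\<forall>x. f x \<ge> 0) \<longrightarrow>
        (AE t in lebesgue. t > 0 \<longrightarrow>
           (\<forall>F W. smooth_on S5 F \<and> hamiltonian_field F W \<and>
              support_S5 F \<inter> u ` {x. f x = t} = {} \<longrightarrow>
              (\<exists>E1 E2. W12_loc (\<lambda>x. W (u x)) E1 E2 \<and>
                 (LINT x:{x \<in> torus_domain R. f x > t}|lebesgue.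
                    real (N x) * (E1 x \<bullet> D1 x + E2 x \<bullet> D2 x)) = 0))))"

definition induced_varifold :: "real \<Rightarrow> (real \<times> real \<Rightarrow> C3) \<Rightarrow> (real \<times> real \<Rightarrow> C3) \<Rightarrow>
    (real \<times> real \<Rightarrow> C3) \<Rightarrow> (real \<times> real \<Rightarrow> nat) \<Rightarrow> (C3 set \<times> C3) measure" where
  "induced_varifold R u D1 D2 N = measure_of LegG (sets LegG_borel)
     (\<lambda>B. \<integral>\<^sup>+x\<in>{x \<in> torus_domain R. (span {D1 x, D2 x}, u x) \<in> B}.
        ennreal (real (N x) * ((norm (D1 x))\<^sup>2 + (norm (D2 x))\<^sup>2) / 2) \<partial>lebesgue)"

definition fibre_point :: "real \<Rightarrow> C3" where
  "fibre_point \<beta> = vector [0, 0, cis \<beta>]"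

definition base_plane :: "real \<Rightarrow> real \<Rightarrow> C3 set" where
  "base_plane \<tau> \<eta> =
     span {cos \<tau> *\<^sub>R vector [1, 0, 0] + sin \<tau> *\<^sub>R vector [\<i>, 0, 0],
           cos \<eta> *\<^sub>R vector [0, 1, 0] + sin \<eta> *\<^sub>R vector [0, \<i>, 0]}"

text \<open>The map \<open>x \<mapsto> e\<^sup>i\<^sup>\<beta> x\<close> is linear, hence equal to its differential.\<close>

definition rotated_plane :: "real \<Rightarrow> real \<Rightarrow> real \<Rightarrow> C3 set" where
  "rotated_plane \<beta> \<tau> \<eta> = (\<lambda>v. cis \<beta> *s v) ` base_plane \<tau> \<eta>"

definition mu :: "real \<Rightarrow> (C3 set \<times> C3) measure" where
  "mu \<beta> = distr (uniform_measure lborel ({0..2 * pi} \<times> {0..2 * pi})) LegG_borel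
     (\<lambda>(\<tau>, \<eta>). (rotated_plane \<beta> \<tau> \<eta>, fibre_point \<beta>))"

text \<open>\<open>\<beta>\<close> is the arclength parameter of the fibre, so that \<open>d\<beta>\<close> represents \<open>\<H>\<^sup>1\<close> on the fibre.\<close>

definition limit_varifold :: "(C3 set \<times> C3) measure" where
  "limit_varifold = measure_of LegG (sets LegG_borel)
     (\<lambda>B. ennreal (2 * pi) * (\<integral>\<^sup>+\<beta>\<in>{0..2 * pi}. emeasure (mu \<beta>) B \<partial>lborel))"

end

theory Submission
  imports Defs
begin

text \<open>
  The tori are orbits \<open>(s/\<surd>2 e\<^sup>i\<^sup>a, s/\<surd>2 e\<^sup>i\<^sup>b, c e\<^sup>i\<^sup>\<gamma>)\<close> with \<open>s = sin \<omega>\<close>, \<open>c = cos \<omega>\<close>, along which the phases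
  \<open>a = x + c y\<close>, \<open>b = - x + c y\<close>, \<open>\<gamma> = - y/R\<close> are linear; they are closed if \<open>cot\<^sup>2 \<omega>\<close> is a natural number
  \<open>n\<close>. The Laplacian of such a map \<open>u\<close> is \<open>- 2 s\<^sup>2 u + const J u\<^sub>y\<close>, and the contact condition gives
  \<open>2 \<langle>J u\<^sub>y, W\<^sub>F \<circ> u\<rangle> = \<partial>\<^sub>y (F \<circ> u)\<close>; therefore \<open>\<nabla>u \<cdot> \<nabla>(W\<^sub>F \<circ> u)\<close> is a divergence, which gives stationarity.
  For \<open>n \<rightarrow> \<infinity>\<close> the points collapse to the fibre while the phases \<open>x + n t\<close>, \<open>- x + n t\<close>, \<open>- t\<close> (with
  \<open>y = R t\<close>) equidistribute, so that all planes of the limiting family are charged uniformly. Stationarity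
  passes to the limit. The weight of the limit lives on a circle, which is null for the two-dimensional
  Hausdorff measure, so the limit is not rectifiable.
\<close>

section \<open>Continuously differentiable maps\<close>

text \<open>The contact condition in the \<open>y\<close> direction reads
  \<open>R * (sin \<omega>)\<^sup>2 = cos \<omega>\<close>, so \<open>R * cos \<omega>\<close> is
  the squared cotangent; when it is the integer \<open>n\<close>, one period in \<open>y\<close>
  turns the three phases by n, n and -1 full turns. The area is 4 pi^2 R times the squared sine,
  that is 4 pi^2 times \<open>cos \<omega>\<close>, so the masses converge although R tends to
  infinity. A Hamiltonian field is known only through a flow that preserves the contact planes. The
  relation between dF and W, and the vanishing of W off the support of F, must be extracted by
  differentiating this flow; much of the preparation before the tori serves that end. All pairs of
  plane and point that occur are values of \<open>legendrian_pair\<close>, continuous in \<omega>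
  and in three phases, with \<omega> > 0 for the tori and \<omega> = 0 for the limit. Testing a
  varifold and taking its first variation both become integrals of a function of these four
  parameters. A single equidistribution theorem therefore yields the weak convergence and the
  stationarity of the limit.\<close>

definition C1_on :: "'a::euclidean_space set \<Rightarrow> ('a \<Rightarrow> 'b::real_normed_vector) \<Rightarrow> ('a \<Rightarrow> 'a \<Rightarrow> 'b) \<Rightarrow> bool"
  where "C1_on U f f' \<longleftrightarrow>
    (\<forall>x\<in>U. (f has_derivative f' x) (at x)) \<and> continuous_on (U \<times> UNIV) (\<lambda>(x, v). f' x v)"

lemma C1_onI:
  assumes "\<And>x. x \<in> U \<Longrightarrow> (f has_derivative f' x) (at x)"
    and "continuous_on (U \<times> UNIV) (\<lambda>z. f' (fst z) (snd z))"
  shows "C1_on U f f'"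
  using assms by (simp add: C1_on_def case_prod_beta)

lemma C1_on_has_derivative: "C1_on U f f' \<Longrightarrow> x \<in> U \<Longrightarrow> (f has_derivative f' x) (at x)"
  by (simp add: C1_on_def)

lemma C1_on_linear: "C1_on U f f' \<Longrightarrow> x \<in> U \<Longrightarrow> linear (f' x)"
  using C1_on_has_derivative has_derivative_linear by blast

lemma C1_on_frechet: "C1_on U f f' \<Longrightarrow> x \<in> U \<Longrightarrow> frechet_derivative f (at x) = f' x"
  by (metis C1_on_has_derivative frechet_derivative_at)

lemma C1_on_continuous_on: "C1_on U f f' \<Longrightarrow> continuous_on U f"
  by (meson C1_on_has_derivative continuous_at_imp_continuous_on has_derivative_continuous)

lemma C1_on_continuous_derivative:
  assumes "C1_on U f f'" "continuous_on S g" "continuous_on S h" "\<And>x. x \<in> S \<Longrightarrow> g x \<in> U"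
  shows "continuous_on S (\<lambda>x. f' (g x) (h x))"
proof -
  have "continuous_on (U \<times> UNIV) (\<lambda>z. f' (fst z) (snd z))"
    using assms(1) by (simp add: C1_on_def case_prod_beta)
  from continuous_on_compose2[OF this, of S "\<lambda>x. (g x, h x)"] show ?thesis
    using assms(2-4) by (auto intro!: continuous_intros)
qed

lemma C1_on_subset: "C1_on U f f' \<Longrightarrow> V \<subseteq> U \<Longrightarrow> C1_on V f f'"
  unfolding C1_on_def by (meson Sigma_mono continuous_on_subset order_refl subsetD)

lemma continuous_on_fst_Times: "continuous_on U f \<Longrightarrow> continuous_on (U \<times> V) (\<lambda>z. f (fst z))"
  by (rule continuous_on_compose2[where f = fst]) (auto intro: continuous_on_fst continuous_on_id)

lemma continuous_on_C1_derivative: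
  "C1_on U f f' \<Longrightarrow> continuous_on (U \<times> UNIV) (\<lambda>z. f' (fst z) (snd z))"
  by (simp add: C1_on_def case_prod_beta)

lemma C1_on_compose:
  assumes "C1_on U f f'" "C1_on V g g'" "\<And>x. x \<in> U \<Longrightarrow> f x \<in> V"
  shows "C1_on U (\<lambda>x. g (f x)) (\<lambda>x v. g' (f x) (f' x v))"
proof (rule C1_onI)
  fix x assume "x \<in> U"
  then show "((\<lambda>x. g (f x)) has_derivative (\<lambda>v. g' (f x) (f' x v))) (at x)"
    using assms has_derivative_compose[OF C1_on_has_derivative[OF assms(1)] C1_on_has_derivative[OF assms(2)]]
    by simp
next
  show "continuous_on (U \<times> UNIV) (\<lambda>z. g' (f (fst z)) (f' (fst z) (snd z)))"
    using assms(3)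
    by (intro C1_on_continuous_derivative[OF assms(2)] continuous_on_C1_derivative[OF assms(1)]
        continuous_on_fst_Times[OF C1_on_continuous_on[OF assms(1)]]) auto
qed

lemma C1_on_bilinear:
  assumes "bounded_bilinear B" "C1_on U f f'" "C1_on U g g'"
  shows "C1_on U (\<lambda>x. B (f x) (g x)) (\<lambda>x v. B (f x) (g' x v) + B (f' x v) (g x))"
proof (rule C1_onI)
  fix x assume "x \<in> U"
  then show "((\<lambda>x. B (f x) (g x)) has_derivative (\<lambda>v. B (f x) (g' x v) + B (f' x v) (g x))) (at x)"
    using bounded_bilinear.FDERIV[OF assms(1) C1_on_has_derivative[OF assms(2)] C1_on_has_derivative[OF assms(3)]]
    by simp
next
  have "continuous_on (U \<times> UNIV) (\<lambda>z. f (fst z))" "continuous_on (U \<times> UNIV) (\<lambda>z. g (fst z))"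
    by (intro continuous_on_fst_Times C1_on_continuous_on[OF assms(2)] C1_on_continuous_on[OF assms(3)])+
  then show "continuous_on (U \<times> UNIV)
      (\<lambda>z. B (f (fst z)) (g' (fst z) (snd z)) + B (f' (fst z) (snd z)) (g (fst z)))"
    by (intro continuous_on_add bounded_bilinear.continuous_on[OF assms(1)]
         continuous_on_C1_derivative[OF assms(2)] continuous_on_C1_derivative[OF assms(3)])
qed

lemma C1_on_bounded_linear:
  assumes "bounded_linear L"
  shows "C1_on U L (\<lambda>x. L)"
  by (intro C1_onI bounded_linear_imp_has_derivative[OF assms] bounded_linear.continuous_on[OF assms]
      continuous_on_snd continuous_on_id)

text \<open>\<open>Ck_on\<close> gives continuity of the derivative for each fixed direction only.
  Expanding the direction in the finite basis turns this into joint continuity in point and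
  direction, the form that survives composition and integration over parameters.\<close>

lemma Ck_on_Suc_imp_C1_on:
  fixes f :: "'a::euclidean_space \<Rightarrow> 'b::real_normed_vector"
  assumes "Ck_on (Suc 0) U f"
  shows "C1_on U f (\<lambda>x. frechet_derivative f (at x))"
proof (rule C1_onI)
  fix x assume "x \<in> U"
  with assms show "(f has_derivative frechet_derivative f (at x)) (at x)"
    by (simp add: frechet_derivative_works)
next
  define D where "D = (\<lambda>x. frechet_derivative f (at x))"
  have d: "linear (D x)" if "x \<in> U" for x
    using assms that by (simp add: D_def linear_frechet_derivative)
  have e0: "D x v = (\<Sum>b\<in>Basis. (v \<bullet> b) *\<^sub>R D x b)" if "x \<in> U" for x v
  proof -
    have "D x v = D x (\<Sum>b\<in>Basis. (v \<bullet> b) *\<^sub>R b)"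
      by (simp only: euclidean_representation)
    also have "\<dots> = (\<Sum>b\<in>Basis. (v \<bullet> b) *\<^sub>R D x b)"
      by (simp only: linear_sum[OF d[OF that]] linear_scale[OF d[OF that]])
    finally show ?thesis .
  qed
  have e: "(\<Sum>b\<in>Basis. (snd z \<bullet> b) *\<^sub>R D (fst z) b) = D (fst z) (snd z)"
    if "z \<in> U \<times> UNIV" for z
    by (rule e0[symmetric]) (use that in auto)
  have c: "continuous_on (U \<times> UNIV) (\<lambda>z. D (fst z) b)" for b
    by (rule continuous_on_fst_Times) (use assms in \<open>simp add: D_def\<close>)
  have "continuous_on (U \<times> UNIV) (\<lambda>z. \<Sum>b\<in>Basis. (snd z \<bullet> b) *\<^sub>R D (fst z) b)"
    by (intro continuous_intros c)
  from continuous_on_eq[OF this e]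
  show "continuous_on (U \<times> UNIV) (\<lambda>z. frechet_derivative f (at (fst z)) (snd z))"
    by (simp add: D_def)
qed

lemma smooth_on_imp_C1_on:
  assumes "smooth_on S f"
  obtains U g g' where "open U" "S \<subseteq> U" "C1_on U g g'" "\<And>x. x \<in> S \<Longrightarrow> g x = f x"
proof -
  obtain U g where *: "open U" "S \<subseteq> U" "\<forall>k. Ck_on k U g" "\<forall>x\<in>S. g x = f x"
    using assms unfolding smooth_on_def by blast
  then have "C1_on U g (\<lambda>x. frechet_derivative g (at x))"
    using Ck_on_Suc_imp_C1_on by blast
  then show ?thesis using * that by blast
qed

lemma smooth_on_UNIV_C1_on:
  assumes "smooth_on UNIV f"
  shows "C1_on UNIV f (\<lambda>x. frechet_derivative f (at x))"
proof -
  obtain U g g' where "open U" "UNIV \<subseteq> U" "C1_on U g g'" "\<And>x. g x = f x"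
    using smooth_on_imp_C1_on[OF assms] by (metis UNIV_I)
  then have "C1_on UNIV f g'" by (metis C1_on_subset ext)
  then show ?thesis using C1_on_frechet[of UNIV f g'] by (simp add: C1_on_def)
qed

lemma pd1_eq: "C1_on UNIV f f' \<Longrightarrow> pd1 f = (\<lambda>x. f' x (1, 0))"
  by (auto simp: pd1_def C1_on_frechet)

lemma pd2_eq: "C1_on UNIV f f' \<Longrightarrow> pd2 f = (\<lambda>x. f' x (0, 1))"
  by (auto simp: pd2_def C1_on_frechet)

section \<open>Integration of partial derivatives and weak gradients\<close>

lemma C1_on_line:
  assumes "C1_on UNIV f f'"
  shows "((\<lambda>s. f (x + s *\<^sub>R v)) has_vector_derivative f' (x + s *\<^sub>R v) v) (at s within S)"
proof -
  have l: "((\<lambda>s. x + s *\<^sub>R v) has_derivative (\<lambda>s. s *\<^sub>R v)) (at s within S)"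
    by (auto intro!: derivative_eq_intros)
  have "(f has_derivative f' (x + s *\<^sub>R v)) (at (x + s *\<^sub>R v))"
    using C1_on_has_derivative[OF assms] by blast
  from has_derivative_compose[OF l this] show ?thesis
    using C1_on_linear[OF assms, of "x + s *\<^sub>R v"]
    by (simp add: has_vector_derivative_def linear_scale)
qed

lemma C1_on_axis:
  assumes "C1_on UNIV (f :: real \<times> real \<Rightarrow> 'b::real_normed_vector) f'"
  shows "((\<lambda>s. f (s, y)) has_vector_derivative f' (s, y) (1, 0)) (at s within S)"
    and "((\<lambda>s. f (y, s)) has_vector_derivative f' (y, s) (0, 1)) (at s within S)"
  using C1_on_line[OF assms, of "(0, y)" "(1, 0)" s S] C1_on_line[OF assms, of "(y, 0)" "(0, 1)" s S]
  by auto

text \<open>Fubini, then the fundamental theorem in the direction of differentiation. Equal values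
  on opposite sides cover both uses: products with a compactly supported test function, where both
  values are 0, and periodic functions on the torus.\<close>

lemma integral_cbox_pd_eq_0:
  fixes f :: "real \<times> real \<Rightarrow> 'b::euclidean_space"
  assumes f: "C1_on UNIV f f'" and "a \<le> b" "c \<le> d"
  shows "(\<And>y. f (b, y) = f (a, y)) \<Longrightarrow> integral (cbox (a, c) (b, d)) (\<lambda>x. f' x (1, 0)) = 0"
    and "(\<And>y. f (y, d) = f (y, c)) \<Longrightarrow> integral (cbox (a, c) (b, d)) (\<lambda>x. f' x (0, 1)) = 0"
proof -
  have c: "continuous_on (cbox (a, c) (b, d)) (\<lambda>x. f' x v)" for v
    by (intro C1_on_continuous_derivative[OF f] continuous_intros) auto
  { assume *: "\<And>y. f (b, y) = f (a, y)"
    have i: "integral (cbox a b) (\<lambda>x. f' (x, y) (1, 0)) = 0" for y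
      using fundamental_theorem_of_calculus[OF \<open>a \<le> b\<close> C1_on_axis(1)[OF f], of y] *
      by (simp add: integral_unique cbox_interval)
    have "integral (cbox (a, c) (b, d)) (\<lambda>x. f' x (1, 0)) =
        integral (cbox a b) (\<lambda>x. integral (cbox c d) (\<lambda>y. f' (x, y) (1, 0)))"
      by (rule integral_prod_continuous[OF c])
    also have "\<dots> = integral (cbox c d) (\<lambda>y. integral (cbox a b) (\<lambda>x. f' (x, y) (1, 0)))"
      by (rule integral_swap_continuous) (use c in \<open>simp add: case_prod_beta\<close>)
    finally show "integral (cbox (a, c) (b, d)) (\<lambda>x. f' x (1, 0)) = 0"
      by (simp add: i[unfolded cbox_interval]) }
  { assume *: "\<And>y. f (y, d) = f (y, c)"
    have i: "integral (cbox c d) (\<lambda>y. f' (x, y) (0, 1)) = 0" for x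
      using fundamental_theorem_of_calculus[OF \<open>c \<le> d\<close> C1_on_axis(2)[OF f], of x] *
      by (simp add: integral_unique cbox_interval)
    have "integral (cbox (a, c) (b, d)) (\<lambda>x. f' x (0, 1)) =
        integral (cbox a b) (\<lambda>x. integral (cbox c d) (\<lambda>y. f' (x, y) (0, 1)))"
      by (rule integral_prod_continuous[OF c])
    then show "integral (cbox (a, c) (b, d)) (\<lambda>x. f' x (0, 1)) = 0"
      by (simp add: i[unfolded cbox_interval]) }
qed

text \<open>The half-open box is the fundamental domain of the torus, whereas integration by parts
  works on the closed box; the difference lies in the negligible frontier.\<close>

lemma set_integral_box_eq_integral:
  fixes f :: "real \<times> real \<Rightarrow> 'b::euclidean_space"
  assumes "continuous_on (cbox (a, c) (b, d)) f"
  shows "set_integrable lborel ({a..<b} \<times> {c..<d}) f"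
    and "(LINT x:{a..<b} \<times> {c..<d}|lborel. f x) = integral (cbox (a, c) (b, d)) f"
proof -
  have i: "set_integrable lborel (cbox (a, c) (b, d)) f"
    unfolding set_integrable_def using borel_integrable_compact[OF compact_cbox assms] by simp
  have sub: "{a..<b} \<times> {c..<d} \<subseteq> cbox (a, c) (b, d)" by (auto simp: cbox_Pair_eq)
  have m: "{a..<b} \<times> {c..<d} \<in> sets lborel" by (simp add: borel_Times)
  show j: "set_integrable lborel ({a..<b} \<times> {c..<d}) f"
    by (rule set_integrable_subset[OF i m sub])
  have n: "negligible (cbox (a, c) (b, d) - box (a, c) (b, d))"
    by (simp add: negligible_frontier_interval)
  have b: "box (a, c) (b, d) \<subseteq> {a..<b} \<times> {c..<d}"
    by (auto simp: box_def Basis_prod_def)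
  have "(LINT x:{a..<b} \<times> {c..<d}|lborel. f x) = integral ({a..<b} \<times> {c..<d}) f"
    by (rule set_borel_integral_eq_integral(2)[OF j])
  also have "\<dots> = integral (cbox (a, c) (b, d)) f"
    by (rule integral_spike_set; rule negligible_subset[OF n]) (use sub b in auto)
  finally show "(LINT x:{a..<b} \<times> {c..<d}|lborel. f x) = integral (cbox (a, c) (b, d)) f" .
qed

lemma compact_support_integral:
  fixes f :: "real \<times> real \<Rightarrow> 'b::euclidean_space"
  assumes "continuous_on UNIV f" "\<And>x. x \<notin> {-M..<M} \<times> {-M..<M} \<Longrightarrow> f x = 0"
  shows "integrable lebesgue f" "(\<integral>x. f x \<partial>lebesgue) = integral (cbox (-M, -M) (M, M)) f"
proof -
  have b: "f \<in> borel_measurable lborel"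
    using borel_measurable_continuous_onI[OF assms(1)] by simp
  have e: "(\<lambda>x. indicator ({-M..<M} \<times> {-M..<M}) x *\<^sub>R f x) = f"
    using assms(2) by (auto simp: indicator_def fun_eq_iff)
  note s = set_integral_box_eq_integral[OF continuous_on_subset[OF assms(1)], of "-M" "-M" M M]
  show "integrable lebesgue f"
    using s(1) b unfolding set_integrable_def e by (simp add: integrable_completion)
  show "(\<integral>x. f x \<partial>lebesgue) = integral (cbox (-M, -M) (M, M)) f"
    using s(2) b unfolding set_lebesgue_integral_def e by (simp add: integral_completion)
qed

lemma L2_loc_continuous:
  fixes f :: "real \<times> real \<Rightarrow> C3"
  assumes "continuous_on UNIV f"
  shows "L2_loc f"
proof -
  have "set_integrable lebesgue K (\<lambda>x. (norm (f x))\<^sup>2)" if "compact K" for K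
  proof -
    have "continuous_on K (\<lambda>x. (norm (f x))\<^sup>2)"
      using continuous_on_subset[OF assms] by (auto intro!: continuous_intros)
    from borel_integrable_compact[OF that this] show ?thesis
      unfolding set_integrable_def
      by (subst integrable_completion) (auto intro: borel_measurable_integrable)
  qed
  moreover have "f \<in> borel_measurable lebesgue"
    using borel_measurable_continuous_onI[OF assms] by (simp add: measurable_completion)
  ultimately show ?thesis by (simp add: L2_loc_def)
qed

lemma W12_loc_C1:
  fixes f :: "real \<times> real \<Rightarrow> C3"
  assumes f: "C1_on UNIV f f'"
  shows "W12_loc f (\<lambda>x. f' x (1, 0)) (\<lambda>x. f' x (0, 1))"
proof -
  have "continuous_on UNIV (\<lambda>x. f' x v)" for v
    by (intro C1_on_continuous_derivative[OF f] continuous_intros) auto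
  then have L: "L2_loc (\<lambda>x. f' x v)" for v by (rule L2_loc_continuous)
  have "(\<integral>x. pd1 \<psi> x *\<^sub>R f x \<partial>lebesgue) = - (\<integral>x. \<psi> x *\<^sub>R f' x (1, 0) \<partial>lebesgue) \<and>
        (\<integral>x. pd2 \<psi> x *\<^sub>R f x \<partial>lebesgue) = - (\<integral>x. \<psi> x *\<^sub>R f' x (0, 1) \<partial>lebesgue)"
    if \<psi>: "smooth_on UNIV \<psi>" "compact (closure {x. \<psi> x \<noteq> 0})" for \<psi> :: "real \<times> real \<Rightarrow> real"
  proof -
    define p where "p = (\<lambda>x. frechet_derivative \<psi> (at x))"
    have p: "C1_on UNIV \<psi> p" unfolding p_def by (rule smooth_on_UNIV_C1_on[OF \<psi>(1)])
    obtain M0 where M0: "\<And>x. x \<in> closure {x. \<psi> x \<noteq> 0} \<Longrightarrow> norm x \<le> M0"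
      using compact_imp_bounded[OF \<psi>(2)] by (auto simp: bounded_iff)
    \<comment> \<open>The margin 1 puts the support strictly inside the square, so the test function
      and its derivative vanish on the sides.\<close>
    define M where "M = max M0 0 + 1"
    have M: "M > 0" by (simp add: M_def)
    have out: "x \<notin> closure {x. \<psi> x \<noteq> 0}" if "x \<notin> {-M<..<M} \<times> {-M<..<M}" for x
    proof
      assume "x \<in> closure {x. \<psi> x \<noteq> 0}"
      from M0[OF this] have "norm (fst x) \<le> M0" "norm (snd x) \<le> M0"
        using norm_fst_le[of "fst x" "snd x"] norm_snd_le[of "snd x" "fst x"] by simp_all
      then show False using that by (cases x) (auto simp: M_def)
    qed
    have z: "\<psi> x = 0 \<and> p x v = 0" if "x \<notin> {-M<..<M} \<times> {-M<..<M}" for x v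
    proof -
      let ?V = "- closure {x. \<psi> x \<noteq> 0}"
      have x: "x \<in> ?V" "open ?V" using out[OF that] by auto
      have 0: "0 = \<psi> y" if "y \<in> ?V" for y
        using that closure_subset[of "{x. \<psi> x \<noteq> 0}"] by auto
      have "(\<psi> has_derivative (\<lambda>_. 0)) (at x)"
        by (rule has_derivative_transform_within_open[OF has_derivative_const x(2,1) 0])
      then have "p x = (\<lambda>_. 0)"
        by (rule has_derivative_unique[OF C1_on_has_derivative[OF p UNIV_I]])
      then show ?thesis using 0[OF x(1)] by simp
    qed
    have c: "C1_on UNIV (\<lambda>x. \<psi> x *\<^sub>R f x) (\<lambda>x v. \<psi> x *\<^sub>R f' x v + p x v *\<^sub>R f x)"
      by (rule C1_on_bilinear[OF bounded_bilinear_scaleR p f])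
    have cf: "continuous_on UNIV f" "continuous_on UNIV \<psi>" "continuous_on UNIV (\<lambda>x. f' x v)"
      "continuous_on UNIV (\<lambda>x. p x v)" for v
      using C1_on_continuous_on[OF f] C1_on_continuous_on[OF p]
      by (auto intro!: C1_on_continuous_derivative[OF f] C1_on_continuous_derivative[OF p] continuous_intros)
    have ib: "(\<integral>x. p x v *\<^sub>R f x \<partial>lebesgue) = - (\<integral>x. \<psi> x *\<^sub>R f' x v \<partial>lebesgue)"
      if 0: "integral (cbox (-M, -M) (M, M)) (\<lambda>x. \<psi> x *\<^sub>R f' x v + p x v *\<^sub>R f x) = 0" for v
    proof -
      have 1: "continuous_on UNIV (\<lambda>x. \<psi> x *\<^sub>R f' x v)" "continuous_on UNIV (\<lambda>x. p x v *\<^sub>R f x)"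
        by (intro continuous_intros cf)+
      have 2: "x \<notin> {-M..<M} \<times> {-M..<M} \<Longrightarrow> \<psi> x *\<^sub>R f' x v = 0"
        "x \<notin> {-M..<M} \<times> {-M..<M} \<Longrightarrow> p x v *\<^sub>R f x = 0" for x
        using z[of x v] by (cases x; auto)+
      note I = compact_support_integral[OF 1(1) 2(1)] compact_support_integral[OF 1(2) 2(2)]
      have "integral (cbox (-M, -M) (M, M)) (\<lambda>x. \<psi> x *\<^sub>R f' x v + p x v *\<^sub>R f x) =
        integral (cbox (-M, -M) (M, M)) (\<lambda>x. \<psi> x *\<^sub>R f' x v) +
        integral (cbox (-M, -M) (M, M)) (\<lambda>x. p x v *\<^sub>R f x)"
        by (rule integral_add; rule integrable_continuous; rule continuous_on_subset[OF 1(1)] continuous_on_subset[OF 1(2)]; simp)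
      then show ?thesis using I(2,4) 0 by (simp add: add_eq_0_iff)
    qed
    have "pd1 \<psi> = (\<lambda>x. p x (1, 0))" "pd2 \<psi> = (\<lambda>x. p x (0, 1))"
      by (simp_all add: pd1_eq[OF p] pd2_eq[OF p])
    moreover have "integral (cbox (-M, -M) (M, M)) (\<lambda>x. \<psi> x *\<^sub>R f' x (1, 0) + p x (1, 0) *\<^sub>R f x) = 0"
      by (rule integral_cbox_pd_eq_0(1)[OF c]) (use M z in auto)
    moreover have "integral (cbox (-M, -M) (M, M)) (\<lambda>x. \<psi> x *\<^sub>R f' x (0, 1) + p x (0, 1) *\<^sub>R f x) = 0"
      by (rule integral_cbox_pd_eq_0(2)[OF c]) (use M z in auto)
    ultimately show ?thesis using ib by simp
  qed
  then show ?thesis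
    unfolding W12_loc_def using L C1_on_continuous_on[OF f] L2_loc_continuous by blast
qed

section \<open>Contact geometry of the sphere\<close>

lemma alpha_eq_inner: "alpha p v = (\<i> *s p) \<bullet> v"
  by (simp add: alpha_def inner_vec_def inner_complex_def sum_3 algebra_simps)

lemma alpha_commute: "alpha v w = - alpha w v"
  by (simp add: alpha_def sum_3 algebra_simps)

lemma inner_i_mult: "(\<i> *s v) \<bullet> (\<i> *s w) = v \<bullet> (w :: C3)"
  by (simp add: inner_vec_def inner_complex_def sum_3 algebra_simps)

lemma bounded_bilinear_alpha: "bounded_bilinear alpha"
proof -
  have "bilinear alpha"
    by (auto simp: bilinear_def alpha_def sum_3 algebra_simps intro!: linearI)
  then show ?thesis by (simp add: bilinear_conv_bounded_bilinear)
qed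

text \<open>The sphere is not open, so a derivative within it is determined on tangent vectors only;
  great circles are the test curves that detect it.\<close>

definition circle_arc :: "C3 \<Rightarrow> C3 \<Rightarrow> real \<Rightarrow> C3" where
  "circle_arc p v s = cos (s * norm v) *\<^sub>R p + sin (s * norm v) *\<^sub>R sgn v"

lemma circle_arc_0: "circle_arc p v 0 = p"
  by (simp add: circle_arc_def)

lemma circle_arc_in_S5: "p \<in> S5 \<Longrightarrow> p \<bullet> v = 0 \<Longrightarrow> v \<noteq> 0 \<Longrightarrow> circle_arc p v s \<in> S5"
proof -
  assume *: "p \<in> S5" "p \<bullet> v = 0" "v \<noteq> 0"
  then have a: "p \<bullet> sgn v = 0" "sgn v \<bullet> sgn v = 1" "p \<bullet> p = 1"
    by (simp_all add: sgn_div_norm power2_norm_eq_inner[symmetric] power2_eq_square norm_sgn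
        flip: norm_eq_1)
  have "circle_arc p v s \<bullet> circle_arc p v s = (cos (s * norm v))\<^sup>2 + (sin (s * norm v))\<^sup>2"
    by (simp add: circle_arc_def inner_add_left inner_add_right a inner_commute[of "sgn v" p] power2_eq_square)
  then show ?thesis by (simp add: norm_eq_1)
qed

lemma circle_arc_has_vector_derivative:
  "((circle_arc p v) has_vector_derivative
    (- sin (s * norm v) * norm v) *\<^sub>R p + (cos (s * norm v) * norm v) *\<^sub>R sgn v) (at s)"
  unfolding circle_arc_def by (auto intro!: derivative_eq_intros)

lemma circle_arc_has_vector_derivative_0: "((circle_arc p v) has_vector_derivative v) (at 0)"
  using circle_arc_has_vector_derivative[of p v 0] by (cases "v = 0") (simp_all add: sgn_div_norm)

lemma derivative_along_circle_arc:
  assumes "(f has_derivative D) (at p within S5)" "p \<in> S5" "p \<bullet> v = 0" "v \<noteq> 0"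
  shows "((\<lambda>s. f (circle_arc p v s)) has_vector_derivative D v) (at 0)"
proof -
  have "(f has_derivative D) (at (circle_arc p v 0) within range (circle_arc p v))"
    unfolding circle_arc_0
    by (rule has_derivative_subset[OF assms(1)]) (use circle_arc_in_S5[OF assms(2-4)] in blast)
  from vector_derivative_diff_chain_within[OF circle_arc_has_vector_derivative_0 this]
  show ?thesis by (simp add: o_def)
qed

lemma derivative_within_S5_unique:
  assumes "(f has_derivative D) (at p within S5)" "(f has_derivative E) (at p within S5)"
    and "p \<in> S5" "p \<bullet> v = 0"
  shows "D v = E v"
proof (cases "v = 0")
  case True
  then show ?thesis
    using assms(1,2)[THEN has_derivative_linear] by (simp add: linear_0)
next
  case False
  show ?thesis
    using derivative_along_circle_arc[OF assms(1,3,4) False]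
      derivative_along_circle_arc[OF assms(2,3,4) False]
    by (rule vector_derivative_unique_at)
qed

lemma C1_on_derivative_within_S5:
  assumes "C1_on U g g'" "S5 \<subseteq> U" "\<And>x. x \<in> S5 \<Longrightarrow> g x = f x" "p \<in> S5"
  shows "(f has_derivative g' p) (at p within S5)"
  by (rule has_derivative_transform[OF assms(4) assms(3)[symmetric]])
     (use assms in \<open>auto intro!: has_derivative_at_withinI C1_on_has_derivative[OF assms(1)]\<close>)

lemma dS5_eq:
  assumes "(f has_derivative D) (at p within S5)" "p \<in> S5" "p \<bullet> v = 0"
  shows "dS5 f p v = D v"
proof -
  have "(f has_derivative frechet_derivative f (at p within S5)) (at p within S5)"
    using assms(1) differentiable_def frechet_derivative_works by blast
  from derivative_within_S5_unique[OF this assms] show ?thesis by (simp add: dS5_def)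
qed

lemma C1_on_dS5:
  assumes "C1_on U g g'" "S5 \<subseteq> U" "\<And>x. x \<in> S5 \<Longrightarrow> g x = f x" "p \<in> S5" "p \<bullet> v = 0"
  shows "dS5 f p v = g' p v"
  by (rule dS5_eq[OF C1_on_derivative_within_S5[OF assms(1-4)] assms(4,5)])

lemma C1_on_Pair_left:
  assumes "C1_on G g g'"
  shows "C1_on {q. (t, q) \<in> G} (\<lambda>q. g (t, q)) (\<lambda>q v. g' (t, q) (0, v))"
proof (rule C1_onI)
  fix q assume "q \<in> {q. (t, q) \<in> G}"
  then have "(g has_derivative g' (t, q)) (at (t, q))"
    using C1_on_has_derivative[OF assms] by simp
  from has_derivative_compose[OF has_derivative_Pair[OF has_derivative_const has_derivative_ident] this]
  show "((\<lambda>q. g (t, q)) has_derivative (\<lambda>v. g' (t, q) (0, v))) (at q)" .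
next
  show "continuous_on ({q. (t, q) \<in> G} \<times> UNIV) (\<lambda>z. g' (t, fst z) (0, snd z))"
    by (rule C1_on_continuous_derivative[OF assms]) (auto intro!: continuous_intros)
qed

text \<open>The variation equation of the flow. Only first derivatives are used: the integral equation of
  the flow is differentiated in the initial point under the integral sign.\<close>

lemma flow_variation:
  fixes \<phi> :: "real \<Rightarrow> C3 \<Rightarrow> C3"
  assumes flow: "flow_on_S5 W \<phi>"
    and We: "C1_on V We We'" "S5 \<subseteq> V" "\<And>x. x \<in> S5 \<Longrightarrow> We x = W x"
    and g: "C1_on G g g'" "UNIV \<times> S5 \<subseteq> G" "\<And>t x. x \<in> S5 \<Longrightarrow> g (t, x) = \<phi> t x"
    and p: "p \<in> S5" "p \<bullet> v = 0"
  shows "((\<lambda>t. g' (t, p) (0, v)) has_vector_derivative We' (\<phi> t p) (g' (t, p) (0, v))) (at t)"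
proof (cases "v = 0")
  case True
  have "(t, p) \<in> G" for t
    using g(2) p(1) by blast
  then have "g' (t, p) (0, 0) = 0" for t
    using linear_0[OF C1_on_linear[OF g(1)]] by (simp add: zero_prod_def)
  moreover have "\<phi> t p \<in> V"
    using flow p(1) We(2) by (auto simp: flow_on_S5_def)
  then have "We' (\<phi> t p) 0 = 0"
    by (rule linear_0[OF C1_on_linear[OF We(1)]])
  ultimately show ?thesis using True by simp
next
  case False
  define c where "c = circle_arc p v"
  define c' where "c' = (\<lambda>s. (- sin (s * norm v) * norm v) *\<^sub>R p + (cos (s * norm v) * norm v) *\<^sub>R sgn v)"
  \<comment> \<open>Derivative of the flow along the great circle at arbitrary \<open>s\<close>.
    Only \<open>Y 0\<close> is wanted, but the Leibniz rule asks for a derivative that is continuous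
    in \<open>s\<close> as well.\<close>
  define Y where "Y = (\<lambda>s t. g' (t, c s) (0, c' s))"
  have c: "c s \<in> S5" "(c has_vector_derivative c' s) (at s)" for s
    using circle_arc_in_S5[OF p False] circle_arc_has_vector_derivative[of p v] by (auto simp: c_def c'_def)
  have c0: "c 0 = p" "c' 0 = v"
    using False by (simp_all add: c_def c'_def circle_arc_0 sgn_div_norm)
  have cc: "continuous_on A c" "continuous_on A c'" for A
    unfolding c_def c'_def circle_arc_def by (intro continuous_intros)+
  have S: "\<phi> t q \<in> S5" "\<phi> 0 q = q" "((\<lambda>s. \<phi> s q) has_vector_derivative W (\<phi> t q)) (at t)"
    if "q \<in> S5" for t q
    using flow that by (auto simp: flow_on_S5_def)
  have cg: "continuous_on A (\<lambda>x. g (a x, b x))" if "continuous_on A a" "continuous_on A b" "\<And>x. x \<in> A \<Longrightarrow> b x \<in> S5"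
    for A :: "'x::euclidean_space set" and a b
    by (rule continuous_on_compose2[OF C1_on_continuous_on[OF g(1)]])
       (use that g(2) in \<open>auto intro!: continuous_intros\<close>)
  have cY: "continuous_on A (\<lambda>x. Y (b x) (a x))" if "continuous_on A a" "continuous_on A b"
    for A :: "'x::euclidean_space set" and a b
    unfolding Y_def
    by (rule C1_on_continuous_derivative[OF g(1)])
       (use that g(2) c(1) in \<open>auto intro!: continuous_intros continuous_on_compose2[OF cc(1)[of UNIV]] continuous_on_compose2[OF cc(2)[of UNIV]]\<close>)
  have cZ: "continuous_on A (\<lambda>x. We' (g (a x, c (b x))) (Y (b x) (a x)))"
    if "continuous_on A a" "continuous_on A b"
    for A :: "'x::euclidean_space set" and a b
  proof (rule C1_on_continuous_derivative[OF We(1)])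
    show "continuous_on A (\<lambda>x. g (a x, c (b x)))"
      by (intro cg that continuous_on_compose2[OF cc(1)[of UNIV]]) (use c(1) in auto)
    show "continuous_on A (\<lambda>x. Y (b x) (a x))"
      by (intro cY that)
    show "g (a x, c (b x)) \<in> V" for x
      using We(2) c(1) S(1) g(3) by (metis subsetD)
  qed
  have dg: "((\<lambda>s. g (t, c s)) has_vector_derivative Y s t) (at s)" for s t
  proof -
    have 1: "((\<lambda>s. (t, c s)) has_vector_derivative (0, c' s)) (at s)"
      using c(2) by (auto intro!: has_vector_derivative_Pair derivative_intros)
    have "(g has_derivative g' (t, c s)) (at (t, c s))"
      using C1_on_has_derivative[OF g(1)] g(2) c(1) by blast
    from vector_derivative_diff_chain_within[OF 1 has_derivative_at_withinI[OF this]]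
    show ?thesis by (simp add: o_def Y_def)
  qed
  have dW: "((\<lambda>s. We (g (t, c s))) has_vector_derivative We' (g (t, c s)) (Y s t)) (at s within B)" for s t B
  proof -
    have "(We has_derivative We' (g (t, c s))) (at (g (t, c s)))"
      using C1_on_has_derivative[OF We(1)] We(2) c(1) S(1) g(3) by (metis subsetD)
    from vector_derivative_diff_chain_within[OF has_vector_derivative_at_within[OF dg] has_derivative_at_withinI[OF this]]
    show ?thesis by (simp add: o_def)
  qed
  \<comment> \<open>Starting the integral equation before \<open>t\<close> makes \<open>t\<close> an
    interior point of \<open>{a..t + 1}\<close>, so the derivative obtained at the end is
    two-sided.\<close>
  define a where "a = t - 1"
  have I: "g (r, c s) = g (a, c s) + integral {a..r} (\<lambda>\<sigma>. We (g (\<sigma>, c s)))" if "a \<le> r" for r s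
  proof -
    have "((\<lambda>\<sigma>. W (\<phi> \<sigma> (c s))) has_integral \<phi> r (c s) - \<phi> a (c s)) {a..r}"
      by (rule fundamental_theorem_of_calculus[OF that])
         (use S(3)[OF c(1)] in \<open>auto intro: has_vector_derivative_at_within\<close>)
    then have "integral {a..r} (\<lambda>\<sigma>. W (\<phi> \<sigma> (c s))) = \<phi> r (c s) - \<phi> a (c s)"
      by (rule integral_unique)
    then show ?thesis using We(3) S(1) c(1) g(3) by simp
  qed
  \<comment> \<open>The equation \<open>I\<close> is differentiated at \<open>s = 0\<close> under
    the integral sign, and \<open>dg\<close> identifies the derivative of its left side. This is the
    variation equation in integrated form.\<close>
  have J: "Y 0 r = Y 0 a + integral {a..r} (\<lambda>\<sigma>. We' (g (\<sigma>, p)) (Y 0 \<sigma>))" if "a \<le> r" for r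
  proof -
    have "((\<lambda>s. integral (cbox a r) (\<lambda>\<sigma>. We (g (\<sigma>, c s)))) has_vector_derivative
        integral (cbox a r) (\<lambda>\<sigma>. We' (g (\<sigma>, c 0)) (Y 0 \<sigma>))) (at 0 within UNIV)"
    proof (rule leibniz_rule_vector_derivative[OF dW])
      show "(\<lambda>\<sigma>. We (g (\<sigma>, c s))) integrable_on cbox a r" for s
      proof (rule integrable_continuous, rule continuous_on_compose2[OF C1_on_continuous_on[OF We(1)]])
        show "continuous_on (cbox a r) (\<lambda>\<sigma>. g (\<sigma>, c s))"
          by (intro cg continuous_intros c(1))
        show "(\<lambda>\<sigma>. g (\<sigma>, c s)) ` cbox a r \<subseteq> V"
          using We(2) S(1)[OF c(1)] unfolding g(3)[OF c(1)] by blast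
      qed
      show "continuous_on (UNIV \<times> cbox a r) (\<lambda>(s, \<sigma>). We' (g (\<sigma>, c s)) (Y s \<sigma>))"
        unfolding case_prod_beta by (intro cZ continuous_intros)
    qed auto
    then have "((\<lambda>s. g (a, c s) + integral (cbox a r) (\<lambda>\<sigma>. We (g (\<sigma>, c s)))) has_vector_derivative
        Y 0 a + integral (cbox a r) (\<lambda>\<sigma>. We' (g (\<sigma>, c 0)) (Y 0 \<sigma>))) (at 0)"
      by (intro has_vector_derivative_add dg) simp
    then have "((\<lambda>s. g (r, c s)) has_vector_derivative
        Y 0 a + integral {a..r} (\<lambda>\<sigma>. We' (g (\<sigma>, p)) (Y 0 \<sigma>))) (at 0)"
      using I[OF that] by (simp add: c0)
    with dg[of r 0] show ?thesis by (rule vector_derivative_unique_at)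
  qed
  have "((\<lambda>r. Y 0 a + integral {a..r} (\<lambda>\<sigma>. We' (g (\<sigma>, p)) (Y 0 \<sigma>))) has_vector_derivative
      0 + We' (g (t, p)) (Y 0 t)) (at t within {a..t + 1})"
  proof (intro has_vector_derivative_add integral_has_vector_derivative)
    show "continuous_on {a..t + 1} (\<lambda>\<sigma>. We' (g (\<sigma>, p)) (Y 0 \<sigma>))"
      using cZ[of "{a..t + 1}" "\<lambda>x. x" "\<lambda>_. 0"] by (simp add: c0 continuous_on_id)
  qed (auto simp: a_def)
  then have K: "((\<lambda>r. Y 0 a + integral {a..r} (\<lambda>\<sigma>. We' (g (\<sigma>, p)) (Y 0 \<sigma>))) has_vector_derivative
      We' (g (t, p)) (Y 0 t)) (at t within {a..t + 1})" by simp
  have "((Y 0) has_vector_derivative We' (g (t, p)) (Y 0 t)) (at t within {a..t + 1})"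
  proof (rule has_vector_derivative_transform[OF _ _ K])
    show "t \<in> {a..t + 1}" by (simp add: a_def)
    show "Y 0 r = Y 0 a + integral {a..r} (\<lambda>\<sigma>. We' (g (\<sigma>, p)) (Y 0 \<sigma>))" if "r \<in> {a..t + 1}" for r
      by (rule J) (use that in simp)
  qed
  moreover have "at t within {a..t + 1} = at t"
    by (rule at_within_interior) (simp add: a_def)
  ultimately show ?thesis using g(3)[OF p(1), of t] by (simp add: Y_def c0)
qed

text \<open>Differentiating \<open>\<alpha>(d\<phi>\<^sub>t v) = 0\<close> at \<open>t = 0\<close>.\<close>

lemma contact_identity_field:
  assumes H: "hamiltonian_flow F W \<phi>"
    and We: "C1_on V We We'" "S5 \<subseteq> V" "\<And>x. x \<in> S5 \<Longrightarrow> We x = W x"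
    and p: "p \<in> S5" "v \<in> horizontal p"
  shows "alpha p (We' p v) + alpha (W p) v = 0"
proof -
  have fl: "flow_on_S5 W \<phi>" "smooth_on (UNIV \<times> S5) (\<lambda>(t, p). \<phi> t p)"
    using H by (auto simp: hamiltonian_flow_def flow_on_S5_def)
  obtain G g g' where g: "open G" "UNIV \<times> S5 \<subseteq> G" "C1_on G g g'"
      "\<And>x. x \<in> UNIV \<times> S5 \<Longrightarrow> g x = (\<lambda>(t, p). \<phi> t p) x"
    using smooth_on_imp_C1_on[OF fl(2)] by metis
  have g4: "g (t, x) = \<phi> t x" if "x \<in> S5" for t x
    using g(4)[of "(t, x)"] that by simp
  have pv: "p \<bullet> v = 0" "alpha p v = 0" using p(2) by (auto simp: horizontal_def)
  define Y where "Y = (\<lambda>t. g' (t, p) (0, v))"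
  have S: "\<phi> t p \<in> S5" "\<phi> 0 q = q" "((\<lambda>s. \<phi> s p) has_vector_derivative W (\<phi> t p)) (at t)"
    if "q \<in> S5" for t q
    using fl(1) that p(1) by (auto simp: flow_on_S5_def)
  have dY: "(Y has_vector_derivative We' (\<phi> t p) (Y t)) (at t)" for t
    unfolding Y_def
    by (rule flow_variation[OF fl(1) We g(3,2) g4 p(1) pv(1)])
  have gt: "S5 \<subseteq> {q. (t, q) \<in> G}" for t using g(2) by blast
  have "Y t = dS5 (\<phi> t) p v" for t
    unfolding Y_def using C1_on_dS5[OF C1_on_Pair_left[OF g(3)] gt g4 p(1) pv(1)] by simp
  moreover have "dS5 (\<phi> t) p ` horizontal p = horizontal (\<phi> t p)" for t
    using H p(1) by (simp add: hamiltonian_flow_def)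
  then have "dS5 (\<phi> t) p v \<in> horizontal (\<phi> t p)" for t
    using p(2) by blast
  ultimately have "alpha (\<phi> t p) (Y t) = 0" for t
    by (simp add: horizontal_def)
  moreover have "((\<lambda>t. alpha (\<phi> t p) (Y t)) has_vector_derivative
      alpha (\<phi> 0 p) (We' (\<phi> 0 p) (Y 0)) + alpha (W (\<phi> 0 p)) (Y 0)) (at 0)"
    by (rule bounded_bilinear.has_vector_derivative[OF bounded_bilinear_alpha S(3)[OF p(1)] dY])
  ultimately have "alpha (\<phi> 0 p) (We' (\<phi> 0 p) (Y 0)) + alpha (W (\<phi> 0 p)) (Y 0) = 0"
    using vector_derivative_unique_at[OF has_vector_derivative_const] by simp
  \<comment> \<open>\<open>g (0, q)\<close> extends the identity of \<open>S5\<close>. Its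
    derivative is pinned down on tangent vectors only, and \<open>v\<close> is one.\<close>
  moreover have "Y 0 = v"
  proof -
    have "((\<lambda>q. q) has_derivative (\<lambda>v. g' (0, p) (0, v))) (at p within S5)"
      using C1_on_derivative_within_S5[OF C1_on_Pair_left[OF g(3)] gt _ p(1), of 0 "\<lambda>q. q"] g4 S(2)
      by simp
    from derivative_within_S5_unique[OF this has_derivative_ident p(1) pv(1)]
    show ?thesis by (simp add: Y_def)
  qed
  ultimately show ?thesis
    using S(2)[OF p(1)] by simp
qed

text \<open>The contact Hamiltonian equation: contracting d\<alpha> with W gives -dF on the contact
  planes, because \<open>dalpha (W p) v = 2 * alpha (W p) v\<close>. Differentiating
  \<open>alpha q (W q) = F q\<close> produces two terms, and \<open>contact_identity_field\<close>
  says that they are equal.\<close>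

lemma contact_identity:
  assumes H: "hamiltonian_flow F W \<phi>"
    and F: "(F has_derivative D) (at p within S5)"
    and p: "p \<in> S5" "v \<in> horizontal p"
  shows "D v + 2 * alpha (W p) v = 0"
proof -
  obtain V We We' where We: "open V" "S5 \<subseteq> V" "C1_on V We We'" "\<And>x. x \<in> S5 \<Longrightarrow> We x = W x"
    using H smooth_on_imp_C1_on[of S5 W] unfolding hamiltonian_flow_def by metis
  have pv: "p \<bullet> v = 0" using p(2) by (auto simp: horizontal_def)
  note 1 = contact_identity_field[OF H We(3,2,4) p]
  have "C1_on V (\<lambda>q. alpha q (We q)) (\<lambda>q v. alpha q (We' q v) + alpha v (We q))"
    using C1_on_bilinear[OF bounded_bilinear_alpha C1_on_bounded_linear[OF bounded_linear_ident] We(3)] .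
  moreover have "alpha q (We q) = F q" if "q \<in> S5" for q
    using H We(4)[OF that] that by (simp add: hamiltonian_flow_def)
  ultimately have "(F has_derivative (\<lambda>v. alpha p (We' p v) + alpha v (We p))) (at p within S5)"
    by (intro C1_on_derivative_within_S5[OF _ We(2) _ p(1)])
  from derivative_within_S5_unique[OF F this p(1) pv]
  show ?thesis using 1 We(4)[OF p(1)] by (simp add: alpha_commute[of v])
qed

text \<open>Off the support dF is 0, so \<open>contact_identity\<close> gives
  \<open>alpha (W p) v = 0\<close> for horizontal \<open>v\<close>. As F is 0 at \<open>p\<close>,
  the vector \<open>W p\<close> is horizontal, hence so is \<open>\<i> *s W p\<close>; inserting
  this vector yields \<open>W p \<bullet> W p = 0\<close>.\<close>

lemma hamiltonian_field_vanishes: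
  assumes H: "hamiltonian_flow F W \<phi>" and p: "p \<in> S5" "p \<notin> support_S5 F"
  shows "W p = 0"
proof -
  have z: "F q = 0" if "q \<in> S5" "q \<notin> support_S5 F" for q
    using that closure_subset[of "{p \<in> S5. F p \<noteq> 0}"] by (auto simp: support_S5_def)
  have o: "open (- support_S5 F)" by (simp add: support_S5_def open_Compl)
  have F: "(F has_derivative (\<lambda>_. 0)) (at p within S5)"
  proof (rule has_derivative_transform_eventually[OF has_derivative_const[of 0]])
    show "\<forall>\<^sub>F q in at p within S5. 0 = F q"
      unfolding eventually_at_topological using o p z by (intro exI[of _ "- support_S5 F"]) auto
  qed (use p z in auto)
  have W: "p \<bullet> W p = 0" "alpha p (W p) = 0"
    using H p z by (auto simp: hamiltonian_flow_def)
  have "\<i> *s W p \<in> horizontal p"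
    using W alpha_commute[of p "W p"] inner_i_mult[of p "W p"]
    by (simp add: horizontal_def alpha_eq_inner inner_commute)
  from contact_identity[OF H F p(1) this]
  have "alpha (W p) (\<i> *s W p) = 0" by simp
  then show ?thesis by (simp add: alpha_eq_inner inner_i_mult)
qed

section \<open>Gluing and cutting off continuously differentiable maps\<close>

lemma C1_on_local:
  assumes "\<And>x. x \<in> U \<Longrightarrow> \<exists>N. open N \<and> x \<in> N \<and> C1_on N f f'"
  shows "C1_on U f f'"
proof (rule C1_onI)
  show "(f has_derivative f' x) (at x)" if "x \<in> U" for x
    using assms[OF that] by (auto intro: C1_on_has_derivative)
  have "isCont (\<lambda>z. f' (fst z) (snd z)) z" if z: "z \<in> U \<times> UNIV" for z
  proof -
    have "fst z \<in> U" using z by auto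
    then obtain N where N: "open N" "fst z \<in> N" "C1_on N f f'"
      using assms[of "fst z"] by blast
    have "open (N \<times> (UNIV :: 'a set))" "z \<in> N \<times> UNIV"
      using N by (auto simp: open_Times mem_Times_iff)
    then show ?thesis
      using continuous_on_C1_derivative[OF N(3)]
      by (metis continuous_on_eq_continuous_at)
  qed
  then show "continuous_on (U \<times> UNIV) (\<lambda>z. f' (fst z) (snd z))"
    by (rule continuous_at_imp_continuous_on[OF ballI])
qed

lemma C1_on_cong_open:
  assumes "open N" "C1_on N g g'" "\<And>x. x \<in> N \<Longrightarrow> f x = g x" "\<And>x v. x \<in> N \<Longrightarrow> f' x v = g' x v"
  shows "C1_on N f f'"
proof (rule C1_onI)
  fix x assume x: "x \<in> N"
  have "(f has_derivative g' x) (at x)"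
    by (rule has_derivative_transform_within_open[OF C1_on_has_derivative[OF assms(2) x] assms(1) x
          assms(3)[symmetric]])
  moreover have "g' x = f' x" by (rule ext) (rule assms(4)[OF x, symmetric])
  ultimately show "(f has_derivative f' x) (at x)" by simp
next
  have "g' (fst z) (snd z) = f' (fst z) (snd z)" if "z \<in> N \<times> UNIV" for z
    by (rule assms(4)[symmetric]) (use that in auto)
  from continuous_on_eq[OF continuous_on_C1_derivative[OF assms(2)] this]
  show "continuous_on (N \<times> UNIV) (\<lambda>z. f' (fst z) (snd z))" .
qed

lemma C1_on_zero_derivative:
  assumes "C1_on N w w'" "open N" "x \<in> N" "\<And>y. y \<in> N \<Longrightarrow> w y = 0"
  shows "w' x v = 0"
proof -
  have "(w has_derivative (\<lambda>_. 0)) (at x)"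
    by (rule has_derivative_transform_within_open[OF has_derivative_const[of 0] assms(2,3)]) (simp add: assms(4))
  then have "w' x = (\<lambda>_. 0)"
    by (rule has_derivative_unique[OF C1_on_has_derivative[OF assms(1,3)]])
  then show ?thesis by simp
qed

text \<open>Turns a variation over an open part of the torus into a map on all of it: the field
  along the torus vanishes near the frontier, so cutting it off there creates no jump. First
  variations over \<open>S\<close> become integrals over the whole torus, whatever the shape of the
  frontier.\<close>

lemma C1_on_cutoff:
  assumes w: "C1_on UNIV w w'" and S: "open S"
    and fr: "\<And>x. x \<in> frontier S \<Longrightarrow> \<exists>N. open N \<and> x \<in> N \<and> (\<forall>y\<in>N. w y = 0)"
  shows "C1_on UNIV (\<lambda>x. if x \<in> S then w x else 0) (\<lambda>x v. if x \<in> S then w' x v else 0)"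
    (is "C1_on UNIV ?f ?f'")
proof (rule C1_on_local)
  fix x
  have z: "C1_on N (\<lambda>_. 0) (\<lambda>_ _. 0)" for N
    by (rule C1_onI) auto
  consider "x \<in> S" | "x \<in> - closure S" | "x \<in> frontier S"
    using S by (auto simp: frontier_def interior_open)
  then show "\<exists>N. open N \<and> x \<in> N \<and> C1_on N ?f ?f'"
  proof cases
    case 1
    have "C1_on S ?f ?f'"
      by (rule C1_on_cong_open[OF S C1_on_subset[OF w subset_UNIV]]) simp_all
    with 1 S show ?thesis by (intro exI conjI)
  next
    case 2
    have *: "y \<notin> S" if "y \<in> - closure S" for y
      using that closure_subset[of S] by blast
    have "open (- closure S)" by (rule open_Compl[OF closed_closure])
    moreover from this have "C1_on (- closure S) ?f ?f'"
      by (rule C1_on_cong_open[OF _ z]) (simp_all add: *)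
    ultimately show ?thesis using 2 by (intro exI conjI)
  next
    case 3
    obtain N where N: "open N" "x \<in> N" "\<forall>y\<in>N. w y = 0" using fr[OF 3] by (elim exE conjE)
    have w0: "w y = 0" if "y \<in> N" for y using N(3) that by (rule bspec)
    have w1: "w' y v = 0" if "y \<in> N" for y v
      by (rule C1_on_zero_derivative[OF C1_on_subset[OF w subset_UNIV] N(1) that w0])
    have "C1_on N ?f ?f'"
      by (rule C1_on_cong_open[OF N(1) z]) (simp_all add: w0 w1)
    with N(1,2) show ?thesis by (intro exI conjI)
  qed
qed

section \<open>Homogeneous Legendrian tori\<close>

text \<open>The action of the diagonal torus of U(3) on \<open>c\<close>. It preserves the inner
  product and \<alpha>, so pointwise identities along the tori reduce to identities between
  coefficient vectors.\<close>

definition trig3 :: "C3 \<Rightarrow> real ^ 3 \<Rightarrow> C3" where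
  "trig3 c \<theta> = (\<chi> j. c $ j * cis (\<theta> $ j))"

lemma trig3_inner: "trig3 c \<theta> \<bullet> trig3 d \<theta> = c \<bullet> d"
proof -
  have "(a * cis t) \<bullet> (b * cis t) = a \<bullet> b" for a b :: complex and t
  proof -
    have "(a * cis t) \<bullet> (b * cis t) = (a \<bullet> b) * ((cos t)\<^sup>2 + (sin t)\<^sup>2)"
      by (simp only: inner_complex_def times_complex.sel cis.sel) algebra
    then show ?thesis by simp
  qed
  then show ?thesis by (simp add: trig3_def inner_vec_def)
qed

lemma trig3_mult: "z *s trig3 c \<theta> = trig3 (z *s c) \<theta>"
  by (simp add: trig3_def vec_eq_iff)

lemma trig3_alpha: "alpha (trig3 c \<theta>) (trig3 d \<theta>) = alpha c d"
  by (simp add: alpha_eq_inner trig3_mult trig3_inner)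

lemma trig3_add: "trig3 (c + d) \<theta> = trig3 c \<theta> + trig3 d \<theta>"
  by (simp add: trig3_def vec_eq_iff algebra_simps)

lemma trig3_scaleR: "trig3 (r *\<^sub>R c) \<theta> = r *\<^sub>R trig3 c \<theta>"
  by (simp add: trig3_def vec_eq_iff)

lemma continuous_on_trig3 [continuous_intros]:
  assumes "continuous_on A c" "continuous_on A t"
  shows "continuous_on A (\<lambda>x. trig3 (c x) (t x))"
  unfolding trig3_def cis_conv_exp by (intro continuous_intros assms)

definition wave_deriv :: "C3 \<Rightarrow> (real \<times> real) ^ 3 \<Rightarrow> real \<times> real \<Rightarrow> C3" where
  "wave_deriv c m v = (\<chi> j. c $ j * \<i> * complex_of_real (m $ j \<bullet> v))"

definition wave :: "C3 \<Rightarrow> (real \<times> real) ^ 3 \<Rightarrow> real \<times> real \<Rightarrow> C3" where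
  "wave c m x = trig3 c (\<chi> j. m $ j \<bullet> x)"

lemma has_derivative_vec_lambda:
  fixes f :: "'a::real_normed_vector \<Rightarrow> 'b::euclidean_space ^ 'n"
  assumes "\<And>j. ((\<lambda>x. f x $ j) has_derivative (\<lambda>v. D v $ j)) (at x)"
  shows "(f has_derivative D) (at x)"
proof -
  have "((\<lambda>x. f x \<bullet> i) has_derivative (\<lambda>v. D v \<bullet> i)) (at x)" if i: "i \<in> Basis" for i
  proof -
    obtain j b where "i = axis j b" using i by (auto simp: Basis_vec_def)
    then show ?thesis
      using has_derivative_inner_left[OF assms, of j b] by (simp add: inner_axis)
  qed
  then show ?thesis by (subst has_derivative_componentwise_within) auto
qed

lemma wave_C1: "C1_on UNIV (wave c m) (\<lambda>x v. wave (wave_deriv c m v) m x)"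
proof (rule C1_onI)
  fix x
  have "((\<lambda>x. c $ j * cis (m $ j \<bullet> x)) has_derivative
      (\<lambda>v. c $ j * \<i> * of_real (m $ j \<bullet> v) * cis (m $ j \<bullet> x))) (at x)" for j
  proof -
    have "((\<lambda>x. exp (\<i> * of_real (m $ j \<bullet> x))) has_derivative
        (\<lambda>v. exp (\<i> * of_real (m $ j \<bullet> x)) * (\<i> * of_real (m $ j \<bullet> v)))) (at x)"
      by (rule has_derivative_compose[OF _ DERIV_exp[THEN has_field_derivative_imp_has_derivative]])
         (auto intro!: derivative_eq_intros)
    from has_derivative_mult_right[OF this, of "c $ j"] show ?thesis
      by (simp add: cis_conv_exp mult_ac)
  qed
  then show "(wave c m has_derivative (\<lambda>v. wave (wave_deriv c m v) m x)) (at x)"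
    by (intro has_derivative_vec_lambda) (simp add: wave_def trig3_def wave_deriv_def)
next
  show "continuous_on (UNIV \<times> UNIV) (\<lambda>z. wave (wave_deriv c m (snd z)) m (fst z))"
    unfolding wave_def wave_deriv_def by (intro continuous_intros)
qed

text \<open>A directional derivative of a wave is a wave with the same frequencies and other
  coefficients, so the induction runs over all coefficient vectors at once.\<close>

lemma wave_smooth: "smooth_on UNIV (wave c m)"
proof -
  have "Ck_on k UNIV (wave c m)" for k
  proof (induction k arbitrary: c)
    case 0
    show ?case using C1_on_continuous_on[OF wave_C1] by simp
  next
    case (Suc k)
    then show ?case
      using C1_on_has_derivative[OF wave_C1, of _ c m]
      by (auto simp: C1_on_frechet[OF wave_C1] differentiable_def)
  qed
  then show ?thesis unfolding smooth_on_def by blast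
qed

text \<open>Coefficients of the point; \<open>coef1\<close> and \<open>coef2\<close> below are those
  of the unit vectors along the two partial derivatives. Dividing out the conformal factor
  \<open>sin \<omega>\<close> lets the frame survive at \<omega> = 0, where the derivatives
  themselves tend to 0.\<close>

definition coef_pt :: "real \<Rightarrow> C3" where
  "coef_pt \<omega> = vector [of_real (sin \<omega> / sqrt 2), of_real (sin \<omega> / sqrt 2), of_real (cos \<omega>)]"

definition coef1 :: C3 where
  "coef1 = vector [\<i> * of_real (1 / sqrt 2), - \<i> * of_real (1 / sqrt 2), 0]"

definition coef2 :: "real \<Rightarrow> C3" where
  "coef2 \<omega> = vector [\<i> * of_real (cos \<omega> / sqrt 2), \<i> * of_real (cos \<omega> / sqrt 2), - \<i> * of_real (sin \<omega>)]"

lemmas coef_defs = coef_pt_def coef1_def coef2_def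

lemma frame_algebra:
  "coef_pt \<omega> \<bullet> coef_pt \<omega> = 1" "coef1 \<bullet> coef1 = 1" "coef2 \<omega> \<bullet> coef2 \<omega> = 1"
  "coef_pt \<omega> \<bullet> coef1 = 0" "coef_pt \<omega> \<bullet> coef2 \<omega> = 0" "coef1 \<bullet> coef2 \<omega> = 0"
  "alpha (coef_pt \<omega>) coef1 = 0" "alpha (coef_pt \<omega>) (coef2 \<omega>) = 0" "alpha coef1 (coef2 \<omega>) = 0"
proof -
  have "coef_pt \<omega> \<bullet> coef_pt \<omega> = 2 * (sin \<omega> / sqrt 2)\<^sup>2 + (cos \<omega>)\<^sup>2"
    "coef2 \<omega> \<bullet> coef2 \<omega> = 2 * (cos \<omega> / sqrt 2)\<^sup>2 + (sin \<omega>)\<^sup>2"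
    "coef1 \<bullet> coef1 = 2 * (1 / sqrt 2)\<^sup>2"
    by (simp_all add: coef_defs inner_vec_def inner_complex_def sum_3 power2_eq_square)
  then show "coef_pt \<omega> \<bullet> coef_pt \<omega> = 1" "coef2 \<omega> \<bullet> coef2 \<omega> = 1" "coef1 \<bullet> coef1 = 1"
    by (simp_all add: power_divide)
  show "coef_pt \<omega> \<bullet> coef1 = 0" "coef_pt \<omega> \<bullet> coef2 \<omega> = 0" "coef1 \<bullet> coef2 \<omega> = 0"
    "alpha (coef_pt \<omega>) coef1 = 0" "alpha (coef_pt \<omega>) (coef2 \<omega>) = 0" "alpha coef1 (coef2 \<omega>) = 0"
    by (simp_all add: coef_defs inner_vec_def inner_complex_def alpha_def sum_3 field_simps)
qed

text \<open>With \<open>n = cot\<^sup>2 \<omega>\<close> the phases below are well defined modulo \<open>2\<pi>\<close> on the torus with periods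
  \<open>2\<pi>\<close> and \<open>2\<pi>R\<close>, and the map is conformal with factor \<open>sin \<omega>\<close>.\<close>

locale torus =
  fixes \<omega> R :: real and n :: nat
  assumes sin_pos: "sin \<omega> > 0" and cos_pos: "cos \<omega> > 0"
    and R_cos: "R * cos \<omega> = real n" and R_sin: "R * (sin \<omega>)\<^sup>2 = cos \<omega>"
begin

lemma R_pos: "R > 0"
  using R_sin sin_pos cos_pos by (metis zero_less_mult_pos2 zero_less_power)

definition freq :: "(real \<times> real) ^ 3" where
  "freq = vector [(1, cos \<omega>), (- 1, cos \<omega>), (0, - 1 / R)]"

definition angle :: "real \<times> real \<Rightarrow> real ^ 3" where
  "angle x = vector [fst x + cos \<omega> * snd x, - fst x + cos \<omega> * snd x, - snd x / R]"

definition u :: "real \<times> real \<Rightarrow> C3" where "u = wave (coef_pt \<omega>) freq"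

lemma angle_eq: "(\<chi> j. freq $ j \<bullet> x) = angle x"
  by (cases x) (simp add: vec_eq_iff forall_3 freq_def angle_def)

lemma wave_eq: "wave c freq x = trig3 c (angle x)"
  by (simp add: wave_def angle_eq)

lemma u_eq: "u x = trig3 (coef_pt \<omega>) (angle x)"
  by (simp add: u_def wave_eq)

lemma wave_deriv_coef_pt:
  "wave_deriv (coef_pt \<omega>) freq v = (fst v * sin \<omega>) *\<^sub>R coef1 + (snd v * sin \<omega>) *\<^sub>R coef2 \<omega>"
proof -
  have "b * cos \<omega> / R = b * (sin \<omega> * sin \<omega>)" for b
    unfolding R_sin[symmetric] using R_pos by (simp add: power2_eq_square)
  then show ?thesis
    by (cases v) (simp add: vec_eq_iff forall_3 wave_deriv_def coef_defs freq_def power2_eq_square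
        complex_eq_iff field_simps)
qed

definition fr1 :: "real \<times> real \<Rightarrow> C3" where "fr1 = wave (sin \<omega> *\<^sub>R coef1) freq"
definition fr2 :: "real \<times> real \<Rightarrow> C3" where "fr2 = wave (sin \<omega> *\<^sub>R coef2 \<omega>) freq"

definition du :: "real \<times> real \<Rightarrow> real \<times> real \<Rightarrow> C3" where
  "du x v = fst v *\<^sub>R fr1 x + snd v *\<^sub>R fr2 x"

lemma u_C1: "C1_on UNIV u du"
proof -
  have "du = (\<lambda>x v. wave (wave_deriv (coef_pt \<omega>) freq v) freq x)"
    by (simp add: fun_eq_iff wave_deriv_coef_pt du_def fr1_def fr2_def wave_eq trig3_add trig3_scaleR)
  then show ?thesis unfolding u_def by (simp add: wave_C1)
qed

lemma pd_u: "pd1 u = fr1" "pd2 u = fr2"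
  by (simp_all add: pd1_eq[OF u_C1] pd2_eq[OF u_C1] du_def)

lemma frame_inner:
  "u x \<bullet> u x = 1" "fr1 x \<bullet> fr1 x = (sin \<omega>)\<^sup>2" "fr2 x \<bullet> fr2 x = (sin \<omega>)\<^sup>2"
  "u x \<bullet> fr1 x = 0" "u x \<bullet> fr2 x = 0" "fr1 x \<bullet> fr2 x = 0"
  "alpha (u x) (fr1 x) = 0" "alpha (u x) (fr2 x) = 0" "alpha (fr1 x) (fr2 x) = 0"
proof -
  interpret a: bounded_bilinear alpha by (rule bounded_bilinear_alpha)
  show "u x \<bullet> u x = 1" "fr1 x \<bullet> fr1 x = (sin \<omega>)\<^sup>2" "fr2 x \<bullet> fr2 x = (sin \<omega>)\<^sup>2"
    "u x \<bullet> fr1 x = 0" "u x \<bullet> fr2 x = 0" "fr1 x \<bullet> fr2 x = 0"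
    "alpha (u x) (fr1 x) = 0" "alpha (u x) (fr2 x) = 0" "alpha (fr1 x) (fr2 x) = 0"
    unfolding u_eq fr1_def fr2_def wave_eq trig3_inner trig3_alpha
    by (simp_all add: frame_algebra a.scaleR_left a.scaleR_right power2_eq_square)
qed

lemma u_in_S5: "u x \<in> S5"
  using frame_inner(1)[of x] by (simp add: norm_eq_1)

lemma du_horizontal: "du x v \<in> horizontal (u x)"
proof -
  interpret a: bounded_bilinear alpha by (rule bounded_bilinear_alpha)
  show ?thesis
    by (simp add: horizontal_def du_def inner_add_right frame_inner a.add_right a.scaleR_right)
qed


lemma fr_C1:
  "C1_on UNIV fr1 (\<lambda>x v. wave (wave_deriv (sin \<omega> *\<^sub>R coef1) freq v) freq x)"
  "C1_on UNIV fr2 (\<lambda>x v. wave (wave_deriv (sin \<omega> *\<^sub>R coef2 \<omega>) freq v) freq x)"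
  unfolding fr1_def fr2_def by (rule wave_C1)+

text \<open>The normal part of \<open>\<Delta>u\<close> is a constant multiple of \<open>J u\<^sub>y\<close> because the Lagrangian angle of
  the torus is an affine function of \<open>y\<close>.\<close>

definition K :: real where "K = (3 * (cos \<omega>)\<^sup>2 - 1) / cos \<omega>"

text \<open>The term with \<open>u x\<close> is minus the squared gradient times \<open>u x\<close>,
  the part normal to the sphere. The first two components then force
  \<open>K * cos \<omega> = 3 * (cos \<omega>)\<^sup>2 - 1\<close>, and the third gives the same
  \<open>K\<close> because \<open>R_sin\<close> fixes \<open>1 / R\<close>.\<close>

lemma laplacian:
  "wave (wave_deriv (sin \<omega> *\<^sub>R coef1) freq (1, 0)) freq x + wave (wave_deriv (sin \<omega> *\<^sub>R coef2 \<omega>) freq (0, 1)) freq x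
    = - (2 * (sin \<omega>)\<^sup>2) *\<^sub>R u x + K *\<^sub>R (\<i> *s fr2 x)"
proof -
  have R: "1 / R = (sin \<omega>)\<^sup>2 / cos \<omega>"
    using R_sin R_pos cos_pos by (simp add: field_simps)
  have "wave_deriv (sin \<omega> *\<^sub>R coef1) freq (1, 0) + wave_deriv (sin \<omega> *\<^sub>R coef2 \<omega>) freq (0, 1)
    = - (2 * (sin \<omega>)\<^sup>2) *\<^sub>R coef_pt \<omega> + K *\<^sub>R (\<i> *s (sin \<omega> *\<^sub>R coef2 \<omega>))"
  proof -
    have f3: "freq = vector [(1, cos \<omega>), (- 1, cos \<omega>), (0, - ((sin \<omega>)\<^sup>2 / cos \<omega>))]"
      using R by (simp add: freq_def)
    have k: "K * cos \<omega> = 3 * (cos \<omega>)\<^sup>2 - 1"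
      using cos_pos by (simp add: K_def)
    have s: "(sin \<omega>)\<^sup>2 = 1 - (cos \<omega>)\<^sup>2" by (rule sin_squared_eq)
    have 1: "- (sin \<omega> / sqrt 2) - sin \<omega> * (cos \<omega> * cos \<omega>) / sqrt 2 =
        - (K * sin \<omega> * cos \<omega> / sqrt 2) - 2 * (sin \<omega>)\<^sup>2 * sin \<omega> / sqrt 2"
      unfolding divide_inverse using k s by algebra
    have 2: "sin \<omega> * (sin \<omega> * (sin \<omega>)\<^sup>2) = (2 * (sin \<omega>)\<^sup>2 * cos \<omega> - K * sin \<omega> * sin \<omega>) * cos \<omega>"
      using k s by algebra
    have 3: "- (sin \<omega> * (sin \<omega> * (sin \<omega>)\<^sup>2) / cos \<omega>) = K * sin \<omega> * sin \<omega> - 2 * (sin \<omega>)\<^sup>2 * cos \<omega>"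
      unfolding 2 using cos_pos by simp
    show ?thesis
      unfolding f3
      by (simp add: vec_eq_iff forall_3 wave_deriv_def coef_defs complex_eq_iff) (simp only: 1 3 simp_thms)
  qed
  from arg_cong[OF this, of "\<lambda>c. wave c freq x"] show ?thesis
    by (simp only: wave_eq trig3_add trig3_scaleR trig3_mult[symmetric] u_eq fr2_def)
qed

lemma angle_periodic:
  assumes "l \<in> torus_lattice R"
  shows "\<exists>k :: int ^ 3. angle (x + l) = angle x + (\<chi> j. 2 * pi * of_int (k $ j))"
proof -
  obtain a b where l: "l = (2 * pi * of_int a, 2 * pi * R * of_int b)"
    using assms by (auto simp: torus_lattice_def)
  have n: "cos \<omega> * (2 * pi * R * of_int b) = 2 * pi * (real n * of_int b)"
    unfolding R_cos[symmetric] by simp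
  show ?thesis
    \<comment> \<open>A period in \<open>x\<close> turns the first two phases once in opposite
      senses; a period in \<open>y\<close> turns both of them \<open>n\<close> times and the third
      one -1 times.\<close>
    by (rule exI[of _ "vector [a + int n * b, - a + int n * b, - b]"])
       (use R_pos n in \<open>simp add: vec_eq_iff forall_3 angle_def l field_simps\<close>)
qed

lemma trig3_periodic: "trig3 c (\<theta> + (\<chi> j. 2 * pi * of_int (k $ j))) = trig3 c \<theta>"
  by (simp add: trig3_def vec_eq_iff flip: cis_mult)

lemma wave_periodic: "torus_periodic R (wave c freq)"
  unfolding torus_periodic_def wave_eq using angle_periodic trig3_periodic by metis

text \<open>With \<open>w\<close> the field along \<open>u\<close>, cut off outside
  \<open>S\<close>, periodicity removes the derivatives of \<open>fr1 x \<bullet> w x\<close> and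
  \<open>fr2 x \<bullet> w x\<close> and leaves the Laplacian of \<open>u\<close> paired with
  \<open>w\<close>. Its part along \<open>u x\<close> pairs to 0 because W is tangent to the sphere;
  its other part is \<open>K / 2\<close> times the \<open>y\<close> derivative of
  \<open>alpha (u x) (w x)\<close>, again of integral 0.\<close>

lemma first_variation:
  assumes S: "open S" "torus_periodic R (\<lambda>x. x \<in> S)"
    and H: "hamiltonian_flow F W \<phi>"
    and sup: "support_S5 F \<inter> u ` frontier S = {}"
    and We: "C1_on V We We'" "S5 \<subseteq> V" "\<And>x. x \<in> S5 \<Longrightarrow> We x = W x"
  shows "(LINT x:torus_domain R \<inter> S|lborel.
      fr1 x \<bullet> We' (u x) (fr1 x) + fr2 x \<bullet> We' (u x) (fr2 x)) = 0"
proof -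
  define w where "w = (\<lambda>x. if x \<in> S then We (u x) else 0)"
  define w' where "w' = (\<lambda>x v. if x \<in> S then We' (u x) (du x v) else 0)"
  have uV: "u x \<in> V" for x using u_in_S5 We(2) by blast
  have wu: "C1_on UNIV (\<lambda>x. We (u x)) (\<lambda>x v. We' (u x) (du x v))"
    by (rule C1_on_compose[OF u_C1 We(1)]) (rule uV)
  have w: "C1_on UNIV w w'"
    unfolding w_def w'_def
  proof (rule C1_on_cutoff[OF wu S(1)])
    fix x assume "x \<in> frontier S"
    then have x: "u x \<notin> support_S5 F" using sup by blast
    let ?N = "u -` (- support_S5 F)"
    have "open ?N"
      by (rule open_vimage[OF _ C1_on_continuous_on[OF u_C1]]) (simp add: support_S5_def open_Compl)
    moreover have "We (u y) = 0" if "y \<in> ?N" for y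
      using hamiltonian_field_vanishes[OF H u_in_S5, of y] that We(3)[OF u_in_S5, of y] by simp
    ultimately show "\<exists>N. open N \<and> x \<in> N \<and> (\<forall>y\<in>N. We (u y) = 0)"
      using x by (intro exI[of _ ?N]) simp
  qed
  have Sp: "x + l \<in> S \<longleftrightarrow> x \<in> S" if "l \<in> torus_lattice R" for x l
    using S(2) that unfolding torus_periodic_def by blast
  have up: "u (x + l) = u x" "fr1 (x + l) = fr1 x" "fr2 (x + l) = fr2 x" if "l \<in> torus_lattice R" for x l
    using wave_periodic that unfolding u_def fr1_def fr2_def torus_periodic_def by blast+
  have wp: "w (x + l) = w x" if "l \<in> torus_lattice R" for x l
    using that by (simp add: w_def Sp up)
  have tan: "u x \<bullet> w x = 0" for x
    using H u_in_S5[of x] We(3)[OF u_in_S5] by (simp add: w_def hamiltonian_flow_def)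
  define f1 where "f1 = (\<lambda>x v. wave (wave_deriv (sin \<omega> *\<^sub>R coef1) freq v) freq x)"
  define f2 where "f2 = (\<lambda>x v. wave (wave_deriv (sin \<omega> *\<^sub>R coef2 \<omega>) freq v) freq x)"
  note fC = fr_C1[folded f1_def f2_def]
  define A1 where "A1 = (\<lambda>x v. fr1 x \<bullet> w' x v + f1 x v \<bullet> w x)"
  define A2 where "A2 = (\<lambda>x v. fr2 x \<bullet> w' x v + f2 x v \<bullet> w x)"
  define A3 where "A3 = (\<lambda>x v. alpha (u x) (w' x v) + alpha (du x v) (w x))"
  have A1: "C1_on UNIV (\<lambda>x. fr1 x \<bullet> w x) A1"
    unfolding A1_def by (rule C1_on_bilinear[OF bounded_bilinear_inner fC(1) w])
  have A2: "C1_on UNIV (\<lambda>x. fr2 x \<bullet> w x) A2"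
    unfolding A2_def by (rule C1_on_bilinear[OF bounded_bilinear_inner fC(2) w])
  have A3: "C1_on UNIV (\<lambda>x. alpha (u x) (w x)) A3"
    unfolding A3_def by (rule C1_on_bilinear[OF bounded_bilinear_alpha u_C1 w])
  \<comment> \<open>The contact identity makes both terms of the product rule equal to
    \<open>alpha (fr2 x) (w x)\<close>.\<close>
  have A3': "A3 x (0, 1) = 2 * alpha (fr2 x) (w x)" for x
  proof (cases "x \<in> S")
    case True
    have "fr2 x = du x (0, 1)" by (simp add: du_def)
    then have "alpha (u x) (We' (u x) (fr2 x)) + alpha (W (u x)) (fr2 x) = 0"
      using contact_identity_field[OF H We u_in_S5 du_horizontal] by metis
    then show ?thesis
      using True by (simp add: A3_def w_def w'_def du_def We(3)[OF u_in_S5] alpha_commute[of "W (u x)"])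
  next
    case False
    then show ?thesis
      by (simp add: A3_def w_def w'_def alpha_eq_inner)
  qed
  have E: "fr1 x \<bullet> w' x (1, 0) + fr2 x \<bullet> w' x (0, 1) = A1 x (1, 0) + A2 x (0, 1) - K / 2 * A3 x (0, 1)" for x
  proof -
    have "f1 x (1, 0) \<bullet> w x + f2 x (0, 1) \<bullet> w x = K * alpha (fr2 x) (w x)"
      unfolding inner_add_left[symmetric] f1_def f2_def laplacian
      by (simp add: inner_diff_left inner_add_left tan alpha_eq_inner)
    then show ?thesis by (simp add: A1_def A2_def A3')
  qed
  let ?Q = "cbox (0, 0) (2 * pi, 2 * pi * R)"
  have per: "g (2 * pi, y) = g (0, y)" "g (y, 2 * pi * R) = g (y, 0)"
    if "\<And>x l. l \<in> torus_lattice R \<Longrightarrow> g (x + l) = g x" for g :: "real \<times> real \<Rightarrow> real" and y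
  proof -
    have "(2 * pi, 0) \<in> torus_lattice R" "(0, 2 * pi * R) \<in> torus_lattice R"
      unfolding torus_lattice_def
      by (auto intro: exI[of _ "1::int"] exI[of _ "0::int"])
    from that[OF this(1), of "(0, y)"] that[OF this(2), of "(y, 0)"]
    show "g (2 * pi, y) = g (0, y)" "g (y, 2 * pi * R) = g (y, 0)" by simp_all
  qed
  have c: "continuous_on ?Q (\<lambda>x. B x v)" if "C1_on UNIV b B" for b :: "real \<times> real \<Rightarrow> real" and B v
    by (intro C1_on_continuous_derivative[OF that] continuous_intros) auto
  have I: "integral ?Q (\<lambda>x. A1 x (1, 0)) = 0" "integral ?Q (\<lambda>x. A2 x (0, 1)) = 0"
      "integral ?Q (\<lambda>x. A3 x (0, 1)) = 0"
    using R_pos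
    by (intro integral_cbox_pd_eq_0(1)[OF A1] integral_cbox_pd_eq_0(2)[OF A2] integral_cbox_pd_eq_0(2)[OF A3]
        per; simp add: up wp)+
  have ci: "(\<lambda>x. A1 x (1, 0)) integrable_on ?Q" "(\<lambda>x. A2 x (0, 1)) integrable_on ?Q"
      "(\<lambda>x. A3 x (0, 1)) integrable_on ?Q"
    using c[OF A1] c[OF A2] c[OF A3] by (auto intro: integrable_continuous)
  have "integral ?Q (\<lambda>x. A1 x (1, 0) + A2 x (0, 1) - K / 2 * A3 x (0, 1)) = 0"
    using I ci by (simp add: integral_diff integral_add integrable_add integrable_on_mult_right)
  moreover have "continuous_on ?Q (\<lambda>x. A1 x (1, 0) + A2 x (0, 1) - K / 2 * A3 x (0, 1))"
    using c[OF A1] c[OF A2] c[OF A3] by (intro continuous_intros)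
  ultimately have "(LINT x:torus_domain R|lborel. fr1 x \<bullet> w' x (1, 0) + fr2 x \<bullet> w' x (0, 1)) = 0"
    unfolding E torus_domain_def by (subst set_integral_box_eq_integral(2)) auto
  moreover have "(LINT x:torus_domain R|lborel. fr1 x \<bullet> w' x (1, 0) + fr2 x \<bullet> w' x (0, 1)) =
      (LINT x:torus_domain R \<inter> S|lborel. fr1 x \<bullet> We' (u x) (fr1 x) + fr2 x \<bullet> We' (u x) (fr2 x))"
    unfolding set_lebesgue_integral_def
    by (rule Bochner_Integration.integral_cong) (auto simp: w'_def du_def indicator_def)
  ultimately show ?thesis by simp
qed

end

section \<open>Stationarity of the tori\<close>

text \<open>The mean value theorem bounds the linearisation error at each point by the oscillation
  of \<open>B\<close> between time 0 and time \<open>t\<close>, and compactness makes this small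
  uniformly in the point.\<close>

lemma has_real_derivative_set_integral:
  fixes A B :: "real \<Rightarrow> 'a::euclidean_space \<Rightarrow> real"
  assumes K: "compact K" and S: "S \<in> sets borel" "S \<subseteq> K" and \<delta>: "\<delta> > 0"
    and A: "\<And>t x. t \<in> {-\<delta>..\<delta>} \<Longrightarrow> x \<in> K \<Longrightarrow> ((\<lambda>t. A t x) has_real_derivative B t x) (at t)"
    and cA: "\<And>t. t \<in> {-\<delta>..\<delta>} \<Longrightarrow> continuous_on K (A t)"
    and cB: "continuous_on ({-\<delta>..\<delta>} \<times> K) (\<lambda>z. B (fst z) (snd z))"
  shows "((\<lambda>t. LINT x:S|lborel. A t x) has_real_derivative (LINT x:S|lborel. B 0 x)) (at 0)"
proof -
  have fin: "emeasure lborel K < \<infinity>" by (rule emeasure_compact_finite[OF K])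
  then have finS: "emeasure lborel S < \<infinity>"
    using emeasure_mono[OF S(2), of lborel] compact_imp_closed[OF K] by (auto simp: less_top top_unique)
  define m where "m = measure lborel S"
  have iA: "set_integrable lborel S f" if "continuous_on K f" for f :: "'a \<Rightarrow> real"
  proof -
    have "set_integrable lborel K f"
      unfolding set_integrable_def using borel_integrable_compact[OF K that] by simp
    then show ?thesis by (rule set_integrable_subset) (use S in auto)
  qed
  have cB0: "continuous_on K (B 0)"
  proof -
    have 1: "continuous_on K (Pair 0)" by (intro continuous_on_Pair continuous_on_const continuous_on_id)
    have 2: "Pair 0 ` K \<subseteq> {-\<delta>..\<delta>} \<times> K" using \<delta> by auto
    from continuous_on_compose2[OF cB 1 2] show ?thesis by simp
  qed
  have uB: "uniformly_continuous_on ({-\<delta>..\<delta>} \<times> K) (\<lambda>z. B (fst z) (snd z))"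
    by (rule compact_uniformly_continuous[OF cB]) (intro compact_Times compact_Icc K)
  show ?thesis
    unfolding has_field_derivative_def has_derivative_within_alt
  proof (intro conjI allI impI)
    show "bounded_linear ((*) (LINT x:S|lborel. B 0 x))" by (rule bounded_linear_mult_right)
    fix e :: real assume e: "e > 0"
    \<comment> \<open>The summand 1 keeps the denominator positive when \<open>S\<close> has measure
      0.\<close>
    define e' where "e' = e / (m + 1)"
    have m: "m \<ge> 0" by (simp add: m_def)
    have e': "e' > 0" "e' * m \<le> e" using e m by (auto simp: e'_def field_simps)
    obtain d where d: "d > 0" "\<And>z w. z \<in> {-\<delta>..\<delta>} \<times> K \<Longrightarrow> w \<in> {-\<delta>..\<delta>} \<times> K \<Longrightarrow> dist w z < d \<Longrightarrow>
        dist (B (fst w) (snd w)) (B (fst z) (snd z)) < e'"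
      using uB e'(1) unfolding uniformly_continuous_on_def by metis
    have "norm ((LINT x:S|lborel. A t x) - (LINT x:S|lborel. A 0 x) - (LINT x:S|lborel. B 0 x) * (t - 0))
          \<le> e * norm (t - 0)" if t: "norm (t - 0) < min d \<delta>" for t
    proof -
      have tI: "t \<in> {-\<delta>..\<delta>}" "0 \<in> {-\<delta>..\<delta>}" using t \<delta> by auto
      have pt: "\<bar>A t x - A 0 x - B 0 x * t\<bar> \<le> e' * \<bar>t\<bar>" if x: "x \<in> K" for x
      proof -
        have "norm ((A t x - B 0 x * t) - (A 0 x - B 0 x * 0)) \<le> e' * norm (t - 0)"
        proof (rule field_differentiable_bound[of "closed_segment 0 t" _ "\<lambda>s. B s x - B 0 x"])
          fix s assume s: "s \<in> closed_segment 0 t"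
          then have sI: "\<bar>s\<bar> \<le> \<bar>t\<bar>" by (auto simp: closed_segment_eq_real_ivl split: if_splits)
          then have sI': "s \<in> {-\<delta>..\<delta>}" using t by auto
          show "((\<lambda>s. A s x - B 0 x * s) has_field_derivative B s x - B 0 x) (at s within closed_segment 0 t)"
            by (auto intro!: derivative_eq_intros has_field_derivative_at_within[OF A[OF sI' x]])
          have "dist (s, x) (0, x) < d" using sI t by (simp add: dist_Pair_Pair)
          from d(2)[OF _ _ this] show "norm (B s x - B 0 x) \<le> e'"
            using sI' tI x by (simp add: dist_norm)
        qed auto
        then show ?thesis by (simp add: algebra_simps)
      qed
      have i: "set_integrable lborel S (A t)" "set_integrable lborel S (A 0)" "set_integrable lborel S (\<lambda>x. B 0 x * t)"
        using iA cA[OF tI(1)] cA[OF tI(2)] cB0 by (auto intro!: continuous_intros)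
      have "(LINT x:S|lborel. A t x) - (LINT x:S|lborel. A 0 x) - (LINT x:S|lborel. B 0 x) * (t - 0) =
          (LINT x:S|lborel. A t x - A 0 x - B 0 x * t)"
        using i by (simp add: set_integral_diff)
      also have "norm \<dots> \<le> (LINT x:S|lborel. norm (A t x - A 0 x - B 0 x * t))"
        by (rule set_integral_norm_bound) (intro set_integral_diff i)
      also have "\<dots> \<le> (LINT x:S|lborel. e' * \<bar>t\<bar>)"
      proof (rule set_integral_mono)
        show "set_integrable lborel S (\<lambda>x. norm (A t x - A 0 x - B 0 x * t))"
          by (rule set_integrable_norm) (intro set_integral_diff i)
        show "set_integrable lborel S (\<lambda>x. e' * \<bar>t\<bar>)" by (rule iA) (rule continuous_on_const)
      qed (use pt S in auto)
      also have "\<dots> = e' * \<bar>t\<bar> * m"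
        using S(1) finS by (simp add: set_lebesgue_integral_def m_def)
      also have "\<dots> \<le> e * norm (t - 0)"
        using mult_right_mono[OF e'(2), of "\<bar>t\<bar>"] by (simp add: mult_ac)
      finally show ?thesis .
    qed
    then show "\<exists>d>0. \<forall>y\<in>UNIV. norm (y - 0) < d \<longrightarrow>
        norm ((LINT x:S|lborel. A y x) - (LINT x:S|lborel. A 0 x) - (LINT x:S|lborel. B 0 x) * (y - 0))
          \<le> e * norm (y - 0)"
      using d(1) \<delta> by (intro exI[of _ "min d \<delta>"]) simp
  qed
qed

lemma cis_eq_cisD: "cis a = cis b \<Longrightarrow> \<exists>k :: int. a = b + 2 * pi * of_int k"
  using sin_cos_eq_iff[of a b] by (simp add: complex_eq_iff)

context torus
begin

lemma du_inner: "du x v \<bullet> fr1 x = fst v * (sin \<omega>)\<^sup>2" "du x v \<bullet> fr2 x = snd v * (sin \<omega>)\<^sup>2"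
  by (simp_all add: du_def inner_add_left frame_inner inner_commute[of "fr2 x" "fr1 x"])

lemma legendrian_immersion_u: "legendrian_immersion R u"
proof -
  have "inj (du x)" for x
  proof (rule injI)
    fix v w assume "du x v = du x w"
    then have "fst v * (sin \<omega>)\<^sup>2 = fst w * (sin \<omega>)\<^sup>2" "snd v * (sin \<omega>)\<^sup>2 = snd w * (sin \<omega>)\<^sup>2"
      by (metis du_inner)+
    then show "v = w" using sin_pos by (simp add: prod_eq_iff)
  qed
  moreover have "alpha (u x) (du x v) = 0" for x v
    using du_horizontal by (simp add: horizontal_def)
  ultimately show ?thesis
    unfolding legendrian_immersion_def C1_on_frechet[OF u_C1 UNIV_I]
    using wave_smooth wave_periodic u_in_S5 unfolding u_def[symmetric] by (auto simp: u_def)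
qed

text \<open>The third phase determines \<open>y\<close> modulo \<open>2 * pi * R\<close>. The first
  phase then determines \<open>x\<close> modulo \<open>2 * pi\<close>, because
  \<open>R * cos \<omega>\<close> is an integer. Both phases can be read off since sine and cosine
  of \<omega> are nonzero.\<close>

lemma legendrian_embedding_u: "legendrian_embedding R u"
  unfolding legendrian_embedding_def
proof (intro conjI allI impI legendrian_immersion_u)
  fix x y assume "u x = u y"
  then have "coef_pt \<omega> $ j * cis (angle x $ j) = coef_pt \<omega> $ j * cis (angle y $ j)" for j
    by (simp add: u_eq trig3_def vec_eq_iff)
  from this[of 1] this[of 3]
  have "cis (angle x $ 1) = cis (angle y $ 1)" "cis (angle x $ 3) = cis (angle y $ 3)"
    using sin_pos cos_pos by (simp_all add: coef_pt_def)
  then obtain a b :: int where "angle x $ 1 = angle y $ 1 + 2 * pi * of_int a"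
    "angle x $ 3 = angle y $ 3 + 2 * pi * of_int b"
    using cis_eq_cisD by meson
  then have 1: "fst x - fst y = 2 * pi * of_int a - cos \<omega> * (snd x - snd y)"
    and 2: "snd x - snd y = 2 * pi * R * of_int (- b)"
    using R_pos by (simp_all add: angle_def field_simps)
  have "fst x - fst y = 2 * pi * of_int a + 2 * pi * (R * cos \<omega>) * of_int b"
    unfolding 1 2 by simp
  then have 1: "fst x - fst y = 2 * pi * of_int (a + int n * b)"
    unfolding R_cos by (simp add: algebra_simps)
  show "x - y \<in> torus_lattice R"
    unfolding torus_lattice_def using 1 2
    by (intro CollectI exI[of _ "a + int n * b"] exI[of _ "- b"]) (simp add: prod_eq_iff)
qed

lemma conformal_u: "conformal u"
proof -
  have n: "norm (fr1 x) = sin \<omega>" "norm (fr2 x) = sin \<omega>" for x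
    using sin_pos by (simp_all add: norm_eq_sqrt_inner frame_inner)
  then have "fr1 x \<noteq> 0" for x using sin_pos by (metis less_irrefl norm_zero)
  then show ?thesis
    by (simp add: conformal_def pd_u n frame_inner)
qed

lemma torus_domain_sets: "torus_domain R \<in> sets borel"
  by (simp add: torus_domain_def borel_Times)

text \<open>The identity is obtained at every level \<open>t\<close>: the superlevel set is open and
  its frontier lies in the level set, so \<open>first_variation\<close> applies even at critical
  levels.\<close>

lemma PHSLV_u: "PHSLV R u (pd1 u) (pd2 u) (\<lambda>_. 1)"
proof -
  have W: "\<exists>E1 E2. W12_loc (\<lambda>x. W (u x)) E1 E2 \<and>
      (LINT x:{x \<in> torus_domain R. f x > t}|lebesgue. real 1 * (E1 x \<bullet> fr1 x + E2 x \<bullet> fr2 x)) = 0"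
    if f: "smooth_on UNIV f" "torus_periodic R f" and H: "hamiltonian_field F W"
      and sup: "support_S5 F \<inter> u ` {x. f x = t} = {}" for f F W and t :: real
  proof -
    obtain \<phi> where \<phi>: "hamiltonian_flow F W \<phi>" using H by (auto simp: hamiltonian_field_def)
    obtain V We We' where We: "open V" "S5 \<subseteq> V" "C1_on V We We'" "\<And>x. x \<in> S5 \<Longrightarrow> We x = W x"
      using \<phi> smooth_on_imp_C1_on[of S5 W] unfolding hamiltonian_flow_def by metis
    define S where "S = {x. t < f x}"
    have cf: "continuous_on UNIV f" by (rule C1_on_continuous_on[OF smooth_on_UNIV_C1_on[OF f(1)]])
    have S: "open S" "torus_periodic R (\<lambda>x. x \<in> S)"
      using cf f(2) by (auto simp: S_def torus_periodic_def intro: open_Collect_less)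
    have cl: "closed {x. t \<le> f x}" by (intro closed_Collect_le cf continuous_intros)
    have "closure S \<subseteq> {x. t \<le> f x}" by (rule closure_minimal[OF _ cl]) (auto simp: S_def)
    moreover have "interior S = S" by (rule interior_open[OF S(1)])
    ultimately have "frontier S \<subseteq> {x. f x = t}" by (force simp: frontier_def S_def)
    then have sup': "support_S5 F \<inter> u ` frontier S = {}" using sup by blast
    have uV: "u x \<in> V" for x using u_in_S5 We(2) by blast
    have wu: "C1_on UNIV (\<lambda>x. We (u x)) (\<lambda>x v. We' (u x) (du x v))"
      by (rule C1_on_compose[OF u_C1 We(3)]) (rule uV)
    let ?E = "\<lambda>x. We' (u x) (fr1 x) \<bullet> fr1 x + We' (u x) (fr2 x) \<bullet> fr2 x"
    have "W12_loc (\<lambda>x. W (u x)) (\<lambda>x. We' (u x) (fr1 x)) (\<lambda>x. We' (u x) (fr2 x))"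
      using W12_loc_C1[OF wu] We(4)[OF u_in_S5] by (simp add: du_def)
    moreover have "(LINT x:{x \<in> torus_domain R. f x > t}|lebesgue. ?E x) = 0"
    proof -
      have "continuous_on UNIV ?E"
        using C1_on_continuous_on[OF u_C1] C1_on_continuous_on[OF fr_C1(1)] C1_on_continuous_on[OF fr_C1(2)]
        by (intro continuous_intros C1_on_continuous_derivative[OF We(3)] uV)
      then have "?E \<in> borel_measurable borel" by (rule borel_measurable_continuous_onI)
      then have "(\<lambda>x. indicator (torus_domain R \<inter> S) x *\<^sub>R ?E x) \<in> borel_measurable lborel"
        using torus_domain_sets S(1) by (intro borel_measurable_scaleR borel_measurable_indicator) auto
      from integral_completion[OF this]
      have "(LINT x:torus_domain R \<inter> S|lebesgue. ?E x) = (LINT x:torus_domain R \<inter> S|lborel. ?E x)"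
        by (simp add: set_lebesgue_integral_def)
      also have "\<dots> = 0"
        using first_variation[OF S \<phi> sup' We(3,2,4)] by (simp add: inner_commute)
      finally show ?thesis by (simp add: S_def Int_def)
    qed
    ultimately show ?thesis by (intro exI conjI) simp_all
  qed
  have "norm (fr1 x) = norm (fr2 x)" for x by (simp add: norm_eq_sqrt_inner frame_inner)
  moreover have "W12_loc u fr1 fr2" using W12_loc_C1[OF u_C1] by (simp add: du_def)
  moreover have "torus_periodic R u" unfolding u_def by (rule wave_periodic)
  ultimately show ?thesis
    unfolding PHSLV_def pd_u using u_in_S5 W
    by (auto simp: frame_inner torus_periodic_def intro!: AE_I2)
qed


text \<open>The area integrand is the root of the Gram determinant \<open>Q\<close> of the moved
  frame. The frame is orthogonal with equal lengths at time 0, which reduces the derivative of the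
  root to the trace integrated in \<open>first_variation\<close>.\<close>

lemma area_has_derivative_0:
  assumes S: "open S" "torus_periodic R (\<lambda>x. x \<in> S)"
    and H: "hamiltonian_flow F W \<phi>"
    and sup: "support_S5 F \<inter> u ` frontier S = {}"
  shows "((\<lambda>t. area_on (torus_domain R \<inter> S) (\<lambda>x. \<phi> t (u x))) has_real_derivative 0) (at 0)"
proof -
  obtain V We We' where We: "open V" "S5 \<subseteq> V" "C1_on V We We'" "\<And>x. x \<in> S5 \<Longrightarrow> We x = W x"
    using H smooth_on_imp_C1_on[of S5 W] unfolding hamiltonian_flow_def by metis
  have fl: "flow_on_S5 W \<phi>" "smooth_on (UNIV \<times> S5) (\<lambda>(t, p). \<phi> t p)"
    using H by (auto simp: hamiltonian_flow_def flow_on_S5_def)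
  obtain G g g' where g: "open G" "UNIV \<times> S5 \<subseteq> G" "C1_on G g g'"
      "\<And>x. x \<in> UNIV \<times> S5 \<Longrightarrow> g x = (\<lambda>(t, p). \<phi> t p) x"
    using smooth_on_imp_C1_on[OF fl(2)] by metis
  have g4: "g (t, p) = \<phi> t p" if "p \<in> S5" for t p
    using g(4)[of "(t, p)"] that by simp
  have uG: "(t, u x) \<in> G" for t x using g(2) u_in_S5[of x] by blast
  have \<phi>u: "\<phi> t (u x) = g (t, u x)" for t x using g4[OF u_in_S5] by simp
  define Y1 where "Y1 = (\<lambda>t x. g' (t, u x) (0, fr1 x))"
  define Y2 where "Y2 = (\<lambda>t x. g' (t, u x) (0, fr2 x))"
  define Z1 where "Z1 = (\<lambda>t x. We' (\<phi> t (u x)) (Y1 t x))"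
  define Z2 where "Z2 = (\<lambda>t x. We' (\<phi> t (u x)) (Y2 t x))"
  define Q where "Q = (\<lambda>t x. (Y1 t x \<bullet> Y1 t x) * (Y2 t x \<bullet> Y2 t x) - (Y1 t x \<bullet> Y2 t x)\<^sup>2)"
  define Q' where "Q' = (\<lambda>t x. 2 * (Y1 t x \<bullet> Z1 t x) * (Y2 t x \<bullet> Y2 t x) +
      2 * (Y1 t x \<bullet> Y1 t x) * (Y2 t x \<bullet> Z2 t x) -
      2 * (Y1 t x \<bullet> Y2 t x) * (Y1 t x \<bullet> Z2 t x + Z1 t x \<bullet> Y2 t x))"
  have comp: "C1_on UNIV (\<lambda>x. \<phi> t (u x)) (\<lambda>x v. g' (t, u x) (0, du x v))" for t
    unfolding \<phi>u
    by (rule C1_on_compose[OF u_C1 C1_on_Pair_left[OF g(3)]]) (use uG in simp)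
  have pd: "pd1 (\<lambda>x. \<phi> t (u x)) = Y1 t" "pd2 (\<lambda>x. \<phi> t (u x)) = Y2 t" for t
    unfolding pd1_eq[OF comp] pd2_eq[OF comp] Y1_def Y2_def du_def by simp_all
  have area: "area_on A (\<lambda>x. \<phi> t (u x)) = (LINT x:A|lborel. sqrt (Q t x))" for A t
    by (simp add: area_on_def pd Q_def power2_norm_eq_inner)
  have Y0: "Y1 0 = fr1" "Y2 0 = fr2"
  proof -
    have "(\<lambda>x. \<phi> 0 (u x)) = u" using fl(1) u_in_S5 by (auto simp: flow_on_S5_def)
    then show "Y1 0 = fr1" "Y2 0 = fr2" using pd[of 0] pd_u by simp_all
  qed
  have tan: "u x \<bullet> fr1 x = 0" "u x \<bullet> fr2 x = 0" for x by (simp_all add: frame_inner)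
  have dY1: "((\<lambda>t. Y1 t x) has_vector_derivative Z1 t x) (at t)" for t x
    unfolding Y1_def Z1_def
    by (rule flow_variation[OF fl(1) We(3,2,4) g(3,2) g4 u_in_S5 tan(1)])
  have dY2: "((\<lambda>t. Y2 t x) has_vector_derivative Z2 t x) (at t)" for t x
    unfolding Y2_def Z2_def
    by (rule flow_variation[OF fl(1) We(3,2,4) g(3,2) g4 u_in_S5 tan(2)])
  have dI: "((\<lambda>t. a t \<bullet> b t) has_real_derivative a t \<bullet> b' + a' \<bullet> b t) (at t)"
    if "(a has_vector_derivative a') (at t)" "(b has_vector_derivative b') (at t)"
    for a b :: "real \<Rightarrow> C3" and a' b' t
    using bounded_bilinear.has_vector_derivative[OF bounded_bilinear_inner that]
    by (simp add: has_real_derivative_iff_has_vector_derivative)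
  have dQ: "((\<lambda>t. Q t x) has_real_derivative Q' t x) (at t)" for t x
    unfolding Q_def Q'_def
    by (rule derivative_eq_intros dI dY1 dY2 refl)+ (simp add: algebra_simps inner_commute)
  have cu: "continuous_on A (\<lambda>z. u (snd z))" "continuous_on A (\<lambda>z. fr1 (snd z))" "continuous_on A (\<lambda>z. fr2 (snd z))"
    for A :: "(real \<times> real \<times> real) set"
    by (rule continuous_on_compose2[OF C1_on_continuous_on[OF u_C1]]
        continuous_on_compose2[OF C1_on_continuous_on[OF fr_C1(1)]]
        continuous_on_compose2[OF C1_on_continuous_on[OF fr_C1(2)]]; simp add: continuous_on_snd)+
  have cY: "continuous_on A (\<lambda>z. Y1 (fst z) (snd z))" "continuous_on A (\<lambda>z. Y2 (fst z) (snd z))" for A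
    unfolding Y1_def Y2_def
    by (intro C1_on_continuous_derivative[OF g(3)] continuous_intros cu uG)+
  have c\<phi>: "continuous_on A (\<lambda>z. \<phi> (fst z) (u (snd z)))" for A
    unfolding \<phi>u
    by (rule continuous_on_compose2[OF C1_on_continuous_on[OF g(3)]])
       (use uG in \<open>auto intro!: continuous_intros cu\<close>)
  have \<phi>V: "\<phi> t (u x) \<in> V" for t x
    using fl(1) u_in_S5[of x] We(2) unfolding flow_on_S5_def by blast
  have cZ: "continuous_on A (\<lambda>z. Z1 (fst z) (snd z))" "continuous_on A (\<lambda>z. Z2 (fst z) (snd z))" for A
    unfolding Z1_def Z2_def
    by (intro C1_on_continuous_derivative[OF We(3)] c\<phi> cY \<phi>V)+
  have cQ: "continuous_on A (\<lambda>z. Q (fst z) (snd z))" "continuous_on A (\<lambda>z. Q' (fst z) (snd z))" for A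
    unfolding Q_def Q'_def by (intro continuous_intros cY cZ)+
  define K where "K = cbox (0, 0) (2 * pi, 2 * pi * R)"
  have Q0: "Q 0 x = (sin \<omega>)^4" for x
    by (simp add: Q_def Y0 frame_inner flip: power_add)
  have "uniformly_continuous_on ({-1..1} \<times> K) (\<lambda>z. Q (fst z) (snd z))"
    unfolding K_def by (intro compact_uniformly_continuous cQ compact_Times compact_Icc compact_cbox)
  then obtain d where d: "d > 0" "\<And>z w. z \<in> {-1..1} \<times> K \<Longrightarrow> w \<in> {-1..1} \<times> K \<Longrightarrow> dist w z < d \<Longrightarrow>
        dist (Q (fst w) (snd w)) (Q (fst z) (snd z)) < (sin \<omega>)^4"
    using sin_pos unfolding uniformly_continuous_on_def by (metis zero_less_power)
  \<comment> \<open>\<open>Q\<close> equals \<open>(sin \<omega>)^4\<close> at time 0; times up to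
    \<delta> change it by less than that, so it stays positive and its root is
    differentiable.\<close>
  define \<delta> where "\<delta> = min 1 (d / 2)"
  have \<delta>: "\<delta> > 0" "\<delta> < d" "\<delta> \<le> 1" using d(1) by (auto simp: \<delta>_def)
  have Qpos: "Q t x > 0" if "t \<in> {-\<delta>..\<delta>}" "x \<in> K" for t x
  proof -
    have "dist (t, x) (0, x) < d" using that \<delta> by (auto simp: dist_Pair_Pair)
    then have "dist (Q t x) (Q 0 x) < (sin \<omega>)^4"
      using d(2)[of "(0, x)" "(t, x)"] that \<delta> by auto
    then show ?thesis by (simp add: Q0 dist_real_def)
  qed
  have "((\<lambda>t. LINT x:torus_domain R \<inter> S|lborel. sqrt (Q t x)) has_real_derivative
      (LINT x:torus_domain R \<inter> S|lborel. Q' 0 x / (2 * sqrt (Q 0 x)))) (at 0)"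
  proof (rule has_real_derivative_set_integral[of K _ \<delta>])
    show "compact K" by (simp add: K_def)
    show "torus_domain R \<inter> S \<in> sets borel" using torus_domain_sets S(1) by auto
    show "torus_domain R \<inter> S \<subseteq> K" by (auto simp: torus_domain_def K_def cbox_Pair_eq)
    show "((\<lambda>t. sqrt (Q t x)) has_real_derivative Q' t x / (2 * sqrt (Q t x))) (at t)"
      if "t \<in> {-\<delta>..\<delta>}" "x \<in> K" for t x
      using DERIV_chain2[OF DERIV_real_sqrt[OF Qpos[OF that]] dQ] by (simp add: field_simps)
    show "continuous_on K (\<lambda>x. sqrt (Q t x))" for t
    proof -
      have "continuous_on K (Pair t)" by (intro continuous_on_Pair continuous_on_const continuous_on_id)
      from continuous_on_compose2[OF cQ(1)[of UNIV] this] show ?thesis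
        by (intro continuous_on_real_sqrt) simp
    qed
    show "continuous_on ({-\<delta>..\<delta>} \<times> K) (\<lambda>z. Q' (fst z) (snd z) / (2 * sqrt (Q (fst z) (snd z))))"
      using Qpos by (intro continuous_intros cQ) fastforce
  qed (rule \<delta>)
  moreover have "Q' 0 x / (2 * sqrt (Q 0 x)) = fr1 x \<bullet> We' (u x) (fr1 x) + fr2 x \<bullet> We' (u x) (fr2 x)" for x
  proof -
    have "\<phi> 0 (u x) = u x" using fl(1) u_in_S5 by (auto simp: flow_on_S5_def)
    moreover have "sqrt (Q 0 x) = (sin \<omega>)\<^sup>2"
      using sin_pos by (simp add: Q0 real_sqrt_unique power_mult[symmetric])
    ultimately show ?thesis
      using sin_pos by (simp add: Q'_def Y0 Z1_def Z2_def frame_inner field_simps)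
  qed
  ultimately show ?thesis
    using first_variation[OF S H sup We(3,2,4)] by (simp add: area)
qed

lemma hamiltonian_stationary_immersion_u: "hamiltonian_stationary_immersion R u"
  unfolding hamiltonian_stationary_immersion_def
  using legendrian_immersion_u area_has_derivative_0 by blast

end

section \<open>Equidistribution\<close>

abbreviation circ_int :: "(real \<Rightarrow> real) \<Rightarrow> real" where
  "circ_int f \<equiv> integral {0..2 * pi} f"

lemma periodic_int:
  assumes "\<And>x. f (x + 2 * pi) = f (x :: real)"
  shows "f (x + 2 * pi * of_int m) = f x"
proof -
  have nat: "f (x + 2 * pi * real n) = f x" for n x
  proof (induction n)
    case (Suc n)
    have "f (x + 2 * pi * real (Suc n)) = f ((x + 2 * pi * real n) + 2 * pi)"
      by (simp add: algebra_simps)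
    then show ?case using assms Suc by simp
  qed simp
  show ?thesis
  proof (cases m rule: int_cases2)
    case (nonneg n)
    then show ?thesis using nat by simp
  next
    case (nonpos n)
    then show ?thesis using nat[of "x + 2 * pi * of_int m" n] by simp
  qed
qed

lemma circ_int_shift:
  assumes c: "continuous_on UNIV f" and per: "\<And>x. f (x + 2 * pi) = f x"
  shows "circ_int (\<lambda>x. f (x + c)) = circ_int f"
proof -
  define r where "r = c - 2 * pi * of_int \<lfloor>c / (2 * pi)\<rfloor>"
  have r: "0 \<le> r" "r \<le> 2 * pi"
    using floor_divide_lower[of "2 * pi" c] floor_divide_upper[of "2 * pi" c]
    by (simp_all add: r_def algebra_simps)
  have ci: "f integrable_on {a..b}" for a b
    by (rule integrable_continuous_interval[OF continuous_on_subset[OF c]]) simp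
  have "f (x + c) = f (r + x)" for x
    using periodic_int[of f "r + x" "\<lfloor>c / (2 * pi)\<rfloor>"] per by (simp add: r_def algebra_simps)
  then have "circ_int (\<lambda>x. f (x + c)) = circ_int (f \<circ> (+) r)" by (simp add: o_def)
  also have "\<dots> = integral {r..2 * pi + r} f"
    using integral_shift_Icc_real[of 0 "2 * pi" f r] by simp
  also have "\<dots> = integral {r..2 * pi} f + integral {2 * pi..2 * pi + r} f"
    by (rule Henstock_Kurzweil_Integration.integral_combine[symmetric]) (use r ci in auto)
  also have "integral {2 * pi..2 * pi + r} f = integral {0..r} (f \<circ> (+) (2 * pi))"
    using integral_shift_Icc_real[of 0 r f "2 * pi"] by (simp add: add.commute)
  also have "f \<circ> (+) (2 * pi) = f"
    using per by (auto simp: o_def add.commute)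
  also have "integral {r..2 * pi} f + integral {0..r} f = circ_int f"
    using Henstock_Kurzweil_Integration.integral_combine[of 0 r "2 * pi" f] r ci by simp
  finally show ?thesis .
qed

lemma circ_int_uminus:
  assumes c: "continuous_on UNIV f" and per: "\<And>x. f (x + 2 * pi) = f x"
  shows "circ_int (\<lambda>x. f (- x)) = circ_int f"
proof -
  have "circ_int (\<lambda>x. f (- x)) = integral {- (2 * pi)..0} f"
    using Henstock_Kurzweil_Integration.integral_reflect_real[of 0 "- (2 * pi)" f] by simp
  also have "\<dots> = circ_int (f \<circ> (+) (- (2 * pi)))"
    using integral_shift_Icc_real[of 0 "2 * pi" f "- (2 * pi)"] by simp
  also have "\<dots> = circ_int (\<lambda>x. f (x + - (2 * pi)))"
    by (simp add: o_def add.commute)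
  also have "\<dots> = circ_int f" by (rule circ_int_shift[OF c per])
  finally show ?thesis .
qed

text \<open>Doubling preserves Haar measure on the circle. This is needed because the change of
  phases from \<open>x\<close>, \<sigma> to x + \<sigma>, -x + \<sigma> is a double
  covering.\<close>

lemma circ_int_double:
  assumes c: "continuous_on UNIV f" and per: "\<And>x. f (x + 2 * pi) = f x"
  shows "circ_int (\<lambda>x. f (2 * x)) = circ_int f"
proof -
  have ci: "f integrable_on {a..b}" for a b
    by (rule integrable_continuous_interval[OF continuous_on_subset[OF c]]) simp
  have "(f has_integral integral {0..4 * pi} f) (cbox 0 (4 * pi))"
    using ci by (simp add: integrable_integral)
  from has_integral_affinity'[OF this, of 2 0]
  have "circ_int (\<lambda>x. f (2 * x)) = integral {0..4 * pi} f / 2"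
    by (simp add: integral_unique field_simps)
  also have "integral {0..4 * pi} f = circ_int f + integral {2 * pi..4 * pi} f"
    by (rule Henstock_Kurzweil_Integration.integral_combine[symmetric]) (use ci in auto)
  also have "integral {2 * pi..4 * pi} f = circ_int (f \<circ> (+) (2 * pi))"
    using integral_shift_Icc_real[of 0 "2 * pi" f "2 * pi"] by simp
  also have "f \<circ> (+) (2 * pi) = f"
    using per by (auto simp: o_def add.commute)
  finally show ?thesis by simp
qed

lemma circ_int_swap:
  assumes "continuous_on UNIV (\<lambda>z. f (fst z) (snd z))"
  shows "circ_int (\<lambda>x. circ_int (f x)) = circ_int (\<lambda>y. circ_int (\<lambda>x. f x y))"
  using integral_swap_continuous[of 0 0 "2 * pi" "2 * pi" f] continuous_on_subset[OF assms subset_UNIV]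
  by (simp add: case_prod_beta)

lemma continuous_on_circ_int:
  fixes f :: "'a::euclidean_space \<Rightarrow> real \<Rightarrow> real"
  assumes "continuous_on UNIV (\<lambda>z. f (fst z) (snd z))"
  shows "continuous_on UNIV (\<lambda>x. circ_int (f x))"
proof -
  have "continuous_on (UNIV \<times> cbox 0 (2 * pi)) (\<lambda>(x, t). f x t)"
    using continuous_on_subset[OF assms subset_UNIV] by (simp add: case_prod_beta)
  from integral_continuous_on_param[OF this] show ?thesis by simp
qed

lemma circ_int_abs_le:
  assumes "continuous_on UNIV f" "continuous_on UNIV g" "\<And>x. x \<in> {0..2 * pi} \<Longrightarrow> \<bar>f x - g x\<bar> \<le> e"
  shows "\<bar>circ_int f - circ_int g\<bar> \<le> 2 * pi * e"
proof -
  have i: "h integrable_on {0..2 * pi}" if "continuous_on UNIV h" for h :: "real \<Rightarrow> real"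
    by (rule integrable_continuous_interval[OF continuous_on_subset[OF that]]) simp
  have "circ_int f - circ_int g = circ_int (\<lambda>x. f x - g x)"
    using i assms(1,2) by (simp add: integral_diff)
  also have "norm \<dots> \<le> circ_int (\<lambda>x. e)"
    by (rule integral_norm_bound_integral)
       (use assms(3) in \<open>auto intro!: i continuous_on_diff assms(1,2) continuous_on_const\<close>)
  finally show ?thesis by (simp add: mult_ac)
qed

lemma mod_2pi: "\<exists>m::int. \<exists>r. r \<in> {0..2 * pi} \<and> (a :: real) = r + 2 * pi * of_int m"
proof (intro exI conjI)
  show "a - 2 * pi * of_int \<lfloor>a / (2 * pi)\<rfloor> \<in> {0..2 * pi}"
    using floor_divide_lower[of "2 * pi" a] floor_divide_upper[of "2 * pi" a]
    by (simp add: algebra_simps)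
qed simp

text \<open>A quantity on the bundle evaluated along \<open>legendrian_pair\<close>:
  \<open>w\<close> stands for \<omega>, the other arguments for the phases. The tori sit at positive
  \<open>w\<close> and the limit at \<open>w = 0\<close>.\<close>

locale torus_family =
  fixes G :: "real \<Rightarrow> real \<Rightarrow> real \<Rightarrow> real \<Rightarrow> real"
  assumes cont: "continuous_on UNIV (\<lambda>(w, a, b, c). G w a b c)"
    and per: "G w (a + 2 * pi) b c = G w a b c" "G w a (b + 2 * pi) c = G w a b c"
      "G w a b (c + 2 * pi) = G w a b c"
begin

lemma continuous_on_G:
  assumes "continuous_on A p" "continuous_on A q" "continuous_on A r" "continuous_on A t"
  shows "continuous_on A (\<lambda>x. G (p x) (q x) (r x) (t x))"
  using continuous_on_compose2[OF cont, of A "\<lambda>x. (p x, q x, r x, t x)"] assms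
  by (simp add: continuous_on_Pair)

lemma per_int:
  "G w (a + 2 * pi * of_int m) (b + 2 * pi * of_int n) (c + 2 * pi * of_int l) = G w a b c"
  using periodic_int[of "\<lambda>a. G w a (b + 2 * pi * of_int n) (c + 2 * pi * of_int l)" a m]
    periodic_int[of "\<lambda>b. G w a b (c + 2 * pi * of_int l)" b n]
    periodic_int[of "\<lambda>c. G w a b c" c l] per by simp

lemma uniform:
  assumes e: "e > 0"
  obtains d where "d > 0" "\<And>w t a b c. \<bar>w\<bar> < d \<Longrightarrow> \<bar>t\<bar> < d \<Longrightarrow> \<bar>G w a b (c + t) - G 0 a b c\<bar> < e"
proof -
  \<comment> \<open>Periodicity brings the phases into one period, so compactness gives uniformity
    in all of them; the last interval is enlarged by 1 on each side to leave room for the shift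
    \<open>t\<close>.\<close>
  let ?K = "{-1..1} \<times> {0..2 * pi} \<times> {0..2 * pi} \<times> {-1..2 * pi + 1 :: real}"
  have "uniformly_continuous_on ?K (\<lambda>(w, a, b, c). G w a b c)"
    by (intro compact_uniformly_continuous continuous_on_subset[OF cont] compact_Times compact_Icc) auto
  then obtain d where d: "d > 0" "\<And>z z'. z \<in> ?K \<Longrightarrow> z' \<in> ?K \<Longrightarrow> dist z' z < d \<Longrightarrow>
      dist ((\<lambda>(w, a, b, c). G w a b c) z') ((\<lambda>(w, a, b, c). G w a b c) z) < e"
    using e unfolding uniformly_continuous_on_def by metis
  have "\<bar>G w a b (c + t) - G 0 a b c\<bar> < e" if wt: "\<bar>w\<bar> < min 1 (d / 2)" "\<bar>t\<bar> < min 1 (d / 2)" for w t a b c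
  proof -
    obtain l m n a' b' c' where r: "a' \<in> {0..2 * pi}" "b' \<in> {0..2 * pi}" "c' \<in> {0..2 * pi}"
      "a = a' + 2 * pi * of_int l" "b = b' + 2 * pi * of_int m" "c = c' + 2 * pi * of_int n"
      using mod_2pi by metis
    have "dist (w, a', b', c' + t) (0, a', b', c') = sqrt (w\<^sup>2 + t\<^sup>2)"
      by (simp add: dist_Pair_Pair dist_real_def)
    also have "\<dots> \<le> \<bar>w\<bar> + \<bar>t\<bar>" by (rule sqrt_sum_squares_le_sum_abs)
    also have "\<dots> < d" using wt by simp
    finally have "\<bar>G w a' b' (c' + t) - G 0 a' b' c'\<bar> < e"
      using d(2)[of "(0, a', b', c')" "(w, a', b', c' + t)"] r(1-3) wt
      by (simp add: dist_real_def abs_less_iff)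
    moreover have "G w a b (c + t) = G w a' b' (c' + t)"
      using per_int[of w a' l b' m "c' + t" n] by (simp add: r(4-6) algebra_simps)
    moreover have "G 0 a b c = G 0 a' b' c'"
      using per_int[of 0 a' l b' m c' n] by (simp add: r(4-6))
    ultimately show ?thesis by simp
  qed
  with d(1) that[of "min 1 (d / 2)"] show ?thesis by auto
qed

text \<open>The map from (x, \<sigma>) to (x + \<sigma>, -x + \<sigma>) is a surjective endomorphism
  of the two-dimensional torus, so it carries Haar measure to Haar measure. In coordinates: a shift
  of \<open>x\<close>, then a doubling of \<sigma>, then a shift.\<close>

lemma haar_pushforward:
  "circ_int (\<lambda>x. circ_int (\<lambda>\<sigma>. G w (x + \<sigma>) (- x + \<sigma>) c)) = circ_int (\<lambda>a. circ_int (\<lambda>b. G w a b c))"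
proof -
  have "circ_int (\<lambda>x. circ_int (\<lambda>\<sigma>. G w (x + \<sigma>) (- x + \<sigma>) c)) =
      circ_int (\<lambda>\<sigma>. circ_int (\<lambda>x. G w (x + \<sigma>) (- x + \<sigma>) c))"
    by (rule circ_int_swap) (intro continuous_on_G continuous_intros)
  also have "\<dots> = circ_int (\<lambda>\<sigma>. circ_int (\<lambda>x. G w x (2 * \<sigma> - x) c))"
  proof (rule integral_cong)
    fix \<sigma>
    have "G w (x + 2 * pi) (2 * \<sigma> - (x + 2 * pi)) c = G w x (2 * \<sigma> - x) c" for x
      using per_int[of w x 1 "2 * \<sigma> - x" "- 1" c 0] by (simp add: algebra_simps)
    moreover have "continuous_on UNIV (\<lambda>x. G w x (2 * \<sigma> - x) c)"
      by (intro continuous_on_G continuous_intros)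
    ultimately show "circ_int (\<lambda>x. G w (x + \<sigma>) (- x + \<sigma>) c) = circ_int (\<lambda>x. G w x (2 * \<sigma> - x) c)"
      using circ_int_shift[of "\<lambda>x. G w x (2 * \<sigma> - x) c" \<sigma>] by (simp add: algebra_simps)
  qed
  also have "\<dots> = circ_int (\<lambda>x. circ_int (\<lambda>\<sigma>. G w x (2 * \<sigma> - x) c))"
    by (rule circ_int_swap) (intro continuous_on_G continuous_intros)
  also have "\<dots> = circ_int (\<lambda>a. circ_int (\<lambda>b. G w a b c))"
  proof (rule integral_cong)
    fix x
    have 1: "continuous_on UNIV (\<lambda>b. G w x (b + - x) c)" "continuous_on UNIV (\<lambda>b. G w x b c)"
      by (intro continuous_on_G continuous_intros)+
    have "G w x (b + 2 * pi + - x) c = G w x (b + - x) c" for b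
      using per(2)[of w x "b + - x" c] by (simp add: algebra_simps)
    from circ_int_double[OF 1(1) this]
    have "circ_int (\<lambda>\<sigma>. G w x (2 * \<sigma> - x) c) = circ_int (\<lambda>b. G w x (b + - x) c)"
      by simp
    also have "\<dots> = circ_int (\<lambda>b. G w x b c)"
      by (rule circ_int_shift[OF 1(2)]) (rule per)
    finally show "circ_int (\<lambda>\<sigma>. G w x (2 * \<sigma> - x) c) = circ_int (\<lambda>b. G w x b c)" .
  qed
  finally show ?thesis .
qed

text \<open>The integrand is periodic in \<open>s\<close>, so \<open>s\<close> may be replaced by \<open>s + \<sigma>/n\<close>; averaging over \<open>\<sigma>\<close> makes
  the fast phase \<open>n s + \<sigma>\<close> independent of the slow one up to an error of order \<open>1/n\<close>.\<close>

lemma average_shift: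
  assumes "n > 0"
  shows "2 * pi * circ_int (\<lambda>s. G w (x + real n * s) (- x + real n * s) (- s)) =
    circ_int (\<lambda>s. circ_int (\<lambda>\<sigma>. G w (x + (real n * s + \<sigma>)) (- x + (real n * s + \<sigma>)) (- s - \<sigma> / real n)))"
proof -
  let ?f = "\<lambda>s. G w (x + real n * s) (- x + real n * s) (- s)"
  have p: "?f (s + 2 * pi) = ?f s" for s
    using per_int[of w "x + real n * s" "int n" "- x + real n * s" "int n" "- s" "- 1"]
    by (simp add: algebra_simps)
  have "circ_int (\<lambda>s. circ_int (\<lambda>\<sigma>. G w (x + (real n * s + \<sigma>)) (- x + (real n * s + \<sigma>)) (- s - \<sigma> / real n))) =
      circ_int (\<lambda>\<sigma>. circ_int (\<lambda>s. G w (x + (real n * s + \<sigma>)) (- x + (real n * s + \<sigma>)) (- s - \<sigma> / real n)))"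
    by (rule circ_int_swap) (intro continuous_on_G continuous_intros, use assms in auto)
  also have "\<dots> = circ_int (\<lambda>\<sigma>. circ_int ?f)"
  proof (rule integral_cong)
    fix \<sigma>
    have "continuous_on UNIV ?f" by (intro continuous_on_G continuous_intros)
    from circ_int_shift[OF this p, of "\<sigma> / real n"]
    show "circ_int (\<lambda>s. G w (x + (real n * s + \<sigma>)) (- x + (real n * s + \<sigma>)) (- s - \<sigma> / real n)) = circ_int ?f"
      using assms by (simp add: algebra_simps)
  qed
  finally show ?thesis by simp
qed

text \<open>Once the slow phase no longer depends on \<sigma>, shift invariance in \<sigma> removes
  the fast phase \<open>real n * s\<close> altogether. The equality is therefore exact for each
  \<open>n\<close>, not only asymptotic.\<close>

lemma average_limit:
  "circ_int (\<lambda>x. circ_int (\<lambda>s. circ_int (\<lambda>\<sigma>. G w (x + (real n * s + \<sigma>)) (- x + (real n * s + \<sigma>)) (- s)))) =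
    circ_int (\<lambda>c. circ_int (\<lambda>a. circ_int (\<lambda>b. G w a b c)))"
proof -
  have "circ_int (\<lambda>\<sigma>. G w (x + (real n * s + \<sigma>)) (- x + (real n * s + \<sigma>)) (- s)) =
      circ_int (\<lambda>\<sigma>. G w (x + \<sigma>) (- x + \<sigma>) (- s))" for x s
  proof -
    have "continuous_on UNIV (\<lambda>\<sigma>. G w (x + \<sigma>) (- x + \<sigma>) (- s))"
      by (intro continuous_on_G continuous_intros)
    moreover have "G w (x + (\<sigma> + 2 * pi)) (- x + (\<sigma> + 2 * pi)) (- s) = G w (x + \<sigma>) (- x + \<sigma>) (- s)" for \<sigma>
      using per_int[of w "x + \<sigma>" 1 "- x + \<sigma>" 1 "- s" 0] by (simp add: algebra_simps)
    ultimately show ?thesis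
      using circ_int_shift[of "\<lambda>\<sigma>. G w (x + \<sigma>) (- x + \<sigma>) (- s)" "real n * s"] by (simp add: algebra_simps)
  qed
  then have "circ_int (\<lambda>x. circ_int (\<lambda>s. circ_int (\<lambda>\<sigma>. G w (x + (real n * s + \<sigma>)) (- x + (real n * s + \<sigma>)) (- s)))) =
      circ_int (\<lambda>x. circ_int (\<lambda>s. circ_int (\<lambda>\<sigma>. G w (x + \<sigma>) (- x + \<sigma>) (- s))))"
    by simp
  also have "\<dots> = circ_int (\<lambda>s. circ_int (\<lambda>x. circ_int (\<lambda>\<sigma>. G w (x + \<sigma>) (- x + \<sigma>) (- s))))"
    by (rule circ_int_swap, rule continuous_on_circ_int) (intro continuous_on_G continuous_intros)
  also have "\<dots> = circ_int (\<lambda>s. circ_int (\<lambda>a. circ_int (\<lambda>b. G w a b (- s))))"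
    by (simp only: haar_pushforward)
  also have "\<dots> = circ_int (\<lambda>c. circ_int (\<lambda>a. circ_int (\<lambda>b. G w a b c)))"
    by (rule circ_int_uminus, rule continuous_on_circ_int, rule continuous_on_circ_int)
       (intro continuous_on_G continuous_intros, simp add: per)
  finally show ?thesis .
qed

lemma equidistribution:
  assumes "w \<longlonglongrightarrow> 0"
  shows "(\<lambda>k. circ_int (\<lambda>x. circ_int (\<lambda>s. G (w k) (x + real (Suc k) * s) (- x + real (Suc k) * s) (- s))))
    \<longlonglongrightarrow> circ_int (\<lambda>c. circ_int (\<lambda>a. circ_int (\<lambda>b. G 0 a b c))) / (2 * pi)" (is "?I \<longlonglongrightarrow> ?L / _")
proof -
  have "(\<lambda>k. 2 * pi * ?I k) \<longlonglongrightarrow> ?L"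
  proof (rule LIMSEQ_I)
    fix e :: real assume e: "e > 0"
    \<comment> \<open>Three integrations multiply a pointwise error by 8 pi^3, which turns
      \<open>e'\<close> into half of \<open>e\<close>.\<close>
    define e' where "e' = e / (16 * pi ^ 3)"
    have e': "e' > 0" "2 * pi * (2 * pi * (2 * pi * e')) < e"
      using e by (auto simp: e'_def power3_eq_cube)
    obtain d where d: "d > 0"
      "\<And>w t a b c. \<bar>w\<bar> < d \<Longrightarrow> \<bar>t\<bar> < d \<Longrightarrow> \<bar>G w a b (c + t) - G 0 a b c\<bar> < e'"
      using uniform[OF e'(1)] by metis
    have "(\<lambda>k. 2 * pi / real (Suc k)) \<longlonglongrightarrow> 0"
      by (rule LIMSEQ_Suc[OF lim_const_over_n])
    from order_tendstoD(2)[OF this d(1)] tendstoD[OF assms d(1)]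
    have "eventually (\<lambda>k. 2 * pi / real (Suc k) < d \<and> \<bar>w k\<bar> < d) sequentially"
      by (auto elim: eventually_elim2 simp: dist_real_def)
    then obtain N where N: "\<And>k. k \<ge> N \<Longrightarrow> 2 * pi / real (Suc k) < d \<and> \<bar>w k\<bar> < d"
      by (auto simp: eventually_sequentially)
    have "norm (2 * pi * ?I k - ?L) < e" if k: "k \<ge> N" for k
    proof -
      define n where "n = Suc k"
      have n: "n > 0" "real n > 0" by (simp_all add: n_def)
      have nn: "real (Suc k) = real n" by (simp add: n_def)
      let ?A = "\<lambda>x s \<sigma>. G (w k) (x + (real n * s + \<sigma>)) (- x + (real n * s + \<sigma>)) (- s - \<sigma> / real n)"
      let ?B = "\<lambda>x s \<sigma>. G 0 (x + (real n * s + \<sigma>)) (- x + (real n * s + \<sigma>)) (- s)"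
      have 1: "2 * pi * ?I k = circ_int (\<lambda>x. circ_int (\<lambda>s. circ_int (?A x s)))"
        unfolding nn average_shift[OF n(1), symmetric] by simp
      have cA: "continuous_on UNIV (?A x s)" "continuous_on UNIV (\<lambda>s. circ_int (?A x s))"
          "continuous_on UNIV (\<lambda>x. circ_int (\<lambda>s. circ_int (?A x s)))"
          "continuous_on UNIV (?B x s)" "continuous_on UNIV (\<lambda>s. circ_int (?B x s))"
          "continuous_on UNIV (\<lambda>x. circ_int (\<lambda>s. circ_int (?B x s)))" for x s
        by (intro continuous_on_circ_int continuous_on_G continuous_intros; use n in simp)+
      have "\<bar>?A x s \<sigma> - ?B x s \<sigma>\<bar> \<le> e'" if "\<sigma> \<in> {0..2 * pi}" for x s \<sigma>
      proof -
        have "\<sigma> / real n \<le> 2 * pi / real n" using that n by (simp add: divide_right_mono)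
        then have "\<bar>- (\<sigma> / real n)\<bar> < d" using N[OF k] that n nn by simp
        from d(2)[OF conjunct2[OF N[OF k]] this] show ?thesis by (simp add: less_imp_le)
      qed
      \<comment> \<open>The limit value is rewritten by \<open>average_limit\<close> with the same
        \<open>n\<close> as on the left, so that the two triple integrals can be compared integrand
        by integrand.\<close>
      then have "\<bar>2 * pi * ?I k - ?L\<bar> \<le> 2 * pi * (2 * pi * (2 * pi * e'))"
        unfolding 1 average_limit[of 0 n, symmetric]
        by (intro circ_int_abs_le cA)
      then show ?thesis using e'(2) by simp
    qed
    then show "\<exists>N. \<forall>k\<ge>N. norm (2 * pi * ?I k - ?L) < e" by blast
  qed
  from tendsto_divide[OF this tendsto_const[of "2 * pi"]] show ?thesis by simp
qed

end

section \<open>Legendrian planes and varifolds\<close>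

lemma closest_point_span_pair:
  fixes e f v :: "'a::euclidean_space"
  assumes "norm e = 1" "norm f = 1" "e \<bullet> f = 0"
  shows "closest_point (span {e, f}) v = (v \<bullet> e) *\<^sub>R e + (v \<bullet> f) *\<^sub>R f"
proof (rule closest_point_unique[symmetric])
  let ?q = "(v \<bullet> e) *\<^sub>R e + (v \<bullet> f) *\<^sub>R f"
  have n: "e \<bullet> e = 1" "f \<bullet> f = 1" using assms by (simp_all add: norm_eq_1)
  show q: "?q \<in> span {e, f}"
    by (intro span_add span_scale span_base) auto
  have o: "(v - ?q) \<bullet> y = 0" if "y \<in> span {e, f}" for y
    using that
    by (rule orthogonal_to_span[unfolded orthogonal_def])
       (auto simp: inner_diff_left inner_add_left n assms(3) inner_commute[of f e])
  show "\<forall>z\<in>span {e, f}. dist v ?q \<le> dist v z"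
  proof
    fix z assume z: "z \<in> span {e, f}"
    have "(v - ?q) \<bullet> (?q - z) = 0" by (rule o) (intro span_diff q z)
    then have "(norm (v - z))\<^sup>2 = (norm (v - ?q))\<^sup>2 + (norm (?q - z))\<^sup>2"
      using norm_add_Pythagorean[of "v - ?q" "?q - z"] by (simp add: orthogonal_def)
    then have "(norm (v - ?q))\<^sup>2 \<le> (norm (v - z))\<^sup>2" by simp
    then show "dist v ?q \<le> dist v z" by (simp add: dist_norm power2_le_iff_abs_le)
  qed
qed (auto intro: subspace_imp_convex closed_subspace)

text \<open>A path of planes is continuous in \<open>LegG_topology\<close> through its projections.
  With an orthonormal frame the projection is explicit, and in finite dimension continuity may be
  tested on single vectors.\<close>

lemma continuous_on_plane_projection:
  fixes e f :: "'x::euclidean_space \<Rightarrow> C3"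
  assumes "continuous_on UNIV e" "continuous_on UNIV f"
    and "\<And>x. norm (e x) = 1" "\<And>x. norm (f x) = 1" "\<And>x. e x \<bullet> f x = 0"
  shows "continuous_on UNIV (\<lambda>x. plane_projection (span {e x, f x}))"
proof (rule continuous_on_blinfun_componentwise)
  fix i :: C3
  have "bounded_linear (\<lambda>v. (v \<bullet> e x) *\<^sub>R e x + (v \<bullet> f x) *\<^sub>R f x)" for x
    by (intro bounded_linear_intros)
  then have "blinfun_apply (plane_projection (span {e x, f x})) i = (i \<bullet> e x) *\<^sub>R e x + (i \<bullet> f x) *\<^sub>R f x" for x
    by (simp add: plane_projection_def closest_point_span_pair[OF assms(3-5), abs_def] bounded_linear_Blinfun_apply)
  then show "continuous_on UNIV (\<lambda>x. blinfun_apply (plane_projection (span {e x, f x})) i)"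
    by (simp add: assms(1,2) continuous_intros)
qed

lemma span_pairE:
  assumes "v \<in> span {e, f :: 'a::real_vector}"
  obtains a b where "v = a *\<^sub>R e + b *\<^sub>R f"
proof -
  obtain a where "v - a *\<^sub>R e \<in> span {f}" using assms span_breakdown_eq[of v e "{f}"] by blast
  then obtain b where "v - a *\<^sub>R e = b *\<^sub>R f" using span_breakdown_eq[of "v - a *\<^sub>R e" f "{}"] by auto
  then have "v = a *\<^sub>R e + b *\<^sub>R f" by (simp add: algebra_simps)
  then show ?thesis by (rule that)
qed

lemma legendrian_plane_span:
  assumes "norm e = 1" "norm f = 1" "e \<bullet> f = 0" "e \<in> horizontal p" "f \<in> horizontal p" "alpha e f = 0"
  shows "legendrian_plane p (span {e, f})"
proof -
  interpret a: bounded_bilinear alpha by (rule bounded_bilinear_alpha)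
  have ne: "e \<noteq> f" "e \<noteq> 0" "f \<noteq> 0" using assms(1-3) by (auto simp: norm_eq_1)
  have "independent {e, f}"
    by (rule pairwise_orthogonal_independent)
       (use assms ne in \<open>auto simp: pairwise_def orthogonal_def inner_commute\<close>)
  then have "dim (span {e, f}) = 2"
    using ne(1) by (simp add: dim_eq_card_independent)
  moreover have "subspace (horizontal p)"
    by (auto simp: subspace_def horizontal_def inner_add_right a.add_right a.scaleR_right a.zero_right)
  then have "span {e, f} \<subseteq> horizontal p"
    using assms(4,5) by (intro span_minimal) auto
  moreover have "dalpha v w = 0" if v: "v \<in> span {e, f}" and w: "w \<in> span {e, f}" for v w
  proof -
    have s: "alpha f e = 0" "alpha e e = 0" "alpha f f = 0"
      using assms(6) alpha_commute[of f e] alpha_commute[of e e] alpha_commute[of f f] by simp_all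
    obtain a b where "v = a *\<^sub>R e + b *\<^sub>R f" by (rule span_pairE[OF v])
    moreover obtain c d where "w = c *\<^sub>R e + d *\<^sub>R f" by (rule span_pairE[OF w])
    ultimately show ?thesis
      by (simp add: dalpha_def a.add_left a.add_right a.scaleR_left a.scaleR_right s assms(6))
  qed
  ultimately show ?thesis by (simp add: legendrian_plane_def)
qed

section \<open>Topology and Borel structure of the bundle\<close>

lemma topspace_LegG: "topspace LegG_topology = LegG"
  by (simp add: LegG_topology_def topspace_pullback_topology)

lemma open_subset_Pow: "{U. openin LegG_topology U} \<subseteq> Pow LegG"
  using openin_subset[of LegG_topology] by (auto simp: topspace_LegG)

lemma space_LegG_borel: "space LegG_borel = LegG"
  and sets_LegG_borel: "sets LegG_borel = sigma_sets LegG {U. openin LegG_topology U}"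
  using open_subset_Pow by (simp_all add: LegG_borel_def space_measure_of sets_measure_of)

lemma continuous_map_into_LegG:
  assumes "\<And>x. m x \<in> LegG" "continuous_on UNIV (\<lambda>x. plane_projection (fst (m x)))"
    "continuous_on UNIV (\<lambda>x. snd (m x))"
  shows "continuous_map euclidean LegG_topology m"
  unfolding LegG_topology_def
  by (rule continuous_map_pullback')
     (use assms in \<open>auto simp: o_def case_prod_beta intro!: continuous_on_Pair\<close>)

lemma measurable_into_LegG:
  assumes "continuous_map euclidean LegG_topology m"
  shows "m \<in> borel \<rightarrow>\<^sub>M LegG_borel"
  unfolding LegG_borel_def
proof (rule measurable_measure_of[OF open_subset_Pow])
  show "m \<in> space borel \<rightarrow> LegG"
    using assms by (auto simp: continuous_map_def topspace_LegG)
  fix U assume "U \<in> {U. openin LegG_topology U}"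
  then have "openin euclidean {x \<in> topspace euclidean. m x \<in> U}"
    using openin_continuous_map_preimage[OF assms, of U] by blast
  then show "m -` U \<inter> space borel \<in> sets borel"
    by (simp add: vimage_def)
qed

lemma measurable_from_LegG:
  assumes "continuous_map LegG_topology euclidean \<Phi>"
  shows "\<Phi> \<in> borel_measurable LegG_borel"
proof (rule borel_measurableI)
  fix S :: "'a set" assume "open S"
  then have "openin LegG_topology {x \<in> topspace LegG_topology. \<Phi> x \<in> S}"
    using assms by (intro openin_continuous_map_preimage) auto
  moreover have "{x \<in> topspace LegG_topology. \<Phi> x \<in> S} = \<Phi> -` S \<inter> space LegG_borel"
    by (auto simp: topspace_LegG space_LegG_borel)
  ultimately show "\<Phi> -` S \<inter> space LegG_borel \<in> sets LegG_borel"
    by (simp add: sets_LegG_borel)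
qed

lemma snd_measurable_LegG: "snd \<in> LegG_borel \<rightarrow>\<^sub>M borel"
proof (rule measurable_from_LegG)
  have "continuous_map LegG_topology euclidean (snd \<circ> (\<lambda>(P, p). (plane_projection P, p)))"
    unfolding LegG_topology_def by (rule continuous_map_pullback) (simp add: continuous_on_snd)
  then show "continuous_map LegG_topology euclidean snd"
    by (simp add: o_def case_prod_beta)
qed

text \<open>The varifolds are given by \<open>measure_of\<close> applied to a formula, which yields
  the zero measure if the formula is not countably additive. Agreement with a genuine measure, here
  always a pushforward, excludes this.\<close>

lemma measure_of_eq_measure:
  assumes "sets N = sets LegG_borel" "\<And>B. B \<in> sets LegG_borel \<Longrightarrow> \<mu> B = emeasure N B"
  shows "measure_of LegG (sets LegG_borel) \<mu> = N"
proof -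
  have s: "space N = LegG" using sets_eq_imp_space_eq[OF assms(1)] by (simp add: space_LegG_borel)
  have "measure_of LegG (sets LegG_borel) \<mu> = measure_of (space N) (sets N) (emeasure N)"
    unfolding s assms(1)
    by (rule measure_of_eq)
       (use assms(2) sets.space_closed[of LegG_borel] sets.sigma_sets_eq[of LegG_borel] in \<open>auto simp: space_LegG_borel\<close>)
  then show ?thesis by (simp add: measure_of_of_measure)
qed

text \<open>For \<open>\<omega> = 0\<close> the third component of the point is all that remains, and the pairs with this
  parameter are exactly those charged by the limit.\<close>

definition legendrian_pair :: "real \<Rightarrow> real ^ 3 \<Rightarrow> C3 set \<times> C3" where
  "legendrian_pair \<omega> \<theta> = (span {trig3 coef1 \<theta>, trig3 (coef2 \<omega>) \<theta>}, trig3 (coef_pt \<omega>) \<theta>)"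

lemma norm_trig3: "norm (trig3 c \<theta>) = norm c"
  by (simp add: norm_eq_sqrt_inner trig3_inner)

lemma leg_frame:
  "norm (trig3 coef1 \<theta>) = 1" "norm (trig3 (coef2 \<omega>) \<theta>) = 1" "norm (trig3 (coef_pt \<omega>) \<theta>) = 1"
  "trig3 coef1 \<theta> \<bullet> trig3 (coef2 \<omega>) \<theta> = 0"
  "trig3 coef1 \<theta> \<in> horizontal (trig3 (coef_pt \<omega>) \<theta>)" "trig3 (coef2 \<omega>) \<theta> \<in> horizontal (trig3 (coef_pt \<omega>) \<theta>)"
  by (simp_all add: norm_trig3 norm_eq_sqrt_inner trig3_inner trig3_alpha horizontal_def frame_algebra)

lemma leg_in_LegG: "legendrian_pair \<omega> \<theta> \<in> LegG"
  unfolding legendrian_pair_def LegG_def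
  by (auto intro!: legendrian_plane_span simp: leg_frame trig3_alpha frame_algebra)

lemma continuous_on_vector3 [continuous_intros]:
  fixes f g h :: "'a::topological_space \<Rightarrow> 'b::{topological_space, zero}"
  assumes "continuous_on A f" "continuous_on A g" "continuous_on A h"
  shows "continuous_on A (\<lambda>x. vector [f x, g x, h x] :: 'b ^ 3)"
proof -
  have "continuous_on A (\<lambda>x. (vector [f x, g x, h x] :: 'b ^ 3) $ j)" for j
    using exhaust_3[of j] assms by auto
  then have "continuous_on A (\<lambda>x. \<chi> j. (vector [f x, g x, h x] :: 'b ^ 3) $ j)"
    by (rule continuous_on_vec_lambda)
  then show ?thesis by simp
qed

lemma continuous_on_frame [continuous_intros]:
  fixes w :: "'a::t2_space \<Rightarrow> real"
  assumes "continuous_on A w"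
  shows "continuous_on A (\<lambda>x. coef_pt (w x))" "continuous_on A (\<lambda>x. coef2 (w x))"
  unfolding coef_pt_def coef2_def by (auto intro!: continuous_intros assms)

lemma continuous_map_leg:
  fixes w :: "'x::euclidean_space \<Rightarrow> real"
  assumes "continuous_on UNIV w" "continuous_on UNIV t"
  shows "continuous_map euclidean LegG_topology (\<lambda>x. legendrian_pair (w x) (t x))"
  by (rule continuous_map_into_LegG[OF leg_in_LegG])
     (auto simp: legendrian_pair_def leg_frame intro!: continuous_on_plane_projection continuous_intros assms)


lemma trig3_shift_2pi:
  "trig3 c (vector [x + 2 * pi, y, z]) = trig3 c (vector [x, y, z])"
  "trig3 c (vector [x, y + 2 * pi, z]) = trig3 c (vector [x, y, z])"
  "trig3 c (vector [x, y, z + 2 * pi]) = trig3 c (vector [x, y, z])"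
  by (simp_all add: trig3_def vec_eq_iff forall_3 flip: cis_mult)

lemma leg_shift_2pi:
  "legendrian_pair \<omega> (vector [x + 2 * pi, y, z]) = legendrian_pair \<omega> (vector [x, y, z])"
  "legendrian_pair \<omega> (vector [x, y + 2 * pi, z]) = legendrian_pair \<omega> (vector [x, y, z])"
  "legendrian_pair \<omega> (vector [x, y, z + 2 * pi]) = legendrian_pair \<omega> (vector [x, y, z])"
  by (simp_all add: legendrian_pair_def trig3_shift_2pi)

lemma torus_family_leg:
  assumes "continuous_map LegG_topology euclideanreal \<Phi>"
  shows "torus_family (\<lambda>w a b c. \<Phi> (legendrian_pair w (vector [a, b, c])))"
proof
  have "continuous_map euclidean LegG_topology (\<lambda>z :: real \<times> real \<times> real \<times> real.
      legendrian_pair (fst z) (vector [fst (snd z), fst (snd (snd z)), snd (snd (snd z))]))"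
    by (rule continuous_map_leg) (intro continuous_intros)+
  from continuous_map_compose[OF this assms]
  show "continuous_on UNIV (\<lambda>(w, a, b, c). \<Phi> (legendrian_pair w (vector [a, b, c])))"
    by (simp add: o_def case_prod_beta)
qed (simp_all add: leg_shift_2pi)

lemma integral_stretch_0:
  fixes f :: "real \<Rightarrow> real"
  assumes "continuous_on UNIV f" "r > 0"
  shows "integral {0..c * r} f = r * integral {0..c} (\<lambda>x. f (r * x))"
proof -
  define I where "I = integral {0..c * r} f"
  have "f integrable_on {0..c * r}"
    by (rule integrable_continuous_interval[OF continuous_on_subset[OF assms(1)]]) simp
  then have "(f has_integral I) (cbox 0 (c * r))"
    by (simp add: I_def integrable_integral)
  from has_integral_affinity'[OF this assms(2), of 0]
  have "((\<lambda>x. f (r * x)) has_integral inverse r * I) (cbox ((0 - 0) /\<^sub>R r) ((c * r - 0) /\<^sub>R r))"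
    by simp
  moreover have "((0::real) - 0) /\<^sub>R r = 0" "(c * r - 0) /\<^sub>R r = c" using assms(2) by simp_all
  ultimately have "((\<lambda>x. f (r * x)) has_integral inverse r * I) {0..c}"
    by (metis cbox_interval)
  then have "integral {0..c} (\<lambda>x. f (r * x)) = inverse r * I" by (rule integral_unique)
  then have "r * integral {0..c} (\<lambda>x. f (r * x)) = I" using assms(2) by simp
  then show ?thesis by (simp add: I_def)
qed

section \<open>The varifolds of the tori as pushforwards\<close>

context torus
begin

text \<open>Substituting R s for y makes the domain independent of R and the phases integral
  multiples of \<open>s\<close>. The Jacobian R times the area factor is
  \<open>cos \<omega>\<close>, which stays bounded.\<close>

lemma integral_torus_family:
  assumes "torus_family G"
  shows "(sin \<omega>)\<^sup>2 * integral (cbox (0, 0) (2 * pi, 2 * pi * R))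
      (\<lambda>x. G \<omega> (angle x $ 1) (angle x $ 2) (angle x $ 3)) =
    cos \<omega> * circ_int (\<lambda>x. circ_int (\<lambda>s. G \<omega> (x + real n * s) (- x + real n * s) (- s)))"
proof -
  interpret torus_family G by fact
  have 1: "integral {0..2 * pi * R} (\<lambda>y. G \<omega> (x + cos \<omega> * y) (- x + cos \<omega> * y) (- y / R)) =
      R * circ_int (\<lambda>s. G \<omega> (x + real n * s) (- x + real n * s) (- s))" for x
  proof -
    have e: "cos \<omega> * (R * s) = real n * s" "- (R * s) / R = - s" for s
      using R_pos by (simp_all add: R_cos[symmetric])
    have "continuous_on UNIV (\<lambda>y. G \<omega> (x + cos \<omega> * y) (- x + cos \<omega> * y) (- y / R))"
      using R_pos by (intro continuous_on_G continuous_intros) auto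
    from integral_stretch_0[OF this R_pos, of "2 * pi"] show ?thesis by (simp only: e)
  qed
  have "continuous_on (cbox (0, 0) (2 * pi, 2 * pi * R)) (\<lambda>x. G \<omega> (angle x $ 1) (angle x $ 2) (angle x $ 3))"
    unfolding angle_def using R_pos by (auto intro!: continuous_on_G continuous_intros)
  from integral_prod_continuous[OF this]
  have "integral (cbox (0, 0) (2 * pi, 2 * pi * R)) (\<lambda>x. G \<omega> (angle x $ 1) (angle x $ 2) (angle x $ 3)) =
      circ_int (\<lambda>x. R * circ_int (\<lambda>s. G \<omega> (x + real n * s) (- x + real n * s) (- s)))"
    using 1 by (simp add: angle_def)
  then show ?thesis by (simp add: R_sin[symmetric])
qed

abbreviation varifold_u :: "(C3 set \<times> C3) measure" where
  "varifold_u \<equiv> induced_varifold R u fr1 fr2 (\<lambda>_. 1)"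

lemma span_fr: "(span {fr1 x, fr2 x}, u x) = legendrian_pair \<omega> (angle x)"
proof -
  have "span ((\<lambda>v. sin \<omega> *\<^sub>R v) ` {trig3 coef1 (angle x), trig3 (coef2 \<omega>) (angle x)}) =
      span {trig3 coef1 (angle x), trig3 (coef2 \<omega>) (angle x)}"
    by (rule span_image_scale) (use sin_pos in auto)
  then show ?thesis
    by (simp add: legendrian_pair_def fr1_def fr2_def u_eq wave_eq trig3_scaleR)
qed

lemma leg_angle_measurable: "(\<lambda>x. legendrian_pair \<omega> (angle x)) \<in> borel \<rightarrow>\<^sub>M LegG_borel"
  unfolding angle_def using R_pos
  by (intro measurable_into_LegG continuous_map_leg continuous_intros) auto

lemma induced_varifold_eq:
  "varifold_u = distr (density lborel (\<lambda>x. ennreal ((sin \<omega>)\<^sup>2 * indicator (torus_domain R) x))) LegG_borel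
    (\<lambda>x. legendrian_pair \<omega> (angle x))" (is "_ = ?N")
  unfolding induced_varifold_def
proof (rule measure_of_eq_measure)
  fix B assume B: "B \<in> sets LegG_borel"
  let ?m = "\<lambda>x. legendrian_pair \<omega> (angle x)"
  have m: "?m -` B \<in> sets borel"
    using measurable_sets[OF leg_angle_measurable B] by simp
  have n: "real 1 * ((norm (fr1 x))\<^sup>2 + (norm (fr2 x))\<^sup>2) / 2 = (sin \<omega>)\<^sup>2" for x
    by (simp add: power2_norm_eq_inner frame_inner)
  have "(\<integral>\<^sup>+x\<in>{x \<in> torus_domain R. (span {fr1 x, fr2 x}, u x) \<in> B}.
        ennreal (real 1 * ((norm (fr1 x))\<^sup>2 + (norm (fr2 x))\<^sup>2) / 2) \<partial>lebesgue) =
      (\<integral>\<^sup>+x. ennreal ((sin \<omega>)\<^sup>2 * indicator (torus_domain R) x) * indicator (?m -` B) x \<partial>lborel)"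
    unfolding n span_fr nn_integral_completion
    by (rule nn_integral_cong) (auto simp: indicator_def)
  also have "\<dots> = emeasure (density lborel (\<lambda>x. ennreal ((sin \<omega>)\<^sup>2 * indicator (torus_domain R) x))) (?m -` B)"
    using m torus_domain_sets by (subst emeasure_density) auto
  also have "\<dots> = emeasure ?N B"
    using B leg_angle_measurable by (subst emeasure_distr) auto
  finally show "(\<integral>\<^sup>+x\<in>{x \<in> torus_domain R. (span {fr1 x, fr2 x}, u x) \<in> B}.
        ennreal (real 1 * ((norm (fr1 x))\<^sup>2 + (norm (fr2 x))\<^sup>2) / 2) \<partial>lebesgue) = emeasure ?N B" .
qed simp

lemma integral_induced_varifold:
  assumes \<Phi>: "\<Phi> \<in> borel_measurable LegG_borel"
    and G: "torus_family G" "\<And>a b c. \<Phi> (legendrian_pair \<omega> (vector [a, b, c])) = G \<omega> a b c"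
  shows "(\<integral>x. \<Phi> x \<partial>varifold_u) =
    cos \<omega> * circ_int (\<lambda>x. circ_int (\<lambda>s. G \<omega> (x + real n * s) (- x + real n * s) (- s)))"
proof -
  interpret torus_family G by (rule G)
  have m: "(\<lambda>x. legendrian_pair \<omega> (angle x)) \<in> density lborel (\<lambda>x. ennreal ((sin \<omega>)\<^sup>2 * indicator (torus_domain R) x)) \<rightarrow>\<^sub>M LegG_borel"
    using leg_angle_measurable by simp
  have \<Phi>G: "\<Phi> (legendrian_pair \<omega> (angle x)) = G \<omega> (angle x $ 1) (angle x $ 2) (angle x $ 3)" for x
    by (simp add: angle_def G(2))
  have c: "continuous_on A (\<lambda>x. G \<omega> (angle x $ 1) (angle x $ 2) (angle x $ 3))" for A
    unfolding angle_def using R_pos by (auto intro!: continuous_on_G continuous_intros)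
  have b: "(\<lambda>x. G \<omega> (angle x $ 1) (angle x $ 2) (angle x $ 3)) \<in> borel_measurable lborel"
    using borel_measurable_continuous_onI[OF c[of UNIV]] by simp
  have "(\<integral>x. \<Phi> x \<partial>varifold_u) = (\<integral>x. ((sin \<omega>)\<^sup>2 * indicator (torus_domain R) x) *
      G \<omega> (angle x $ 1) (angle x $ 2) (angle x $ 3) \<partial>lborel)"
    unfolding induced_varifold_eq integral_distr[OF m \<Phi>] \<Phi>G
    using torus_domain_sets b by (subst integral_density) auto
  also have "\<dots> = (sin \<omega>)\<^sup>2 * (LINT x:torus_domain R|lborel. G \<omega> (angle x $ 1) (angle x $ 2) (angle x $ 3))"
    by (simp add: set_lebesgue_integral_def mult.assoc)
  also have "\<dots> = (sin \<omega>)\<^sup>2 * integral (cbox (0, 0) (2 * pi, 2 * pi * R))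
      (\<lambda>x. G \<omega> (angle x $ 1) (angle x $ 2) (angle x $ 3))"
    unfolding torus_domain_def by (subst set_integral_box_eq_integral(2)[OF c]) simp
  also note integral_torus_family[OF G(1)]
  finally show ?thesis .
qed

lemma finite_induced_varifold: "legendrian_varifold varifold_u"
  unfolding legendrian_varifold_def
proof (intro conjI)
  show "sets varifold_u = sets LegG_borel" unfolding induced_varifold_eq by simp
  then show "space varifold_u = LegG" by (metis sets_eq_imp_space_eq space_LegG_borel)
  let ?d = "\<lambda>x. ennreal ((sin \<omega>)\<^sup>2 * indicator (torus_domain R) x)"
  have "emeasure (density lborel ?d) UNIV = (\<integral>\<^sup>+x. ennreal ((sin \<omega>)\<^sup>2) * indicator (torus_domain R) x \<partial>lborel)"
    using torus_domain_sets
    by (subst emeasure_density) (auto intro!: nn_integral_cong simp: indicator_def)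
  also have "\<dots> = ennreal ((sin \<omega>)\<^sup>2) * emeasure lborel (torus_domain R)"
    using torus_domain_sets by (simp add: nn_integral_cmult)
  also have "\<dots> < \<infinity>"
  proof -
    have "emeasure lborel (torus_domain R) \<le> emeasure lborel (cbox (0, 0) (2 * pi, 2 * pi * R))"
    proof (rule emeasure_mono)
      show "torus_domain R \<subseteq> cbox (0, 0) (2 * pi, 2 * pi * R)"
        by (auto simp: torus_domain_def cbox_Pair_eq)
    qed simp
    also have "\<dots> < \<infinity>" by (rule emeasure_compact_finite[OF compact_cbox])
    finally show ?thesis by (simp add: ennreal_mult_less_top)
  qed
  finally have "finite_measure (density lborel ?d)" by (intro finite_measureI) simp
  then show "finite_measure varifold_u"
    unfolding induced_varifold_eq
    by (rule finite_measure.finite_measure_distr) (use leg_angle_measurable in simp)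
qed

end

section \<open>The limit varifold\<close>

lemma i_cis: "\<i> * complex_of_real r * cis (x - pi / 2) = r *\<^sub>R cis x"
  by (simp add: complex_eq_iff cos_diff sin_diff)

text \<open>The rotation adds \<beta> to the two plane angles, and the quarter turn cancels the
  factor \<open>\<i>\<close> in \<open>coef1\<close> and \<open>coef2\<close>.\<close>

definition limit_angle :: "real \<Rightarrow> real \<Rightarrow> real \<Rightarrow> real ^ 3" where
  "limit_angle \<beta> \<tau> \<eta> = vector [\<beta> + \<tau> - pi / 2, \<beta> + \<eta> - pi / 2, \<beta>]"

text \<open>The defining basis \<open>X\<close>, \<open>Y\<close> of the plane and the frame at
  \<omega> = 0 differ by a rotation of 45 degrees inside the plane.\<close>

lemma rotated_plane_leg:
  "(rotated_plane \<beta> \<tau> \<eta>, fibre_point \<beta>) = legendrian_pair 0 (limit_angle \<beta> \<tau> \<eta>)"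
proof -
  define X :: C3 where "X = vector [cis (\<beta> + \<tau>), 0, 0]"
  define Y :: C3 where "Y = vector [0, cis (\<beta> + \<eta>), 0]"
  let ?f = "\<lambda>v :: C3. cis \<beta> *s v"
  have "linear ?f"
    by (rule linearI) (simp_all add: vec_eq_iff algebra_simps)
  moreover have "?f (cos \<tau> *\<^sub>R vector [1, 0, 0] + sin \<tau> *\<^sub>R vector [\<i>, 0, 0]) = X"
    "?f (cos \<eta> *\<^sub>R vector [0, 1, 0] + sin \<eta> *\<^sub>R vector [0, \<i>, 0]) = Y"
    by (simp_all add: X_def Y_def vec_eq_iff forall_3 complex_eq_iff cos_add sin_add algebra_simps)
  ultimately have "rotated_plane \<beta> \<tau> \<eta> = span {X, Y}"
    unfolding rotated_plane_def base_plane_def by (simp add: linear_span_image[symmetric])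
  also have "\<dots> = span {(1 / sqrt 2) *\<^sub>R (X - Y), (1 / sqrt 2) *\<^sub>R (X + Y)}" (is "_ = span {?P, ?Q}")
  proof -
    have "(sqrt 2 / 2) *\<^sub>R ?P + (sqrt 2 / 2) *\<^sub>R ?Q = X" "(sqrt 2 / 2) *\<^sub>R ?Q - (sqrt 2 / 2) *\<^sub>R ?P = Y"
      by (simp_all flip: scaleR_add_right scaleR_diff_right scaleR_2)
    then have "X \<in> span {?P, ?Q}" "Y \<in> span {?P, ?Q}"
      by (metis insertCI span_add span_base span_scale, metis insertCI span_diff span_base span_scale)
    moreover have "?P \<in> span {X, Y}"
      by (intro span_scale span_diff span_base) auto
    moreover have "?Q \<in> span {X, Y}"
      by (intro span_scale span_add span_base) auto
    ultimately show ?thesis unfolding span_eq by blast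
  qed
  also have "?P = trig3 coef1 (limit_angle \<beta> \<tau> \<eta>)"
    by (simp only: vec_eq_iff forall_3 X_def Y_def trig3_def coef1_def limit_angle_def vec_lambda_beta vector_3
        vector_scaleR_component vector_minus_component vector_add_component mult_minus_left i_cis) simp
  also have "?Q = trig3 (coef2 0) (limit_angle \<beta> \<tau> \<eta>)"
    by (simp only: vec_eq_iff forall_3 X_def Y_def trig3_def coef2_def limit_angle_def vec_lambda_beta vector_3
        vector_scaleR_component vector_minus_component vector_add_component mult_minus_left i_cis) simp
  finally have "rotated_plane \<beta> \<tau> \<eta> = span {trig3 coef1 (limit_angle \<beta> \<tau> \<eta>), trig3 (coef2 0) (limit_angle \<beta> \<tau> \<eta>)}" .
  moreover have "fibre_point \<beta> = trig3 (coef_pt 0) (limit_angle \<beta> \<tau> \<eta>)"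
    by (simp add: fibre_point_def vec_eq_iff forall_3 trig3_def coef_pt_def limit_angle_def)
  ultimately show ?thesis by (simp add: legendrian_pair_def)
qed

definition limit_map :: "real \<times> real \<times> real \<Rightarrow> C3 set \<times> C3" where
  "limit_map z = legendrian_pair 0 (limit_angle (fst z) (fst (snd z)) (snd (snd z)))"

definition limit_box :: "(real \<times> real \<times> real) set" where
  "limit_box = {0..2 * pi} \<times> {0..2 * pi} \<times> {0..2 * pi}"

lemma limit_box_cbox: "limit_box = cbox (0, 0, 0) (2 * pi, 2 * pi, 2 * pi)"
  by (simp add: limit_box_def cbox_Pair_eq)

lemma limit_map_measurable: "limit_map \<in> borel \<rightarrow>\<^sub>M LegG_borel"
  unfolding limit_map_def limit_angle_def
  by (intro measurable_into_LegG continuous_map_leg continuous_intros)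

lemma emeasure_mu:
  assumes B: "B \<in> sets LegG_borel"
  shows "ennreal (2 * pi) * emeasure (mu \<beta>) B =
    (\<integral>\<^sup>+y. ennreal (1 / (2 * pi)) * indicator ({0..2 * pi} \<times> {0..2 * pi}) y * indicator B (limit_map (\<beta>, y)) \<partial>lborel)"
proof -
  let ?Q = "{0..2 * pi} \<times> {0..2 * pi :: real}" and ?m = "\<lambda>y. limit_map (\<beta>, y)"
  have m: "?m \<in> borel \<rightarrow>\<^sub>M LegG_borel"
    unfolding limit_map_def limit_angle_def
    by (intro measurable_into_LegG continuous_map_leg continuous_intros)
  have mu: "mu \<beta> = distr (uniform_measure lborel ?Q) LegG_borel ?m"
    unfolding mu_def by (simp add: rotated_plane_leg limit_map_def case_prod_beta')
  have pre: "?m -` B \<in> sets borel" using measurable_sets[OF m B] by simp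
  have Q: "?Q \<in> sets borel" by (simp add: borel_Times)
  have "emeasure lborel ?Q = ennreal (2 * pi) * ennreal (2 * pi)"
    unfolding lborel_prod[symmetric] by (simp add: lborel.emeasure_pair_measure_Times)
  then have eQ: "emeasure lborel ?Q = ennreal (4 * pi\<^sup>2)"
    by (simp add: ennreal_mult[symmetric] power2_eq_square)
  have "emeasure (mu \<beta>) B = emeasure (uniform_measure lborel ?Q) (?m -` B)"
    unfolding mu using m B by (subst emeasure_distr) auto
  also have "\<dots> = emeasure lborel (?Q \<inter> ?m -` B) / ennreal (4 * pi\<^sup>2)"
    unfolding eQ[symmetric] using pre Q by (intro emeasure_uniform_measure) auto
  also have "\<dots> = ennreal (1 / (4 * pi\<^sup>2)) * emeasure lborel (?Q \<inter> ?m -` B)"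
  proof -
    have "inverse (ennreal (4 * pi\<^sup>2)) = ennreal (1 / (4 * pi\<^sup>2))"
      by (subst inverse_ennreal) (simp_all add: inverse_eq_divide)
    then show ?thesis unfolding divide_ennreal_def by (simp only: mult.commute)
  qed
  finally have "ennreal (2 * pi) * emeasure (mu \<beta>) B =
      ennreal (2 * pi * (1 / (4 * pi\<^sup>2))) * emeasure lborel (?Q \<inter> ?m -` B)"
    by (subst ennreal_mult) (simp_all only: mult.assoc, simp_all)
  also have "2 * pi * (1 / (4 * pi\<^sup>2)) = 1 / (2 * pi)" by (simp add: power2_eq_square)
  also have "ennreal (1 / (2 * pi)) * emeasure lborel (?Q \<inter> ?m -` B) =
      (\<integral>\<^sup>+y. ennreal (1 / (2 * pi)) * indicator (?Q \<inter> ?m -` B) y \<partial>lborel)"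
    using pre Q by (subst nn_integral_cmult_indicator) auto
  also have "\<dots> = (\<integral>\<^sup>+y. ennreal (1 / (2 * pi)) * indicator ?Q y * indicator B (limit_map (\<beta>, y)) \<partial>lborel)"
    by (rule nn_integral_cong) (auto simp: indicator_def)
  finally show ?thesis .
qed

lemma limit_varifold_eq:
  "limit_varifold = distr (density lborel (\<lambda>z. ennreal (1 / (2 * pi) * indicator limit_box z))) LegG_borel limit_map"
    (is "_ = ?N")
  unfolding limit_varifold_def
proof (rule measure_of_eq_measure)
  fix B assume B: "B \<in> sets LegG_borel"
  let ?Q = "{0..2 * pi} \<times> {0..2 * pi :: real}" and ?I = "{0..2 * pi :: real}"
  have pre: "limit_map -` B \<in> sets borel" using measurable_sets[OF limit_map_measurable B] by simp
  have bx: "limit_box \<in> sets borel" unfolding limit_box_cbox by simp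
  have m1: "(\<lambda>\<beta>. \<integral>\<^sup>+y. ennreal (1 / (2 * pi)) * indicator limit_box (\<beta>, y) * indicator (limit_map -` B) (\<beta>, y) \<partial>lborel)
      \<in> borel_measurable lborel"
    by (rule lborel.borel_measurable_nn_integral_fst) (use pre bx in \<open>simp add: lborel_prod\<close>)
  have e: "ennreal (2 * pi) * (emeasure (mu \<beta>) B * indicator ?I \<beta>) =
      (\<integral>\<^sup>+y. ennreal (1 / (2 * pi)) * indicator limit_box (\<beta>, y) * indicator (limit_map -` B) (\<beta>, y) \<partial>lborel)" for \<beta>
  proof -
    have "ennreal (2 * pi) * (emeasure (mu \<beta>) B * indicator ?I \<beta>) =
      (\<integral>\<^sup>+y. ennreal (1 / (2 * pi)) * indicator ?Q y * indicator B (limit_map (\<beta>, y)) \<partial>lborel) * indicator ?I \<beta>"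
      unfolding emeasure_mu[OF B, symmetric] by (simp add: mult.assoc)
    also have "\<dots> = (\<integral>\<^sup>+y. ennreal (1 / (2 * pi)) * indicator limit_box (\<beta>, y) * indicator (limit_map -` B) (\<beta>, y) \<partial>lborel)"
      by (cases "\<beta> \<in> ?I") (auto simp: limit_box_def indicator_def intro!: nn_integral_cong)
    finally show ?thesis .
  qed
  have "ennreal (2 * pi) * (\<integral>\<^sup>+\<beta>\<in>?I. emeasure (mu \<beta>) B \<partial>lborel) =
      (\<integral>\<^sup>+\<beta>. ennreal (2 * pi) * (emeasure (mu \<beta>) B * indicator ?I \<beta>) \<partial>lborel)"
  proof (rule nn_integral_cmult[symmetric])
    \<comment> \<open>Measurability in \<beta> is known from Fubini for 2 pi times this function, so
      the factor is divided out again.\<close>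
    have "emeasure (mu \<beta>) B * indicator ?I \<beta> = ennreal (1 / (2 * pi)) * (ennreal (2 * pi) * (emeasure (mu \<beta>) B * indicator ?I \<beta>))" for \<beta>
      by (simp add: mult.assoc[symmetric] ennreal_mult[symmetric])
    then show "(\<lambda>\<beta>. emeasure (mu \<beta>) B * indicator ?I \<beta>) \<in> borel_measurable lborel"
      using m1 unfolding e by simp
  qed
  also have "\<dots> = (\<integral>\<^sup>+\<beta>. \<integral>\<^sup>+y. ennreal (1 / (2 * pi)) * indicator limit_box (\<beta>, y) * indicator (limit_map -` B) (\<beta>, y) \<partial>lborel \<partial>lborel)"
    by (simp only: e)
  also have "\<dots> = (\<integral>\<^sup>+z. ennreal (1 / (2 * pi)) * indicator limit_box z * indicator (limit_map -` B) z \<partial>lborel)"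
    unfolding lborel_prod[symmetric, where 'a = real and 'b = "real \<times> real"]
    by (rule lborel.nn_integral_fst) (use pre bx in \<open>simp add: lborel_prod\<close>)
  also have "\<dots> = (\<integral>\<^sup>+z. ennreal (1 / (2 * pi) * indicator limit_box z) * indicator (limit_map -` B) z \<partial>lborel)"
    by (rule nn_integral_cong) (simp add: indicator_def)
  also have "\<dots> = emeasure (density lborel (\<lambda>z. ennreal (1 / (2 * pi) * indicator limit_box z))) (limit_map -` B)"
    using pre bx by (subst emeasure_density) auto
  also have "\<dots> = emeasure ?N B"
    using B limit_map_measurable by (subst emeasure_distr) auto
  finally show "ennreal (2 * pi) * (\<integral>\<^sup>+\<beta>\<in>?I. emeasure (mu \<beta>) B \<partial>lborel) = emeasure ?N B" .
qed simp

text \<open>The shifts by \<beta> - pi/2 in \<open>limit_angle\<close> disappear by translation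
  invariance, which leaves the uniform average over three independent phases: the same value that
  \<open>equidistribution\<close> produces.\<close>

lemma integral_limit_varifold:
  assumes \<Phi>: "\<Phi> \<in> borel_measurable LegG_borel"
    and G: "torus_family G" "\<And>a b c. \<Phi> (legendrian_pair 0 (vector [a, b, c])) = G 0 a b c"
  shows "(\<integral>x. \<Phi> x \<partial>limit_varifold) =
    circ_int (\<lambda>c. circ_int (\<lambda>a. circ_int (\<lambda>b. G 0 a b c))) / (2 * pi)"
proof -
  interpret torus_family G by (rule G)
  define g where "g = (\<lambda>z :: real \<times> real \<times> real. G 0 (fst z + fst (snd z) - pi / 2) (fst z + snd (snd z) - pi / 2) (fst z))"
  have \<Phi>g: "\<Phi> (limit_map z) = g z" for z
    by (simp add: limit_map_def limit_angle_def G(2) g_def)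
  have c: "continuous_on A g" for A
    unfolding g_def by (intro continuous_on_G continuous_intros)
  have b: "g \<in> borel_measurable lborel"
    using borel_measurable_continuous_onI[OF c[of UNIV]] by simp
  have bx: "limit_box \<in> sets borel" unfolding limit_box_cbox by simp
  have "(\<integral>x. \<Phi> x \<partial>limit_varifold) = (\<integral>z. (1 / (2 * pi) * indicator limit_box z) * g z \<partial>lborel)"
  proof -
    have m: "limit_map \<in> density lborel (\<lambda>z. ennreal (1 / (2 * pi) * indicator limit_box z)) \<rightarrow>\<^sub>M LegG_borel"
      using limit_map_measurable by simp
    show ?thesis
      unfolding limit_varifold_eq integral_distr[OF m \<Phi>] \<Phi>g
      using bx b by (subst integral_density) auto
  qed
  also have "\<dots> = (LINT z:limit_box|lborel. g z) / (2 * pi)"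
    by (simp add: set_lebesgue_integral_def)
  also have "(LINT z:limit_box|lborel. g z) = integral limit_box g"
    unfolding limit_box_cbox
    by (rule set_borel_integral_eq_integral(2))
       (use borel_integrable_compact[OF compact_cbox c] in \<open>simp add: set_integrable_def\<close>)
  also have "\<dots> = circ_int (\<lambda>\<beta>. integral (cbox (0, 0) (2 * pi, 2 * pi)) (\<lambda>y. g (\<beta>, y)))"
    unfolding limit_box_cbox by (simp add: integral_prod_continuous[OF c])
  also have "\<dots> = circ_int (\<lambda>c. circ_int (\<lambda>a. circ_int (\<lambda>b. G 0 a b c)))"
  proof (rule integral_cong)
    fix \<beta>
    have "continuous_on (cbox (0, 0) (2 * pi, 2 * pi)) (\<lambda>y. g (\<beta>, y))"
      unfolding g_def by (intro continuous_on_G continuous_intros)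
    from integral_prod_continuous[OF this]
    have "integral (cbox (0, 0) (2 * pi, 2 * pi)) (\<lambda>y. g (\<beta>, y)) =
        circ_int (\<lambda>\<tau>. circ_int (\<lambda>\<eta>. G 0 (\<tau> + (\<beta> - pi / 2)) (\<eta> + (\<beta> - pi / 2)) \<beta>))"
      by (simp add: g_def algebra_simps)
    also have "\<dots> = circ_int (\<lambda>\<tau>. circ_int (\<lambda>b. G 0 (\<tau> + (\<beta> - pi / 2)) b \<beta>))"
      by (rule integral_cong, rule circ_int_shift) (intro continuous_on_G continuous_intros, rule per)
    also have "\<dots> = circ_int (\<lambda>a. circ_int (\<lambda>b. G 0 a b \<beta>))"
      by (rule circ_int_shift, rule continuous_on_circ_int) (intro continuous_on_G continuous_intros, simp add: per)
    finally show "integral (cbox (0, 0) (2 * pi, 2 * pi)) (\<lambda>y. g (\<beta>, y)) = \<dots>" .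
  qed
  finally show ?thesis .
qed

lemma legendrian_varifold_limit: "legendrian_varifold limit_varifold"
  unfolding legendrian_varifold_def
proof (intro conjI)
  show "sets limit_varifold = sets LegG_borel" unfolding limit_varifold_eq by simp
  then show "space limit_varifold = LegG" by (metis sets_eq_imp_space_eq space_LegG_borel)
  let ?d = "\<lambda>z. ennreal (1 / (2 * pi) * indicator limit_box z)"
  have bx: "limit_box \<in> sets borel" unfolding limit_box_cbox by simp
  have "emeasure (density lborel ?d) UNIV = (\<integral>\<^sup>+z. ennreal (1 / (2 * pi)) * indicator limit_box z \<partial>lborel)"
    using bx by (subst emeasure_density) (auto intro!: nn_integral_cong simp: indicator_def)
  also have "\<dots> = ennreal (1 / (2 * pi)) * emeasure lborel limit_box"
    using bx by (simp add: nn_integral_cmult)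
  also have "\<dots> < \<infinity>"
  proof -
    have "emeasure lborel limit_box < \<infinity>"
      unfolding limit_box_cbox by (rule emeasure_compact_finite[OF compact_cbox])
    then show ?thesis by (simp add: ennreal_mult_less_top)
  qed
  finally have "finite_measure (density lborel ?d)" by (intro finite_measureI) simp
  then show "finite_measure limit_varifold"
    unfolding limit_varifold_eq
    by (rule finite_measure.finite_measure_distr) (use limit_map_measurable in simp)
qed

section \<open>Divergence along a plane\<close>

lemma trace_orthonormal_pair:
  fixes e f :: "'a::real_inner"
  assumes D: "linear D" and ef: "norm e = 1" "norm f = 1" "e \<bullet> f = 0"
    and Z: "norm Z1 = 1" "norm Z2 = 1" "Z1 \<bullet> Z2 = 0" "Z1 \<in> span {e, f}" "Z2 \<in> span {e, f}"
  shows "D Z1 \<bullet> Z1 + D Z2 \<bullet> Z2 = D e \<bullet> e + D f \<bullet> f"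
proof -
  obtain a b where 1: "Z1 = a *\<^sub>R e + b *\<^sub>R f" by (rule span_pairE[OF Z(4)])
  obtain c d where 2: "Z2 = c *\<^sub>R e + d *\<^sub>R f" by (rule span_pairE[OF Z(5)])
  have n: "e \<bullet> e = 1" "f \<bullet> f = 1" "f \<bullet> e = 0" using ef by (simp_all add: norm_eq_1 inner_commute)
  have o: "a * a + b * b = 1" "c * c + d * d = 1" "a * c + b * d = 0"
    using Z(1-3) by (simp_all add: norm_eq_1 1 2 inner_add_left inner_add_right n ef(3) mult.commute)
  \<comment> \<open>The matrix of the new frame has orthonormal rows, hence orthonormal
    columns.\<close>
  have q: "a * a + c * c = 1" "a * b + c * d = 0" "b * b + d * d = 1"
    using o by algebra+
  have "D Z1 \<bullet> Z1 + D Z2 \<bullet> Z2 = (a * a + c * c) * (D e \<bullet> e) + (a * b + c * d) * (D e \<bullet> f + D f \<bullet> e) +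
      (b * b + d * d) * (D f \<bullet> f)"
    by (simp add: 1 2 linear_add[OF D] linear_scale[OF D] inner_add_left inner_add_right algebra_simps)
  then show ?thesis by (simp add: q)
qed

text \<open>Invariance of the trace leaves exactly one value for the choice in
  \<open>plane_div\<close>. The tangential projection in \<open>nablaS5\<close> drops out because
  the plane is orthogonal to \<open>p\<close>.\<close>

lemma plane_div_eq:
  assumes D: "(W has_derivative D) (at p within S5)" and p: "p \<in> S5" "p \<bullet> e = 0" "p \<bullet> f = 0"
    and ef: "norm e = 1" "norm f = 1" "e \<bullet> f = 0"
  shows "plane_div W (span {e, f}) p = D e \<bullet> e + D f \<bullet> f"
proof -
  have nab: "nablaS5 W p Z \<bullet> Z = D Z \<bullet> Z" if "Z \<in> span {e, f}" for Z
  proof -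
    have "p \<bullet> Z = 0"
      using that by (elim span_pairE) (simp add: inner_add_right p)
    then show ?thesis
      using dS5_eq[OF D p(1)] by (simp add: nablaS5_def inner_diff_left)
  qed
  have "(\<exists>Z1 Z2. norm Z1 = 1 \<and> norm Z2 = 1 \<and> Z1 \<bullet> Z2 = 0 \<and> span {Z1, Z2} = span {e, f} \<and>
     s = nablaS5 W p Z1 \<bullet> Z1 + nablaS5 W p Z2 \<bullet> Z2) \<longleftrightarrow> s = D e \<bullet> e + D f \<bullet> f" for s
  proof
    assume "\<exists>Z1 Z2. norm Z1 = 1 \<and> norm Z2 = 1 \<and> Z1 \<bullet> Z2 = 0 \<and> span {Z1, Z2} = span {e, f} \<and>
     s = nablaS5 W p Z1 \<bullet> Z1 + nablaS5 W p Z2 \<bullet> Z2"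
    then obtain Z1 Z2 where Z: "norm Z1 = 1" "norm Z2 = 1" "Z1 \<bullet> Z2 = 0" "span {Z1, Z2} = span {e, f}"
     "s = nablaS5 W p Z1 \<bullet> Z1 + nablaS5 W p Z2 \<bullet> Z2" by blast
    have i: "Z1 \<in> span {e, f}" "Z2 \<in> span {e, f}"
      unfolding Z(4)[symmetric] by (auto intro: span_base)
    show "s = D e \<bullet> e + D f \<bullet> f"
      using trace_orthonormal_pair[OF has_derivative_linear[OF D] ef Z(1-3) i] by (simp add: Z(5) nab i)
  next
    assume "s = D e \<bullet> e + D f \<bullet> f"
    then show "\<exists>Z1 Z2. norm Z1 = 1 \<and> norm Z2 = 1 \<and> Z1 \<bullet> Z2 = 0 \<and> span {Z1, Z2} = span {e, f} \<and>
     s = nablaS5 W p Z1 \<bullet> Z1 + nablaS5 W p Z2 \<bullet> Z2"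
      using ef by (intro exI[of _ e] exI[of _ f]) (simp add: nab span_base)
  qed
  then show ?thesis by (simp add: plane_div_def)
qed

section \<open>The sequence of tori and its limit\<close>

text \<open>Chosen so that the squared cotangent of the angle is \<open>Suc k\<close>.\<close>

definition omega_seq :: "nat \<Rightarrow> real" where "omega_seq k = arctan (1 / sqrt (real (Suc k)))"
text \<open>The period that makes the torus Legendrian, by solving \<open>R_sin\<close> for
  R.\<close>

definition period_seq :: "nat \<Rightarrow> real" where "period_seq k = cos (omega_seq k) / (sin (omega_seq k))\<^sup>2"

lemma torus_omega_seq: "torus (omega_seq k) (period_seq k) (Suc k)"
proof
  have c: "cos (omega_seq k) > 0" unfolding omega_seq_def by (rule cos_gt_zero_pi[OF arctan_lbound arctan_ubound])
  have t: "sin (omega_seq k) / cos (omega_seq k) = 1 / sqrt (real (Suc k))"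
    using tan_arctan[of "1 / sqrt (real (Suc k))"] unfolding omega_seq_def tan_def .
  then have s: "sin (omega_seq k) = cos (omega_seq k) / sqrt (real (Suc k))"
    using c by (simp add: field_simps)
  show "sin (omega_seq k) > 0" unfolding s using c by simp
  then show "period_seq k * (sin (omega_seq k))\<^sup>2 = cos (omega_seq k)" by (simp add: period_seq_def)
  show "cos (omega_seq k) > 0" by (rule c)
  have "(sin (omega_seq k))\<^sup>2 * real (Suc k) = (cos (omega_seq k))\<^sup>2"
    unfolding s by (simp add: power_divide)
  with \<open>sin (omega_seq k) > 0\<close> show "period_seq k * cos (omega_seq k) = real (Suc k)"
    by (simp add: period_seq_def power2_eq_square divide_eq_eq mult.commute)
qed

lemma omega_seq_tendsto: "omega_seq \<longlonglongrightarrow> 0"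
proof -
  have "(\<lambda>k. 1 / sqrt (real (Suc k))) \<longlonglongrightarrow> 0"
    by (rule LIMSEQ_Suc) real_asymp
  from tendsto_arctan[OF this] show ?thesis by (simp add: omega_seq_def[abs_def])
qed

lemma period_seq_tendsto: "filterlim period_seq at_top sequentially"
proof (rule filterlim_at_top_mono)
  show "filterlim (\<lambda>k. real (Suc k)) at_top sequentially"
    using filterlim_compose[OF filterlim_real_sequentially filterlim_Suc] .
  show "\<forall>\<^sub>F k in sequentially. real (Suc k) \<le> period_seq k"
  proof (rule always_eventually, rule allI)
    fix k
    interpret torus "omega_seq k" "period_seq k" "Suc k" by (rule torus_omega_seq)
    have "period_seq k * cos (omega_seq k) \<le> period_seq k * 1"
      using R_pos by (intro mult_left_mono) auto
    then show "real (Suc k) \<le> period_seq k" by (simp add: R_cos)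
  qed
qed

lemma varifolds_converge:
  "varifold_converges (\<lambda>k. induced_varifold (period_seq k) (torus.u (omega_seq k) (period_seq k))
      (pd1 (torus.u (omega_seq k) (period_seq k))) (pd2 (torus.u (omega_seq k) (period_seq k))) (\<lambda>_. 1)) limit_varifold"
  unfolding varifold_converges_def torus.pd_u[OF torus_omega_seq]
proof (intro conjI allI impI)
  show "legendrian_varifold (induced_varifold (period_seq k) (torus.u (omega_seq k) (period_seq k))
      (torus.fr1 (omega_seq k) (period_seq k)) (torus.fr2 (omega_seq k) (period_seq k)) (\<lambda>_. 1))" for k
    by (rule torus.finite_induced_varifold[OF torus_omega_seq])
  show "legendrian_varifold limit_varifold" by (rule legendrian_varifold_limit)
  fix \<Phi> assume \<Phi>: "continuous_map LegG_topology euclideanreal \<Phi>"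
  define G where "G = (\<lambda>w a b c. \<Phi> (legendrian_pair w (vector [a, b, c])))"
  have G: "torus_family G" unfolding G_def by (rule torus_family_leg[OF \<Phi>])
  note m = measurable_from_LegG[OF \<Phi>]
  have I: "(\<integral>x. \<Phi> x \<partial>induced_varifold (period_seq k) (torus.u (omega_seq k) (period_seq k))
      (torus.fr1 (omega_seq k) (period_seq k)) (torus.fr2 (omega_seq k) (period_seq k)) (\<lambda>_. 1)) =
    cos (omega_seq k) * circ_int (\<lambda>x. circ_int (\<lambda>s. G (omega_seq k) (x + real (Suc k) * s) (- x + real (Suc k) * s) (- s)))" for k
    by (rule torus.integral_induced_varifold[OF torus_omega_seq m G]) (simp add: G_def)
  have "(\<lambda>k. cos (omega_seq k)) \<longlonglongrightarrow> cos 0" by (intro tendsto_cos omega_seq_tendsto)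
  from tendsto_mult[OF this torus_family.equidistribution[OF G omega_seq_tendsto]]
  show "(\<lambda>k. \<integral>x. \<Phi> x \<partial>induced_varifold (period_seq k) (torus.u (omega_seq k) (period_seq k))
      (torus.fr1 (omega_seq k) (period_seq k)) (torus.fr2 (omega_seq k) (period_seq k)) (\<lambda>_. 1)) \<longlonglongrightarrow> (\<integral>x. \<Phi> x \<partial>limit_varifold)"
    unfolding I using integral_limit_varifold[OF m G] by (simp add: G_def)
qed

lemma trig3_coef_pt_S5: "trig3 (coef_pt w) t \<in> S5"
  by (simp add: leg_frame)

text \<open>On the pairs that occur this is \<open>plane_div W\<close>, written with an extension of
  W and the explicit frame. In this form continuity and periodicity are visible, which the choice
  inside \<open>plane_div\<close> hides.\<close>

lemma torus_family_div:
  assumes We: "C1_on V We We'" "S5 \<subseteq> V"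
  shows "torus_family (\<lambda>w a b c. let t = vector [a, b, c]; p = trig3 (coef_pt w) t in
    We' p (trig3 coef1 t) \<bullet> trig3 coef1 t + We' p (trig3 (coef2 w) t) \<bullet> trig3 (coef2 w) t)"
proof
  have "trig3 (coef_pt w) t \<in> V" for w t using trig3_coef_pt_S5 We(2) by blast
  then show "continuous_on UNIV (\<lambda>(w, a, b, c). let t = vector [a, b, c]; p = trig3 (coef_pt w) t in
    We' p (trig3 coef1 t) \<bullet> trig3 coef1 t + We' p (trig3 (coef2 w) t) \<bullet> trig3 (coef2 w) t)"
    unfolding Let_def case_prod_beta
    by (intro continuous_intros C1_on_continuous_derivative[OF We(1)])
qed (simp_all add: trig3_shift_2pi Let_def)

lemma (in torus) first_variation_circ:
  assumes H: "hamiltonian_flow F W \<phi>"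
    and We: "C1_on N We We'" "S5 \<subseteq> N" "\<And>x. x \<in> S5 \<Longrightarrow> We x = W x"
    and G: "\<And>w a b c. G w a b c = (let t = vector [a, b, c]; p = trig3 (coef_pt w) t in
      We' p (trig3 coef1 t) \<bullet> trig3 coef1 t + We' p (trig3 (coef2 w) t) \<bullet> trig3 (coef2 w) t)"
  shows "circ_int (\<lambda>x. circ_int (\<lambda>s. G \<omega> (x + real n * s) (- x + real n * s) (- s))) = 0"
proof -
  have tf: "torus_family G"
    using torus_family_div[OF We(1,2)] unfolding G[symmetric] .
  then interpret torus_family G .
  have uV: "u x \<in> N" for x using u_in_S5 We(2) by blast
  have a: "vector [angle x $ 1, angle x $ 2, angle x $ 3] = angle x" for x
    by (simp add: angle_def)
  have e: "fr1 x \<bullet> We' (u x) (fr1 x) + fr2 x \<bullet> We' (u x) (fr2 x) =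
      (sin \<omega>)\<^sup>2 * G \<omega> (angle x $ 1) (angle x $ 2) (angle x $ 3)" for x
    unfolding G Let_def a
    by (simp add: fr1_def fr2_def wave_eq trig3_scaleR u_eq[symmetric] linear_scale[OF C1_on_linear[OF We(1) uV]]
        power2_eq_square inner_commute algebra_simps)
  have c: "continuous_on A (\<lambda>x. G \<omega> (angle x $ 1) (angle x $ 2) (angle x $ 3))" for A
    unfolding angle_def using R_pos by (auto intro!: continuous_on_G continuous_intros)
  \<comment> \<open>The whole torus has empty frontier, so \<open>first_variation\<close> admits
    every F here.\<close>
  have "(LINT x:torus_domain R|lborel. (sin \<omega>)\<^sup>2 * G \<omega> (angle x $ 1) (angle x $ 2) (angle x $ 3)) = 0"
    using first_variation[of UNIV, OF _ _ H _ We] by (simp add: e torus_periodic_def)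
  then have "(LINT x:torus_domain R|lborel. G \<omega> (angle x $ 1) (angle x $ 2) (angle x $ 3)) = 0"
    using sin_pos by simp
  then have "integral (cbox (0, 0) (2 * pi, 2 * pi * R)) (\<lambda>x. G \<omega> (angle x $ 1) (angle x $ 2) (angle x $ 3)) = 0"
    unfolding torus_domain_def set_integral_box_eq_integral(2)[OF c] .
  then show ?thesis using integral_torus_family[OF tf] cos_pos by simp
qed

text \<open>The first variation of each torus is exactly 0, and by \<open>equidistribution\<close>
  these zeros converge to the average of the divergence over the limit.\<close>

lemma limit_stationary: "hamiltonian_stationary_varifold limit_varifold"
  unfolding hamiltonian_stationary_varifold_def
proof (intro conjI allI impI legendrian_varifold_limit)
  fix F W assume "smooth_on S5 F \<and> hamiltonian_field F W"
  then obtain \<phi> where H: "hamiltonian_flow F W \<phi>" by (auto simp: hamiltonian_field_def)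
  obtain V We We' where We: "open V" "S5 \<subseteq> V" "C1_on V We We'" "\<And>x. x \<in> S5 \<Longrightarrow> We x = W x"
    using H smooth_on_imp_C1_on[of S5 W] unfolding hamiltonian_flow_def by metis
  define G where "G = (\<lambda>w a b c. let t = vector [a, b, c]; p = trig3 (coef_pt w) t in
    We' p (trig3 coef1 t) \<bullet> trig3 coef1 t + We' p (trig3 (coef2 w) t) \<bullet> trig3 (coef2 w) t)"
  have tf: "torus_family G" unfolding G_def by (rule torus_family_div[OF We(3,2)])
  let ?\<Phi> = "\<lambda>(P, p). plane_div W P p"
  have \<Phi>: "?\<Phi> (legendrian_pair w (vector [a, b, c])) = G w a b c" for w a b c
    unfolding legendrian_pair_def G_def Let_def prod.case
    by (rule plane_div_eq[OF C1_on_derivative_within_S5[OF We(3,2,4) trig3_coef_pt_S5] trig3_coef_pt_S5])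
       (simp_all add: leg_frame trig3_inner frame_algebra)
  have "(\<lambda>k. 0) \<longlonglongrightarrow> circ_int (\<lambda>c. circ_int (\<lambda>a. circ_int (\<lambda>b. G 0 a b c))) / (2 * pi)"
    using torus_family.equidistribution[OF tf omega_seq_tendsto]
      torus.first_variation_circ[OF torus_omega_seq H We(3,2,4), of G] by (simp add: G_def)
  then have 0: "circ_int (\<lambda>c. circ_int (\<lambda>a. circ_int (\<lambda>b. G 0 a b c))) / (2 * pi) = 0"
    by (simp add: LIMSEQ_const_iff)
  show "(\<integral>(P, p). plane_div W P p \<partial>limit_varifold) = 0"
  proof (cases "?\<Phi> \<in> borel_measurable LegG_borel")
    case True
    from integral_limit_varifold[OF this tf \<Phi>] 0 show ?thesis by simp
  next
    case False
    \<comment> \<open>The Bochner integral of a non-measurable function is \<open>0\<close> by convention.\<close>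
    have s: "sets limit_varifold = sets LegG_borel"
      using legendrian_varifold_limit by (simp add: legendrian_varifold_def)
    have "\<not> integrable limit_varifold ?\<Phi>"
      using False borel_measurable_integrable[of limit_varifold ?\<Phi>] measurable_cong_sets[OF s refl] by blast
    then show ?thesis by (rule not_integrable_integral_eq)
  qed
qed

section \<open>The fibre is null for the two-dimensional Hausdorff measure\<close>

lemma dist_cis_le: "dist (cis a) (cis b) \<le> \<bar>a - b\<bar>"
proof -
  have "(dist (cis a) (cis b))\<^sup>2 = (cos a - cos b)\<^sup>2 + (sin a - sin b)\<^sup>2"
    by (simp add: dist_norm cmod_power2)
  also have "\<dots> = ((cos a)\<^sup>2 + (sin a)\<^sup>2) + ((cos b)\<^sup>2 + (sin b)\<^sup>2) - 2 * (cos a * cos b + sin a * sin b)"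
    by (simp only: power2_eq_square) algebra
  also have "\<dots> = 2 - 2 * cos (2 * ((a - b) / 2))"
  proof -
    have "2 * ((a - b) / 2) = a - b" by (simp add: field_simps)
    then show ?thesis by (simp only: cos_diff sin_cos_squared_add2)
  qed
  also have "\<dots> = 4 * (sin ((a - b) / 2))\<^sup>2"
    unfolding cos_double_sin by simp
  also have "\<dots> \<le> 4 * ((a - b) / 2)\<^sup>2"
    by (rule mult_left_mono[OF abs_le_square_iff[THEN iffD1, OF abs_sin_x_le_abs_x]]) simp
  also have "\<dots> = \<bar>a - b\<bar>\<^sup>2" by (simp add: power_divide)
  finally show ?thesis by (rule power2_le_imp_le) simp
qed

lemma dist_fibre_point: "dist (fibre_point a) (fibre_point b) \<le> \<bar>a - b\<bar>"
proof -
  have "dist (fibre_point a) (fibre_point b) = dist (cis a) (cis b)"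
    by (simp add: dist_vec_def L2_set_def sum_3 fibre_point_def)
  then show ?thesis using dist_cis_le by simp
qed

definition fibre :: "C3 set" where "fibre = fibre_point ` {0..2 * pi}"

lemma fibre_point_in_fibre: "fibre_point \<beta> \<in> fibre"
proof -
  obtain m :: int and r where "r \<in> {0..2 * pi}" "\<beta> = r + 2 * pi * of_int m"
    using mod_2pi by metis
  moreover from this have "fibre_point \<beta> = fibre_point r"
    by (simp add: fibre_point_def flip: cis_mult)
  ultimately show ?thesis by (auto simp: fibre_def)
qed

lemma fibre_borel: "fibre \<in> sets borel"
proof -
  have "continuous_on {0..2 * pi} fibre_point"
    unfolding fibre_point_def cis_conv_exp by (intro continuous_intros)
  then have "compact fibre" unfolding fibre_def by (rule compact_continuous_image) simp
  then show ?thesis by (intro borel_closed compact_imp_closed)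
qed

lemma hausdorff2_outer_mono: "A \<subseteq> B \<Longrightarrow> hausdorff2_outer A \<le> hausdorff2_outer B"
  unfolding hausdorff2_outer_def hausdorff2_pre_def
  by (intro SUP_mono' INF_superset_mono) auto

text \<open>About N arcs of diameter at most h = 2 pi / N contribute a sum of order N h^2, hence of
  order 1 / N.\<close>

lemma hausdorff2_pre_fibre_le:
  assumes N: "N > 0" "2 * pi / real N \<le> \<delta>"
  shows "hausdorff2_pre \<delta> fibre \<le> ennreal (2 * pi ^ 3 / real N)"
proof -
  define h where "h = 2 * pi / real N"
  have h: "h > 0" "real N * h = 2 * pi" using N by (simp_all add: h_def)
  \<comment> \<open>There are \<open>N + 1\<close> arcs because the parameter 2 pi falls into the
    arc with index \<open>N\<close>; the factor 2 in the final bound absorbs the extra arc through N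
    + 1 \<le> 2 N.\<close>
  define C where "C = (\<lambda>i. if i \<le> N then fibre_point ` {h * real i..h * (real i + 1)} else {})"
  have d: "dist x y \<le> h" if "x \<in> C i" "y \<in> C i" for x y i
  proof -
    have "x \<in> fibre_point ` {h * real i..h * (real i + 1)}" "y \<in> fibre_point ` {h * real i..h * (real i + 1)}"
      using that by (auto simp: C_def split: if_splits)
    then obtain a b where ab: "x = fibre_point a" "y = fibre_point b" "a \<in> {h * real i..h * (real i + 1)}"
      "b \<in> {h * real i..h * (real i + 1)}"
      by (elim imageE)
    then have "\<bar>a - b\<bar> \<le> h" by (auto simp: algebra_simps)
    then show ?thesis using dist_fibre_point[of a b] ab by simp
  qed
  have b: "bounded (C i)" for i
    using d unfolding bounded_two_points by blast
  have di: "diameter (C i) \<le> h" "diameter (C i) \<ge> 0" for i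
  proof -
    show "diameter (C i) \<le> h" by (rule diameter_le) (use h d in \<open>auto simp: dist_norm\<close>)
    show "diameter (C i) \<ge> 0" by (rule diameter_ge_0[OF b])
  qed
  have cov: "fibre \<subseteq> (\<Union>i. C i)"
  proof
    fix p assume "p \<in> fibre"
    then obtain \<beta> where \<beta>: "0 \<le> \<beta>" "\<beta> \<le> 2 * pi" "p = fibre_point \<beta>" by (auto simp: fibre_def)
    define i where "i = nat \<lfloor>\<beta> / h\<rfloor>"
    have i: "real i = of_int \<lfloor>\<beta> / h\<rfloor>" using \<beta> h by (simp add: i_def)
    have "h * real i \<le> \<beta>" "\<beta> \<le> h * (real i + 1)"
      using floor_divide_lower[OF h(1), of \<beta>] floor_divide_upper[OF h(1), of \<beta>]
      by (simp_all add: i mult.commute)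
    moreover have "i \<le> N"
    proof -
      have "h * real i \<le> h * real N" using calculation(1) \<beta>(2) h(2) by (simp add: mult.commute)
      then show ?thesis using h(1) by simp
    qed
    ultimately show "p \<in> (\<Union>i. C i)" using \<beta>(3) by (auto simp: C_def)
  qed
  have "hausdorff2_pre \<delta> fibre \<le> (\<Sum>i. ennreal (pi * (diameter (C i) / 2)\<^sup>2))"
  proof -
    have "diameter (C i) \<le> \<delta>" for i
      using order_trans[OF di(1)] N(2) by (simp add: h_def)
    then show ?thesis
      unfolding hausdorff2_pre_def using cov b by (intro INF_lower) simp
  qed
  also have "\<dots> = (\<Sum>i\<le>N. ennreal (pi * (diameter (C i) / 2)\<^sup>2))"
    by (rule suminf_finite) (auto simp: C_def)
  also have "\<dots> \<le> (\<Sum>i\<le>N. ennreal (pi * (h / 2)\<^sup>2))"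
    using di by (intro sum_mono ennreal_leI mult_left_mono power_mono divide_right_mono) auto
  also have "\<dots> = ennreal (real (Suc N) * (pi * (h / 2)\<^sup>2))"
    by (simp add: ennreal_mult ennreal_of_nat_eq_real_of_nat[symmetric])
  also have "\<dots> \<le> ennreal (2 * pi ^ 3 / real N)"
  proof (rule ennreal_leI)
    have "real (Suc N) * (pi * (h / 2)\<^sup>2) \<le> 2 * real N * (pi * (h / 2)\<^sup>2)"
      using N(1) by (intro mult_right_mono) auto
    also have "\<dots> = 2 * pi ^ 3 / real N"
      using N(1) by (simp add: h_def power2_eq_square power3_eq_cube)
    finally show "real (Suc N) * (pi * (h / 2)\<^sup>2) \<le> 2 * pi ^ 3 / real N" .
  qed
  finally show ?thesis .
qed

lemma hausdorff2_outer_fibre: "hausdorff2_outer fibre = 0"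
proof -
  have "hausdorff2_pre \<delta> fibre = 0" if \<delta>: "\<delta> > 0" for \<delta>
  proof -
    have "(\<lambda>N. ennreal (2 * pi ^ 3 / real N)) \<longlonglongrightarrow> ennreal 0"
      by (intro tendsto_ennrealI lim_const_over_n)
    moreover have "\<exists>M. \<forall>N\<ge>M. hausdorff2_pre \<delta> fibre \<le> ennreal (2 * pi ^ 3 / real N)"
    proof -
      obtain M where M: "2 * pi / \<delta> < real M" using reals_Archimedean2 by blast
      have "hausdorff2_pre \<delta> fibre \<le> ennreal (2 * pi ^ 3 / real N)" if "N \<ge> M" for N
      proof (rule hausdorff2_pre_fibre_le)
        have "2 * pi / \<delta> < real N" using M that by (meson less_le_trans of_nat_mono)
        moreover have "0 < 2 * pi / \<delta>" using \<delta> by simp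
        ultimately have "0 < real N" by linarith
        with \<open>2 * pi / \<delta> < real N\<close> \<delta> show "N > 0" "2 * pi / real N \<le> \<delta>"
          by (simp_all add: field_simps)
      qed
      then show ?thesis by blast
    qed
    ultimately have "hausdorff2_pre \<delta> fibre \<le> ennreal 0" by (rule LIMSEQ_le_const)
    then show ?thesis by simp
  qed
  then show ?thesis by (simp add: hausdorff2_outer_def)
qed

text \<open>On any set, measurable or not, \<open>emeasure\<close> of a \<open>measure_of\<close> is
  either the given set function or 0.\<close>

lemma emeasure_hausdorff2_le: "emeasure hausdorff2 A \<le> hausdorff2_outer A"
  by (simp add: hausdorff2_def emeasure_measure_of_conv)

text \<open>Monotonicity of the outer measure suffices: the level sets of a simple function below \<open>f\<close> are
  subsets of \<open>C\<close>.\<close>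

lemma nn_integral_hausdorff2_null:
  assumes f: "\<And>x. x \<notin> C \<Longrightarrow> f x = 0" and C: "hausdorff2_outer C = 0"
  shows "(\<integral>\<^sup>+x. f x \<partial>hausdorff2) = 0"
proof -
  have "integral\<^sup>S hausdorff2 g = 0" if "g \<le> f" for g
    unfolding simple_integral_def
  proof (rule sum.neutral, rule ballI)
    fix y assume "y \<in> g ` space hausdorff2"
    show "y * emeasure hausdorff2 (g -` {y} \<inter> space hausdorff2) = 0"
    proof (cases "y = 0")
      case False
      have "g -` {y} \<inter> space hausdorff2 \<subseteq> C"
      proof
        fix x assume "x \<in> g -` {y} \<inter> space hausdorff2"
        then have "f x \<noteq> 0" using that False by (auto simp: le_fun_def) (metis le_zero_eq)
        then show "x \<in> C" using f by blast
      qed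
      from order_trans[OF emeasure_hausdorff2_le hausdorff2_outer_mono[OF this]]
      show ?thesis by (simp add: C)
    qed simp
  qed
  then show ?thesis
    unfolding nn_integral_def by (auto intro!: SUP_eqI)
qed

text \<open>Rectifiability would express the weight of the fibre as an integral over a null set. But
  every point of \<open>limit_map\<close> lies over the fibre, so the whole varifold would vanish,
  against its positive total mass.\<close>

lemma limit_not_rectifiable: "\<not> rectifiable_varifold limit_varifold"
proof
  assume "rectifiable_varifold limit_varifold"
  then obtain M \<theta> where
    "emeasure (weight limit_varifold) fibre = (\<integral>\<^sup>+y\<in>M \<inter> fibre. ennreal (\<theta> y) \<partial>hausdorff2)"
    unfolding rectifiable_varifold_def using fibre_borel by blast
  also have "\<dots> = 0"
    by (rule nn_integral_hausdorff2_null[OF _ hausdorff2_outer_fibre]) auto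
  finally have w: "emeasure (weight limit_varifold) fibre = 0" .
  have V: "sets limit_varifold = sets LegG_borel" "space limit_varifold = LegG" "finite_measure limit_varifold"
    using legendrian_varifold_limit by (simp_all add: legendrian_varifold_def)
  have s: "snd \<in> limit_varifold \<rightarrow>\<^sub>M borel"
    using snd_measurable_LegG measurable_cong_sets[OF V(1) refl] by blast
  have pre: "snd -` fibre \<inter> LegG \<in> sets LegG_borel"
    using measurable_sets[OF snd_measurable_LegG fibre_borel] by (simp add: space_LegG_borel)
  have "emeasure limit_varifold (snd -` fibre \<inter> LegG) = 0"
    using w emeasure_distr[OF s fibre_borel] by (simp add: weight_def V)
  then have "emeasure (density lborel (\<lambda>z. ennreal (1 / (2 * pi) * indicator limit_box z))) (limit_map -` (snd -` fibre \<inter> LegG)) = 0"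
    unfolding limit_varifold_eq using pre limit_map_measurable by (subst (asm) emeasure_distr) auto
  moreover have "limit_map -` (snd -` fibre \<inter> LegG) = UNIV"
  proof -
    have "snd (limit_map z) \<in> fibre" for z
      using fibre_point_in_fibre rotated_plane_leg[symmetric] by (simp add: limit_map_def)
    then show ?thesis by (auto simp: limit_map_def leg_in_LegG)
  qed
  moreover have "limit_map -` LegG = UNIV" by (auto simp: limit_map_def leg_in_LegG)
  ultimately have "emeasure limit_varifold LegG = 0"
    unfolding limit_varifold_eq using limit_map_measurable sets.top[of LegG_borel]
    by (subst emeasure_distr) (auto simp: space_LegG_borel)
  then have "measure limit_varifold (space limit_varifold) = 0" by (simp add: measure_def V(2))
  \<comment> \<open>The constant family 1 computes the total mass: (2 pi)^3 / (2 pi) = 4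
    pi^2.\<close>
  moreover have "torus_family (\<lambda>_ _ _ _. 1)" by unfold_locales simp_all
  from integral_limit_varifold[OF _ this, of "\<lambda>_. 1"]
  have "(\<integral>x. 1 \<partial>limit_varifold) = 4 * pi\<^sup>2" by (simp add: power2_eq_square)
  ultimately show False by simp
qed

theorem theoremA1:
  shows "\<exists>(R :: nat \<Rightarrow> real) (u :: nat \<Rightarrow> real \<times> real \<Rightarrow> C3).
    (\<forall>k. R k > 0) \<and> filterlim R at_top sequentially \<and>
    (\<forall>k. legendrian_embedding (R k) (u k) \<and> conformal (u k) \<and>
         hamiltonian_stationary_immersion (R k) (u k) \<and>
         PHSLV (R k) (u k) (pd1 (u k)) (pd2 (u k)) (\<lambda>_. 1)) \<and>
    varifold_converges
      (\<lambda>k. induced_varifold (R k) (u k) (pd1 (u k)) (pd2 (u k)) (\<lambda>_. 1)) limit_varifold \<and>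
    hamiltonian_stationary_varifold limit_varifold \<and>
    \<not> rectifiable_varifold limit_varifold"
proof (intro exI conjI allI)
  fix k
  interpret torus "omega_seq k" "period_seq k" "Suc k" by (rule torus_omega_seq)
  show "period_seq k > 0" by (rule R_pos)
  show "legendrian_embedding (period_seq k) (torus.u (omega_seq k) (period_seq k))" by (rule legendrian_embedding_u)
  show "conformal (torus.u (omega_seq k) (period_seq k))" by (rule conformal_u)
  show "hamiltonian_stationary_immersion (period_seq k) (torus.u (omega_seq k) (period_seq k))"
    by (rule hamiltonian_stationary_immersion_u)
  show "PHSLV (period_seq k) (torus.u (omega_seq k) (period_seq k)) (pd1 (torus.u (omega_seq k) (period_seq k))) (pd2 (torus.u (omega_seq k) (period_seq k))) (\<lambda>_. 1)"
    by (rule PHSLV_u)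
qed (rule period_seq_tendsto varifolds_converge limit_stationary limit_not_rectifiable)+

end
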